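(* The variety $\Sigma(3,2,5,6)$ has codimension $3$ in $G(5,S_2)$. (Here $N_1=23$, $N_2=25$.)
   Context: For positive integers $n,d,r,s$: let $V$ be a $\mathbb C$-vector space of dimension $n+1$ and $S_d=\mathrm{Sym}^d V$ (degree $d$ forms in $x_0,\dots,x_n$); assume $r\le s\le\dim S_d$. $G(r,S_d)$ is the Grassmannian of $r$-dimensional subspaces of $S_d$. $U_s\subseteq \mathrm{Sym}^s(\mathbb P S_1)$ is the open set of unordered $s$-tuples $\{Q_1,\dots,Q_s\}$ of linear forms (up to scalars) with $Q_1^d,\dots,Q_s^d$ linearly independent over $\mathbb C$. $\Sigma=\Sigma(n,d,r,s)\subseteq G(r,S_d)$ is the (constructible) set of all $\Lambda$ such that $\Lambda\subseteq \mathrm{span}(Q_1^d,\dots,Q_s^d)$ for some $\{Q_1,\dots,Q_s\}\in U_s$. Also $N_1=sn+r(s-r)$ and $N_2=\dim G(r,S_d)=r\left(\binom{n+d}{d}-r\right)$. In the present statement $(n,d,r,s)=(3,2,5,6)$. *)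

theory Defs
  imports
    "HOL-Analysis.Function_Topology"
    "HOL-Library.Extended_Nat"
    "HOL-Library.Poly_Mapping"
    "Jordan_Normal_Form.Determinant"
begin

text \<open>Complex polynomials in variables indexed by \<open>'v\<close>: finitely supported maps from exponent
  vectors to coefficients, with the (convolution) ring structure of \<^theory>\<open>HOL-Library.Poly_Mapping\<close>.\<close>

type_synonym 'v cpoly = "('v \<Rightarrow>\<^sub>0 nat) \<Rightarrow>\<^sub>0 complex"

definition monomials :: "'v set \<Rightarrow> nat \<Rightarrow> ('v \<Rightarrow>\<^sub>0 nat) set" where
  "monomials X d =
     {m. Poly_Mapping.keys m \<subseteq> X \<and> (\<Sum>i\<in>Poly_Mapping.keys m. Poly_Mapping.lookup m i) = d}"

definition forms :: "'v set \<Rightarrow> nat \<Rightarrow> 'v cpoly set" where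
  "forms X d = {p. Poly_Mapping.keys p \<subseteq> monomials X d}"

definition eval_poly :: "('v \<Rightarrow> complex) \<Rightarrow> 'v cpoly \<Rightarrow> complex" where
  "eval_poly a p = (\<Sum>m\<in>Poly_Mapping.keys p. Poly_Mapping.lookup p m *
     (\<Prod>i\<in>Poly_Mapping.keys m. a i ^ Poly_Mapping.lookup m i))"

definition poly_scale :: "complex \<Rightarrow> 'v cpoly \<Rightarrow> 'v cpoly" where
  "poly_scale c p = Poly_Mapping.single 0 c * p"

global_interpretation cpoly: vector_space poly_scale
  by unfold_locales
    (simp_all add: poly_scale_def algebra_simps single_add mult_single flip: mult.assoc)

text \<open>The space \<open>S\<^sub>d\<close> of degree \<open>d\<close> forms in \<open>x\<^sub>0, \<dots>, x\<^sub>n\<close>.\<close>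

definition forms_space :: "nat \<Rightarrow> nat \<Rightarrow> nat cpoly set" where
  "forms_space n d = forms {..n} d"

definition Grassmannian :: "nat \<Rightarrow> nat \<Rightarrow> nat \<Rightarrow> nat cpoly set set" where
  "Grassmannian n d r = {L. cpoly.subspace L \<and> L \<subseteq> forms_space n d \<and> cpoly.dim L = r}"

definition is_basis :: "nat \<Rightarrow> (nat \<Rightarrow> nat cpoly) \<Rightarrow> nat cpoly set \<Rightarrow> bool" where
  "is_basis r b L \<longleftrightarrow>
     inj_on b {..<r} \<and> cpoly.independent (b ` {..<r}) \<and> cpoly.span (b ` {..<r}) = L"

text \<open>Pluecker coordinates with respect to the monomial basis of \<open>S\<^sub>d\<close>. They are indexed by all
  \<open>r\<close>-tuples of degree \<open>d\<close> monomials rather than by increasing ones; the additional coordinates are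
  zero or agree with an increasing one up to sign, so the resulting Zariski topology is the usual one.\<close>

definition pluecker_indices :: "nat \<Rightarrow> nat \<Rightarrow> nat \<Rightarrow> (nat \<Rightarrow>\<^sub>0 nat) list set" where
  "pluecker_indices n d r = {I. length I = r \<and> set I \<subseteq> monomials {..n} d}"

definition pluecker :: "nat \<Rightarrow> (nat \<Rightarrow> nat cpoly) \<Rightarrow> (nat \<Rightarrow>\<^sub>0 nat) list \<Rightarrow> complex" where
  "pluecker r b I = Determinant.det (mat r r (\<lambda>(i, j). Poly_Mapping.lookup (b j) (I ! i)))"

text \<open>A change of basis multiplies all Pluecker coordinates by a common nonzero scalar, so for
  homogeneous \<open>F\<close> the condition below does not depend on the choice of the basis.\<close>

definition principal_open ::
    "nat \<Rightarrow> nat \<Rightarrow> nat \<Rightarrow> (nat \<Rightarrow>\<^sub>0 nat) list cpoly \<Rightarrow> nat cpoly set set" where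
  "principal_open n d r F =
     {L \<in> Grassmannian n d r. \<exists>b. is_basis r b L \<and> eval_poly (pluecker r b) F \<noteq> 0}"

text \<open>The Zariski topology on \<open>G(r, S\<^sub>d)\<close>, i.e. the one induced by the Pluecker embedding into
  projective space: the non-vanishing loci of homogeneous polynomials in the Pluecker coordinates
  form a basis of open sets.\<close>

definition zariski_Gr :: "nat \<Rightarrow> nat \<Rightarrow> nat \<Rightarrow> nat cpoly set topology" where
  "zariski_Gr n d r = topology_generated_by
     {principal_open n d r F | F e. F \<in> forms (pluecker_indices n d r) e}"

definition irreducible_in :: "'a topology \<Rightarrow> 'a set \<Rightarrow> bool" where
  "irreducible_in T Z \<longleftrightarrow> Z \<noteq> {} \<and>
     (\<forall>A B. closedin T A \<and> closedin T B \<and> Z \<subseteq> A \<union> B \<longrightarrow> Z \<subseteq> A \<or> Z \<subseteq> B)"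

text \<open>The empty space gets dimension \<open>0\<close> here.\<close>

definition krull_dim :: "'a topology \<Rightarrow> enat" where
  "krull_dim T = Sup {enat k | k. \<exists>Z. (\<forall>i\<le>k. closedin T (Z i) \<and> irreducible_in T (Z i)) \<and>
     (\<forall>i<k. Z i \<subset> Z (Suc i))}"

text \<open>Subtraction on \<^typ>\<open>enat\<close> is truncated and \<open>\<infinity> - k = \<infinity>\<close>; hence a finite positive value of the
  difference means that both dimensions are finite and that it is the true difference.\<close>

definition codim_in :: "'a topology \<Rightarrow> 'a set \<Rightarrow> enat" where
  "codim_in T A = krull_dim T - krull_dim (subtopology T A)"

text \<open>The points of \<open>U\<^sub>s\<close>, given by representatives: sets \<open>Q\<close> of \<open>s\<close> linear forms whose \<open>d\<close>-th powers
  are linearly independent. Independence makes the forms nonzero and pairwise non-proportional, and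
  neither it nor the span of the powers depends on the choice of the representatives.\<close>

definition power_independent_sets :: "nat \<Rightarrow> nat \<Rightarrow> nat \<Rightarrow> nat cpoly set set" where
  "power_independent_sets n d s = {Q. finite Q \<and> card Q = s \<and> Q \<subseteq> forms_space n 1 \<and>
     inj_on (\<lambda>q. q ^ d) Q \<and> cpoly.independent ((\<lambda>q. q ^ d) ` Q)}"

definition Sigma_var :: "nat \<Rightarrow> nat \<Rightarrow> nat \<Rightarrow> nat \<Rightarrow> nat cpoly set set" where
  "Sigma_var n d r s =
     {L \<in> Grassmannian n d r. \<exists>Q \<in> power_independent_sets n d s. L \<subseteq> cpoly.span ((\<lambda>q. q ^ d) ` Q)}"

definition N1 :: "nat \<Rightarrow> nat \<Rightarrow> nat \<Rightarrow> nat" where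
  "N1 n r s = s * n + r * (s - r)"

definition N2 :: "nat \<Rightarrow> nat \<Rightarrow> nat \<Rightarrow> nat" where
  "N2 n d r = r * (((n + d) choose d) - r)"

end

theory Submission
  imports Defs "HOL-Computational_Algebra.Fundamental_Theorem_Algebra"
begin

text \<open>
  Dimensions are bounded by comparing the growth of spaces of forms. Along a chain of \<open>k\<close> strict
  inclusions of irreducible closed sets one finds \<open>k\<close> forms whose monomials are linearly independent on
  the top set, so the forms of degree \<open>m\<close> restrict to a space of dimension at least of order \<open>m\<^sup>k\<close>; on a
  set dominated by \<open>N\<close> parameters this dimension is of order at most \<open>m\<^sup>N\<close>. Conversely, \<open>N\<close> parameters
  with injective differential at one point give a chain of length \<open>N\<close>.

  The expected dimension \<open>23\<close> of \<open>\<Sigma>\<close> is not attained because six general points of \<open>P\<^sup>3\<close> lie on a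
  twisted cubic \<open>C\<close>, and \<open>\<Lambda>\<close> has codimension \<open>2\<close> in the \<open>7\<close>-dimensional span of the squares of the points
  of \<open>C\<close>. The members of the pencil of binary sextics cutting out \<open>\<Lambda>\<close> there yield a one-parameter family
  of six-tuples for the same \<open>\<Lambda>\<close>. Hence \<open>12\<close> parameters for \<open>C\<close> and \<open>10 = dim G(5, 7)\<close> for \<open>\<Lambda>\<close> dominate
  \<open>\<Sigma>\<close>; degenerate six-tuples are reached by density along lines.
\<close>

subsection \<open>Polynomial functions of bounded degree in each variable\<close>

text \<open>\<open>Sigma_var\<close> is only constructible, so its dimension is that of a subspace
  topology. Comparing forms avoids fibre dimensions: it suffices to know which forms vanish along a
  parametrization. The two bounds can therefore use different parametrizations. The number 12 is
  that of twisted cubics (16 coefficients, less 1 for scaling and 3 for reparametrization), realized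
  by moving one root of each of three coordinates to a fixed place. From below, generic values must
  be actual points of \<Sigma>, so six linear forms are written down. With a hyperplane in the span
  of their squares they would have 18 + 5 = 23 parameters, one of them redundant; confining the last
  form to a plane removes it. Injectivity of the differential at a suitable base point then becomes
  a finite check with explicit dual functionals.\<close>

definition ebox :: "nat \<Rightarrow> nat \<Rightarrow> nat list set" where
  "ebox N D = {e. length e = N \<and> set e \<subseteq> {..D}}"

lemma finite_ebox [simp]: "finite (ebox N D)"
proof -
  have "ebox N D = {e. set e \<subseteq> {..D} \<and> length e = N}" by (auto simp: ebox_def)
  then show ?thesis by (simp add: finite_lists_length_eq)
qed

lemma card_ebox: "card (ebox N D) = (D + 1) ^ N"
proof -
  have "ebox N D = {e. set e \<subseteq> {..D} \<and> length e = N}" by (auto simp: ebox_def)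
  then show ?thesis by (simp add: card_lists_length_eq)
qed

lemma ebox_0 [simp]: "ebox 0 D = {[]}"
  by (auto simp: ebox_def)

lemma sum_list_ebox: "e \<in> ebox N D \<Longrightarrow> sum_list e \<le> N * D"
proof -
  have "sum_list e \<le> length e * D" if "set e \<subseteq> {..D}"
    using that by (induction e) auto
  then show "sum_list e \<le> N * D" if "e \<in> ebox N D"
    using that unfolding ebox_def by blast
qed

lemma sum_ebox_Suc: "(\<Sum>e\<in>ebox (Suc N) D. f e) = (\<Sum>m\<le>D. \<Sum>e\<in>ebox N D. f (e @ [m]))"
proof -
  have eq: "ebox (Suc N) D = (\<lambda>(m, e). e @ [m]) ` ({..D} \<times> ebox N D)"
  proof (intro equalityI subsetI)
    fix e assume "e \<in> ebox (Suc N) D"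
    then have e: "length e = Suc N" "set e \<subseteq> {..D}" by (auto simp: ebox_def)
    then obtain e' m where "e = e' @ [m]" by (metis append_butlast_last_id length_0_conv nat.simps(3))
    then show "e \<in> (\<lambda>(m, e). e @ [m]) ` ({..D} \<times> ebox N D)"
      using e by (auto simp: ebox_def image_iff)
  qed (auto simp: ebox_def)
  have inj: "inj_on (\<lambda>(m, e). e @ [m]) ({..D} \<times> ebox N D)"
    by (auto simp: inj_on_def)
  show ?thesis
    unfolding eq sum.reindex[OF inj] by (simp add: sum.cartesian_product case_prod_unfold)
qed

lemma ebox_snoc: "e @ [m] \<in> ebox (Suc N) D \<longleftrightarrow> e \<in> ebox N D \<and> m \<le> D"
  by (auto simp: ebox_def)

lemma ebox_SucE:
  assumes "e \<in> ebox (Suc N) D"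
  obtains e' m where "e = e' @ [m]" "e' \<in> ebox N D" "m \<le> D"
proof -
  from assms have e: "length e = Suc N" by (auto simp: ebox_def)
  then obtain e' m where "e = e' @ [m]" by (metis append_butlast_last_id length_0_conv nat.simps(3))
  then show ?thesis using that assms by (auto simp: ebox_snoc)
qed

definition lmon :: "(nat \<Rightarrow> 'a::comm_monoid_mult) \<Rightarrow> nat list \<Rightarrow> 'a" where
  "lmon x e = (\<Prod>i<length e. x i ^ (e ! i))"

lemma lmon_Nil [simp]: "lmon x [] = 1"
  by (simp add: lmon_def)

lemma lmon_snoc: "lmon x (e @ [m]) = lmon x e * x (length e) ^ m"
  by (simp add: lmon_def nth_append)

lemma lmon_mult:
  "length e = length e' \<Longrightarrow> lmon x e * lmon x e' = lmon x (map2 (+) e e')"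
  by (simp add: lmon_def power_add flip: prod.distrib)

lemma lmon_scale: "lmon (\<lambda>i. (c::'a::comm_ring_1) * x i) e = c ^ sum_list e * lmon x e"
  by (simp add: lmon_def power_mult_distrib prod.distrib sum_list_sum_nth atLeast0LessThan flip: power_sum)

text \<open>Bounding the degree in each variable separately makes the dimension at most the pure
  power \<open>(D + 1) ^ N\<close>, so growth rates are compared without binomial coefficients. The
  functions take infinite sequences and read the first \<open>N\<close> entries, so one type serves
  for every number of parameters.\<close>

definition polyfuns :: "nat \<Rightarrow> nat \<Rightarrow> ((nat \<Rightarrow> complex) \<Rightarrow> complex) set" where
  "polyfuns N D = {f. \<exists>a. \<forall>x. f x = (\<Sum>e\<in>ebox N D. a e * lmon x e)}"

lemma polyfuns_add: "f \<in> polyfuns N D \<Longrightarrow> g \<in> polyfuns N D \<Longrightarrow> (\<lambda>x. f x + g x) \<in> polyfuns N D"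
proof -
  assume "f \<in> polyfuns N D" "g \<in> polyfuns N D"
  then obtain a b where "\<And>x. f x = (\<Sum>e\<in>ebox N D. a e * lmon x e)"
    "\<And>x. g x = (\<Sum>e\<in>ebox N D. b e * lmon x e)" by (auto simp: polyfuns_def)
  then have "\<And>x. f x + g x = (\<Sum>e\<in>ebox N D. (a e + b e) * lmon x e)"
    by (simp add: algebra_simps sum.distrib)
  then show ?thesis unfolding polyfuns_def by (intro CollectI exI allI)
qed

lemma polyfuns_scale: "f \<in> polyfuns N D \<Longrightarrow> (\<lambda>x. c * f x) \<in> polyfuns N D"
proof -
  assume "f \<in> polyfuns N D"
  then obtain a where "\<And>x. f x = (\<Sum>e\<in>ebox N D. a e * lmon x e)" by (auto simp: polyfuns_def)
  then have "\<And>x. c * f x = (\<Sum>e\<in>ebox N D. (c * a e) * lmon x e)"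
    by (simp add: sum_distrib_left mult.assoc)
  then show ?thesis unfolding polyfuns_def by (intro CollectI exI allI)
qed

lemma polyfuns_zero: "(\<lambda>x. 0) \<in> polyfuns N D"
  unfolding polyfuns_def by (intro CollectI exI[of _ "\<lambda>_. 0"]) simp

lemma polyfuns_sum:
  "(\<And>i. i \<in> I \<Longrightarrow> f i \<in> polyfuns N D) \<Longrightarrow> (\<lambda>x. \<Sum>i\<in>I. f i x) \<in> polyfuns N D"
  by (induction I rule: infinite_finite_induct) (auto intro: polyfuns_zero polyfuns_add)

lemma polyfuns_lmon:
  assumes "e \<in> ebox N D" shows "(\<lambda>x. lmon x e) \<in> polyfuns N D"
proof -
  have "lmon x e = (\<Sum>e'\<in>ebox N D. (if e' = e then 1 else 0) * lmon x e')" for x :: "nat \<Rightarrow> complex"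
    using assms by (simp add: if_distrib[of "\<lambda>z. z * _"] sum.delta cong: if_cong)
  then show ?thesis unfolding polyfuns_def by (intro CollectI exI allI)
qed

lemma polyfunsE:
  assumes "f \<in> polyfuns N D"
  obtains a where "f = (\<lambda>x. \<Sum>e\<in>ebox N D. a e * lmon x e)"
  using assms by (auto simp: polyfuns_def)

lemma polyfuns_mono:
  assumes "f \<in> polyfuns N D" "D \<le> D'" shows "f \<in> polyfuns N D'"
proof -
  obtain a where f: "f = (\<lambda>x. \<Sum>e\<in>ebox N D. a e * lmon x e)" using polyfunsE[OF assms(1)] by blast
  have "ebox N D \<subseteq> ebox N D'" using assms(2) by (auto simp: ebox_def)
  then show ?thesis unfolding f by (intro polyfuns_sum polyfuns_scale polyfuns_lmon) auto
qed

lemma polyfuns_const: "(\<lambda>x. c) \<in> polyfuns N D"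
proof -
  have "(\<lambda>x. c * lmon x (replicate N 0)) \<in> polyfuns N D"
    by (intro polyfuns_scale polyfuns_lmon) (auto simp: ebox_def)
  moreover have "lmon x (replicate N 0) = 1" for x :: "nat \<Rightarrow> complex"
    by (simp add: lmon_def)
  ultimately show ?thesis by simp
qed

lemma polyfuns_coord:
  assumes "i < N" shows "(\<lambda>x. x i) \<in> polyfuns N 1"
proof -
  have "(\<lambda>x. lmon x ((replicate N 0)[i := 1])) \<in> polyfuns N 1"
    by (intro polyfuns_lmon) (auto simp: ebox_def dest: set_update_subset_insert[THEN subsetD])
  moreover have "lmon x ((replicate N 0)[i := 1]) = x i" for x :: "nat \<Rightarrow> complex"
  proof -
    have "lmon x ((replicate N 0)[i := 1]) = (\<Prod>j<N. if j = i then x i else 1)"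
      unfolding lmon_def using assms by (intro prod.cong) (auto simp: nth_list_update)
    then show ?thesis using assms by (simp add: prod.delta)
  qed
  ultimately show ?thesis by simp
qed

lemma polyfuns_mult:
  assumes "f \<in> polyfuns N D" "g \<in> polyfuns N D'"
  shows "(\<lambda>x. f x * g x) \<in> polyfuns N (D + D')"
proof -
  obtain a where f: "f = (\<lambda>x. \<Sum>e\<in>ebox N D. a e * lmon x e)" using polyfunsE[OF assms(1)] by blast
  obtain b where g: "g = (\<lambda>x. \<Sum>e\<in>ebox N D'. b e * lmon x e)" using polyfunsE[OF assms(2)] by blast
  have "f x * g x = (\<Sum>e\<in>ebox N D. \<Sum>e'\<in>ebox N D'. (a e * b e') * lmon x (map2 (+) e e'))" for x
    unfolding f g sum_product
  proof (intro sum.cong refl)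
    fix e e' assume "e \<in> ebox N D" "e' \<in> ebox N D'"
    then have "lmon x e * lmon x e' = lmon x (map2 (+) e e')" by (intro lmon_mult) (auto simp: ebox_def)
    then show "a e * lmon x e * (b e' * lmon x e') = a e * b e' * lmon x (map2 (+) e e')"
      by (metis mult.assoc mult.left_commute)
  qed
  moreover have "(\<lambda>x. \<Sum>e\<in>ebox N D. \<Sum>e'\<in>ebox N D'. (a e * b e') * lmon x (map2 (+) e e')) \<in> polyfuns N (D + D')"
  proof (intro polyfuns_sum polyfuns_scale polyfuns_lmon)
    fix e e' assume e: "e \<in> ebox N D" "e' \<in> ebox N D'"
    then show "map2 (+) e e' \<in> ebox N (D + D')"
      by (auto simp: ebox_def set_zip subset_iff intro!: add_mono)
  qed
  ultimately show ?thesis by presburger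
qed

lemma polyfuns_power:
  assumes "f \<in> polyfuns N D" shows "(\<lambda>x. f x ^ k) \<in> polyfuns N (k * D)"
proof (induction k)
  case 0 show ?case using polyfuns_const[of 1] by simp
next
  case (Suc k)
  from polyfuns_mult[OF assms Suc] show ?case by simp
qed

lemma polyfuns_prod:
  assumes "finite I" "\<And>i. i \<in> I \<Longrightarrow> f i \<in> polyfuns N (D i)"
  shows "(\<lambda>x. \<Prod>i\<in>I. f i x) \<in> polyfuns N (\<Sum>i\<in>I. D i)"
  using assms by (induction I rule: finite_induct) (auto intro: polyfuns_const polyfuns_mult)

lemma det_mat_Leibniz:
  "det (mat r r (\<lambda>(i, j). f i j)) =
    (\<Sum>p | p permutes {0..<r}. signof p * (\<Prod>i = 0..<r. f i (p i)))"
  by (subst det_def'[of _ r]) (auto simp: permutes_in_image intro!: sum.cong prod.cong)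

lemma polyfuns_det:
  assumes "\<And>i j. i < r \<Longrightarrow> j < r \<Longrightarrow> f i j \<in> polyfuns N D"
  shows "(\<lambda>x. det (mat r r (\<lambda>(i, j). f i j x))) \<in> polyfuns N (r * D)"
proof -
  have "(\<lambda>x. \<Sum>p | p permutes {0..<r}. signof p * (\<Prod>i = 0..<r. f i (p i) x)) \<in> polyfuns N (r * D)"
  proof (intro polyfuns_sum polyfuns_scale)
    fix p assume "p \<in> {p. p permutes {0..<r}}"
    then have "(\<lambda>x. \<Prod>i = 0..<r. f i (p i) x) \<in> polyfuns N (\<Sum>i = 0..<r. D)"
      by (intro polyfuns_prod assms) (auto simp: permutes_in_image)
    then show "(\<lambda>x. \<Prod>i = 0..<r. f i (p i) x) \<in> polyfuns N (r * D)" by simp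
  qed
  then show ?thesis by (simp only: det_mat_Leibniz)
qed

text \<open>Where the coordinates from \<open>i\<close> on vanish, a monomial containing one of them
  dies and every other one involves the first \<open>i\<close> variables only. This lowers the
  growth rate on the coordinate subspaces in \<open>krull_dim_ge\<close>.\<close>

lemma polyfuns_truncate:
  assumes "f \<in> polyfuns N D" "i \<le> N"
  obtains f' where "f' \<in> polyfuns i D" "\<And>x. (\<And>l. i \<le> l \<Longrightarrow> x l = 0) \<Longrightarrow> f x = f' x"
proof -
  obtain a where f: "f = (\<lambda>x. \<Sum>e\<in>ebox N D. a e * lmon x e)" using polyfunsE[OF assms(1)] by blast
  define g where "g e x = (if \<forall>l\<in>{i..<N}. e ! l = 0 then lmon x (take i e) else 0)" for e and x :: "nat \<Rightarrow> complex"
  have "(\<lambda>x. \<Sum>e\<in>ebox N D. a e * g e x) \<in> polyfuns i D"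
  proof (intro polyfuns_sum polyfuns_scale)
    fix e assume "e \<in> ebox N D"
    then have "take i e \<in> ebox i D" using assms(2) by (auto simp: ebox_def dest: in_set_takeD)
    then have "(\<lambda>x. lmon x (take i e)) \<in> polyfuns i D" by (rule polyfuns_lmon)
    moreover have "g e = (if \<forall>l\<in>{i..<N}. e ! l = 0 then \<lambda>x. lmon x (take i e) else (\<lambda>x. 0))"
      by (auto simp: g_def fun_eq_iff)
    ultimately show "g e \<in> polyfuns i D" by (simp add: polyfuns_zero)
  qed
  moreover have "f x = (\<Sum>e\<in>ebox N D. a e * g e x)" if x: "\<And>l. i \<le> l \<Longrightarrow> x l = 0" for x
    unfolding f
  proof (intro sum.cong refl arg_cong2[where f = "(*)"])
    fix e assume "e \<in> ebox N D"
    then have e: "length e = N" by (auto simp: ebox_def)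
    have "lmon x e = (\<Prod>l<i. x l ^ (e ! l)) * (\<Prod>l\<in>{i..<N}. x l ^ (e ! l))"
      unfolding lmon_def e using assms(2)
      by (subst prod.union_disjoint[symmetric]) (auto intro!: prod.cong)
    moreover have "(\<Prod>l<i. x l ^ (e ! l)) = lmon x (take i e)"
      using e assms(2) by (simp add: lmon_def)
    moreover have "(\<Prod>l\<in>{i..<N}. x l ^ (e ! l)) = (if \<forall>l\<in>{i..<N}. e ! l = 0 then 1 else 0)"
    proof (cases "\<forall>l\<in>{i..<N}. e ! l = 0")
      case False
      then obtain l where "l \<in> {i..<N}" "e ! l \<noteq> 0" by blast
      then have "(\<Prod>l\<in>{i..<N}. x l ^ (e ! l)) = 0"
        using x by (intro prod_zero) (auto intro!: bexI[of _ l])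
      with False show ?thesis by simp
    qed auto
    ultimately show "lmon x e = g e x" by (simp add: g_def)
  qed
  ultimately show ?thesis using that by blast
qed

section \<open>Independence of monomials, and linear dependence by counting\<close>

lemma lmon_independent:
  assumes "\<And>x. (\<Sum>e\<in>ebox N D. c e * lmon x e) = (0::complex)" "e \<in> ebox N D"
  shows "c e = 0"
  using assms
proof (induction N arbitrary: c e)
  case (Suc N)
  obtain e' m where e: "e = e' @ [m]" "e' \<in> ebox N D" "m \<le> D" using Suc.prems(2) by (rule ebox_SucE)
  have "(\<Sum>e\<in>ebox N D. c (e @ [m]) * lmon x e) = 0" for x
  proof -
    have "(\<Sum>j\<le>D. (\<Sum>e\<in>ebox N D. c (e @ [j]) * lmon x e) * y ^ j) = 0" for y
    proof -
      have lmon_upd: "lmon (x(N := y)) e = lmon x e" if "e \<in> ebox N D" for e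
        using that by (auto simp: lmon_def ebox_def intro!: prod.cong)
      have "0 = (\<Sum>e\<in>ebox (Suc N) D. c e * lmon (x(N := y)) e)" by (simp add: Suc.prems(1))
      also have "\<dots> = (\<Sum>j\<le>D. \<Sum>e\<in>ebox N D. c (e @ [j]) * (lmon (x(N := y)) e * y ^ j))"
        unfolding sum_ebox_Suc
        by (intro sum.cong refl) (auto simp: lmon_snoc ebox_def)
      also have "\<dots> = (\<Sum>j\<le>D. (\<Sum>e\<in>ebox N D. c (e @ [j]) * lmon x e) * y ^ j)"
        unfolding sum_distrib_right
        by (intro sum.cong refl) (simp add: lmon_upd mult.assoc)
      finally show ?thesis by simp
    qed
    then show ?thesis using polyfun_eq_0[of "\<lambda>j. \<Sum>e\<in>ebox N D. c (e @ [j]) * lmon x e" D] e(3) by simp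
  qed
  from Suc.IH[OF this e(2)] show ?case by (simp add: e)
qed simp

text \<open>Gaussian elimination, one equation at a time: an unknown \<open>p\<close> that occurs in
  equation \<open>m\<close> is eliminated from the others, which leaves one equation and one unknown
  less; its value is restored afterwards.\<close>

lemma underdetermined_system:
  fixes a :: "'e \<Rightarrow> 'm \<Rightarrow> 'f::field"
  assumes "finite M" "finite E" "card M < card E"
  shows "\<exists>c. (\<exists>e\<in>E. c e \<noteq> 0) \<and> (\<forall>m\<in>M. (\<Sum>e\<in>E. c e * a e m) = 0)"
  using assms
proof (induction M arbitrary: E a rule: finite_induct)
  case empty
  then obtain e where "e \<in> E" by fastforce
  then show ?case by (intro exI[of _ "\<lambda>_. 1"]) auto
next
  case (insert m M)
  show ?case
  proof (cases "\<forall>e\<in>E. a e m = 0")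
    case True
    have "card M < card E" using insert by auto
    from insert.IH[OF insert.prems(1) this, of a] True show ?thesis by auto
  next
    case False
    then obtain p where p: "p \<in> E" "a p m \<noteq> 0" by blast
    define a' where "a' e m' = a e m' - a e m / a p m * a p m'" for e m'
    have "card M < card (E - {p})" using insert p by auto
    from insert.IH[OF _ this, of a'] insert.prems obtain c where
      c: "\<exists>e\<in>E - {p}. c e \<noteq> 0" "\<And>m'. m' \<in> M \<Longrightarrow> (\<Sum>e\<in>E - {p}. c e * a' e m') = 0" by auto
    define d where "d = c(p := - (\<Sum>e\<in>E - {p}. c e * a e m) / a p m)"
    have split: "(\<Sum>e\<in>E. d e * a e m') = d p * a p m' + (\<Sum>e\<in>E - {p}. c e * a e m')" for m'
      using p insert.prems(1) by (subst sum.remove[of _ p]) (auto simp: d_def intro!: sum.cong)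
    have "(\<Sum>e\<in>E. d e * a e m) = 0" unfolding split using p by (simp add: d_def)
    moreover have "(\<Sum>e\<in>E. d e * a e m') = 0" if "m' \<in> M" for m'
    proof -
      have "0 = (\<Sum>e\<in>E - {p}. c e * a e m' - c e * a e m * (a p m' / a p m))"
        using c(2)[OF that] by (simp add: a'_def algebra_simps)
      also have "\<dots> = (\<Sum>e\<in>E - {p}. c e * a e m') - (\<Sum>e\<in>E - {p}. c e * a e m) * (a p m' / a p m)"
        by (simp add: sum_subtractf sum_distrib_right sum_divide_distrib)
      finally show ?thesis unfolding split using p by (simp add: d_def)
    qed
    moreover have "\<exists>e\<in>E. d e \<noteq> 0" using c(1) by (auto simp: d_def)
    ultimately show ?thesis by blast
  qed
qed

lemma polyfuns_dependent:
  assumes "finite E" "card E > (D + 1) ^ N" "\<And>e. e \<in> E \<Longrightarrow> f e \<in> polyfuns N D"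
  shows "\<exists>c. (\<exists>e\<in>E. c e \<noteq> 0) \<and> (\<forall>x. (\<Sum>e\<in>E. c e * f e x) = 0)"
proof -
  have "\<forall>e\<in>E. \<exists>a. \<forall>x. f e x = (\<Sum>m\<in>ebox N D. a m * lmon x m)"
    using assms(3) by (auto simp: polyfuns_def)
  then obtain a where a: "\<And>e x. e \<in> E \<Longrightarrow> f e x = (\<Sum>m\<in>ebox N D. a e m * lmon x m)"
    by metis
  have "card (ebox N D) < card E" using assms(2) by (simp add: card_ebox)
  from underdetermined_system[OF finite_ebox assms(1) this, of a] obtain c where
    c: "\<exists>e\<in>E. c e \<noteq> 0" "\<And>m. m \<in> ebox N D \<Longrightarrow> (\<Sum>e\<in>E. c e * a e m) = 0" by blast
  have "(\<Sum>e\<in>E. c e * f e x) = 0" for x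
  proof -
    have "(\<Sum>e\<in>E. c e * f e x) = (\<Sum>e\<in>E. \<Sum>m\<in>ebox N D. c e * a e m * lmon x m)"
      by (intro sum.cong refl) (simp add: a sum_distrib_left mult.assoc)
    also have "\<dots> = (\<Sum>m\<in>ebox N D. (\<Sum>e\<in>E. c e * a e m) * lmon x m)"
      by (subst sum.swap) (simp add: sum_distrib_right)
    also have "\<dots> = 0" by (simp add: c(2))
    finally show ?thesis .
  qed
  with c(1) show ?thesis by blast
qed

subsection \<open>Density arguments along lines\<close>

definition upoly :: "(complex \<Rightarrow> complex) \<Rightarrow> bool" where
  "upoly f \<longleftrightarrow> (\<exists>q. \<forall>t. f t = poly q t)"

named_theorems upoly_intros

lemma upolyI: "(\<And>t. f t = poly q t) \<Longrightarrow> upoly f"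
  by (auto simp: upoly_def)

lemma upoly_const [upoly_intros]: "upoly (\<lambda>t. c)"
  by (rule upolyI[of _ "[:c:]"]) simp

lemma upoly_id [upoly_intros]: "upoly (\<lambda>t. t)"
  by (rule upolyI[of _ "[:0, 1:]"]) simp

lemma upoly_add [upoly_intros]: "upoly f \<Longrightarrow> upoly g \<Longrightarrow> upoly (\<lambda>t. f t + g t)"
  unfolding upoly_def by (metis poly_add)

lemma upoly_diff [upoly_intros]: "upoly f \<Longrightarrow> upoly g \<Longrightarrow> upoly (\<lambda>t. f t - g t)"
  unfolding upoly_def by (metis poly_diff)

lemma upoly_mult [upoly_intros]: "upoly f \<Longrightarrow> upoly g \<Longrightarrow> upoly (\<lambda>t. f t * g t)"
  unfolding upoly_def by (metis poly_mult)

lemma upoly_sum [upoly_intros]: "(\<And>i. i \<in> I \<Longrightarrow> upoly (f i)) \<Longrightarrow> upoly (\<lambda>t. \<Sum>i\<in>I. f i t)"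
  by (induction I rule: infinite_finite_induct) (auto intro: upoly_intros)

lemma upoly_prod [upoly_intros]: "(\<And>i. i \<in> I \<Longrightarrow> upoly (f i)) \<Longrightarrow> upoly (\<lambda>t. \<Prod>i\<in>I. f i t)"
  by (induction I rule: infinite_finite_induct) (auto intro: upoly_intros)

lemma upoly_power [upoly_intros]: "upoly f \<Longrightarrow> upoly (\<lambda>t. f t ^ n)"
  by (induction n) (auto intro: upoly_intros)

lemma upoly_det:
  assumes "\<And>i j. i < r \<Longrightarrow> j < r \<Longrightarrow> upoly (f i j)"
  shows "upoly (\<lambda>t. det (mat r r (\<lambda>(i, j). f i j t)))"
proof -
  have "upoly (\<lambda>t. \<Sum>p | p permutes {0..<r}. signof p * (\<Prod>i = 0..<r. f i (p i) t))"
    by (intro upoly_intros assms) (auto simp: permutes_in_image)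
  then show ?thesis by (simp only: det_mat_Leibniz)
qed

text \<open>The product of \<open>f\<close> and \<open>g\<close> vanishes everywhere, and
  polynomials in one variable form a domain. Degenerate configurations are reached this way:
  \<open>g\<close> is nonzero at the generic points of a line, and the conclusion is read off at a
  special one.\<close>

lemma upoly_mult_zero:
  assumes "upoly f" "upoly g" "g s \<noteq> 0" "\<And>t. g t \<noteq> 0 \<Longrightarrow> f t = 0"
  shows "f t = 0"
proof -
  obtain p q where pq: "\<And>t. f t = poly p t" "\<And>t. g t = poly q t"
    using assms(1,2) by (auto simp: upoly_def)
  have "poly (p * q) t = 0" for t using assms(4)[of t] by (auto simp: pq)
  then have "p * q = 0" using poly_all_0_iff_0 by blast
  moreover have "q \<noteq> 0" using assms(3) by (auto simp: pq)
  ultimately show ?thesis by (simp add: pq)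
qed

lemma polyfuns_line:
  assumes "f \<in> polyfuns N D" shows "upoly (\<lambda>t. f (\<lambda>i. x i + t * y i))"
proof -
  obtain a where f: "f = (\<lambda>x. \<Sum>e\<in>ebox N D. a e * lmon x e)" using polyfunsE[OF assms(1)] by blast
  show ?thesis unfolding f lmon_def by (intro upoly_intros)
qed

text \<open>On the line joining \<open>x\<close> and \<open>y\<close> neither restriction is the
  zero polynomial, since \<open>x\<close> sits at parameter 0 and \<open>y\<close> at 1. The point
  found stays in every linear subspace containing both, which is what the coordinate subspaces in
  \<open>krull_dim_ge\<close> require.\<close>

lemma polyfuns_nonzero_mult:
  assumes "f \<in> polyfuns N D" "g \<in> polyfuns N D'" "f x \<noteq> 0" "g y \<noteq> 0"
  shows "\<exists>t. f (\<lambda>i. x i + t * (y i - x i)) \<noteq> 0 \<and> g (\<lambda>i. x i + t * (y i - x i)) \<noteq> 0"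
proof (rule ccontr)
  assume "\<not> ?thesis"
  then have *: "\<And>t. g (\<lambda>i. x i + t * (y i - x i)) \<noteq> 0 \<Longrightarrow> f (\<lambda>i. x i + t * (y i - x i)) = 0" by blast
  have "(\<lambda>i. x i + 1 * (y i - x i)) = y" by (simp add: fun_eq_iff)
  then have "g (\<lambda>i. x i + 1 * (y i - x i)) \<noteq> 0" using assms(4) by simp
  from upoly_mult_zero[OF polyfuns_line[OF assms(1)] polyfuns_line[OF assms(2)] this *]
  have "f (\<lambda>i. x i + 0 * (y i - x i)) = 0" by blast
  with assms(3) show False by simp
qed

subsection \<open>Graded families of functions and Krull dimension\<close>

text \<open>Points of the topological space carry several vectors (homogeneous coordinates); the functions
  in \<open>H e\<close> play the role of forms of degree \<open>e\<close>, so that only their vanishing is well defined at a point.\<close>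

locale homogeneous_coordinates =
  fixes T :: "'a topology" and H :: "nat \<Rightarrow> ('w \<Rightarrow> complex) set" and rel :: "'a \<Rightarrow> 'w \<Rightarrow> bool"
  assumes rel_ex: "L \<in> topspace T \<Longrightarrow> \<exists>w. rel L w"
    and rel_inv: "L \<in> topspace T \<Longrightarrow> h \<in> H e \<Longrightarrow> rel L w \<Longrightarrow> rel L w' \<Longrightarrow> h w = 0 \<Longrightarrow> h w' = 0"
    and closedin_iff: "closedin T A \<longleftrightarrow> A \<subseteq> topspace T \<and>
      (\<forall>L\<in>topspace T - A. \<exists>e. \<exists>h\<in>H e. (\<exists>w. rel L w \<and> h w \<noteq> 0) \<and> (\<forall>L'\<in>A. \<forall>w. rel L' w \<longrightarrow> h w = 0))"
    and H_add: "h \<in> H e \<Longrightarrow> h' \<in> H e \<Longrightarrow> (\<lambda>w. h w + h' w) \<in> H e"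
    and H_mult: "h \<in> H e \<Longrightarrow> h' \<in> H e' \<Longrightarrow> (\<lambda>w. h w * h' w) \<in> H (e + e')"
    and H_const: "(\<lambda>w. c) \<in> H 0"
    and H_nonzero: "L \<in> topspace T \<Longrightarrow> \<exists>h\<in>H 1. \<exists>w. rel L w \<and> h w \<noteq> 0"
    and H_zero: "(\<lambda>w. 0) \<in> H e"
begin

definition cone :: "'a set \<Rightarrow> 'w set" where
  "cone Z = {w. \<exists>L\<in>Z. rel L w}"

lemma cone_mono: "Z \<subseteq> Z' \<Longrightarrow> cone Z \<subseteq> cone Z'"
  by (auto simp: cone_def)

lemma H_scale: "h \<in> H e \<Longrightarrow> (\<lambda>w. c * h w) \<in> H e"
  using H_mult[OF H_const, of h e c] by simp

lemma H_sum: "(\<And>i. i \<in> I \<Longrightarrow> h i \<in> H e) \<Longrightarrow> (\<lambda>w. \<Sum>i\<in>I. h i w) \<in> H e"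
  by (induction I rule: infinite_finite_induct) (auto intro: H_zero H_add)

lemma H_power: "h \<in> H e \<Longrightarrow> (\<lambda>w. h w ^ n) \<in> H (n * e)"
proof (induction n)
  case 0 show ?case using H_const[of 1] by simp
next
  case (Suc n)
  from H_mult[OF Suc.prems Suc.IH[OF Suc.prems]] show ?case by simp
qed

lemma H_prod:
  "finite I \<Longrightarrow> (\<And>i. i \<in> I \<Longrightarrow> h i \<in> H (d i)) \<Longrightarrow> (\<lambda>w. \<Prod>i\<in>I. h i w) \<in> H (\<Sum>i\<in>I. d i)"
  by (induction I rule: finite_induct) (auto intro: H_const H_mult)

lemma H_lmon:
  assumes "\<And>i. i < length e \<Longrightarrow> g i \<in> H d"
  shows "(\<lambda>w. lmon (\<lambda>i. g i w) e) \<in> H (sum_list e * d)"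
proof -
  have "(\<lambda>w. \<Prod>i<length e. g i w ^ (e ! i)) \<in> H (\<Sum>i<length e. e ! i * d)"
    using assms by (intro H_prod H_power) auto
  then show ?thesis
    by (simp add: lmon_def sum_list_sum_nth atLeast0LessThan sum_distrib_right)
qed

text \<open>The zero loci of \<open>h\<close> and \<open>h'\<close> inside \<open>Z\<close> are
  closed and cover \<open>Z\<close>, so one of them is all of \<open>Z\<close>: the homogeneous
  ideal of an irreducible set is prime.\<close>

lemma irreducible_mult:
  assumes Z: "closedin T Z" "irreducible_in T Z"
    and h: "h \<in> H e" "h' \<in> H e'" "\<And>w. w \<in> cone Z \<Longrightarrow> h w * h' w = 0"
  shows "(\<forall>w\<in>cone Z. h w = 0) \<or> (\<forall>w\<in>cone Z. h' w = 0)"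
proof -
  have ZT: "Z \<subseteq> topspace T" using Z(1) by (rule closedin_subset)
  have cl: "closedin T {L\<in>Z. \<forall>w. rel L w \<longrightarrow> f w = 0}" if f: "f \<in> H d" for f d
    unfolding closedin_iff
  proof (intro conjI ballI)
    fix L assume L: "L \<in> topspace T - {L\<in>Z. \<forall>w. rel L w \<longrightarrow> f w = 0}"
    show "\<exists>e. \<exists>h\<in>H e. (\<exists>w. rel L w \<and> h w \<noteq> 0) \<and>
        (\<forall>L'\<in>{L\<in>Z. \<forall>w. rel L w \<longrightarrow> f w = 0}. \<forall>w. rel L' w \<longrightarrow> h w = 0)"
    proof (cases "L \<in> Z")
      case True
      then show ?thesis using L f by blast
    next
      case False
      then have "L \<in> topspace T - Z" using L by blast
      then obtain e h where "h \<in> H e" "\<exists>w. rel L w \<and> h w \<noteq> 0" "\<forall>L'\<in>Z. \<forall>w. rel L' w \<longrightarrow> h w = 0"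
        using Z(1) unfolding closedin_iff by blast
      then show ?thesis by blast
    qed
  qed (use ZT in blast)
  have "Z \<subseteq> {L\<in>Z. \<forall>w. rel L w \<longrightarrow> h w = 0} \<union> {L\<in>Z. \<forall>w. rel L w \<longrightarrow> h' w = 0}"
  proof
    fix L assume L: "L \<in> Z"
    then obtain w where w: "rel L w" using rel_ex ZT by blast
    then have "w \<in> cone Z" using L by (auto simp: cone_def)
    then have "h w * h' w = 0" by (rule h(3))
    then have "h w = 0 \<or> h' w = 0" by simp
    moreover have "L \<in> topspace T" using L ZT by blast
    ultimately have "(\<forall>w. rel L w \<longrightarrow> h w = 0) \<or> (\<forall>w. rel L w \<longrightarrow> h' w = 0)"
      using rel_inv[OF _ h(1) w] rel_inv[OF _ h(2) w] by blast
    with L show "L \<in> {L\<in>Z. \<forall>w. rel L w \<longrightarrow> h w = 0} \<union> {L\<in>Z. \<forall>w. rel L w \<longrightarrow> h' w = 0}"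
      by blast
  qed
  then have "Z \<subseteq> {L\<in>Z. \<forall>w. rel L w \<longrightarrow> h w = 0} \<or> Z \<subseteq> {L\<in>Z. \<forall>w. rel L w \<longrightarrow> h' w = 0}"
    using Z(2) cl[OF h(1)] cl[OF h(2)] unfolding irreducible_in_def by blast
  then show ?thesis by (auto simp: cone_def)
qed

text \<open>In a chain of irreducible sets, functions \<open>g\<^sub>i\<close> that vanish on \<open>Z\<^sub>i\<close> but not on \<open>Z\<^sub>i\<^sub>+\<^sub>1\<close> are
  algebraically independent on the last set: cancel the smallest power of the last function, then
  restrict the relation to the previous set.\<close>

lemma chain_independent:
  assumes "\<And>i. i \<le> k \<Longrightarrow> closedin T (Z i) \<and> irreducible_in T (Z i)"
    and "\<And>i. i < k \<Longrightarrow> Z i \<subseteq> Z (Suc i)"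
    and "\<And>i. i < k \<Longrightarrow> g i \<in> H d \<and> (\<forall>w\<in>cone (Z i). g i w = 0) \<and> (\<exists>w\<in>cone (Z (Suc i)). g i w \<noteq> 0)"
    and h: "h \<in> H d" "\<exists>w\<in>cone (Z 0). h w \<noteq> 0"
    and "\<And>e. e \<in> ebox k D \<Longrightarrow> c e \<noteq> 0 \<Longrightarrow> sum_list e \<le> s"
    and "\<And>w. w \<in> cone (Z k) \<Longrightarrow>
      (\<Sum>e\<in>ebox k D. c e * lmon (\<lambda>i. g i w) e * h w ^ (s - sum_list e)) = 0"
    and "e \<in> ebox k D"
  shows "c e = 0"
  using assms(1,2,3,6,7,8)
proof (induction k arbitrary: c s e)
  case 0
  then show ?case using h(2) by auto
next
  case (Suc k)
  show ?case
  proof (rule ccontr)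
    assume "c e \<noteq> 0"
    moreover obtain e' m' where "e = e' @ [m']" "e' \<in> ebox k D" "m' \<le> D"
      using Suc.prems(6) by (rule ebox_SucE)
    ultimately have ex: "\<exists>m. \<exists>e\<in>ebox k D. m \<le> D \<and> c (e @ [m]) \<noteq> 0" by blast
    define m where "m = (LEAST m. \<exists>e\<in>ebox k D. m \<le> D \<and> c (e @ [m]) \<noteq> 0)"
    have m: "\<exists>e\<in>ebox k D. m \<le> D \<and> c (e @ [m]) \<noteq> 0"
      unfolding m_def by (rule LeastI_ex[OF ex])
    have less: "c (e @ [j]) = 0" if "e \<in> ebox k D" "j \<le> D" "j < m" for e j
      using not_less_Least[of j "\<lambda>m. \<exists>e\<in>ebox k D. m \<le> D \<and> c (e @ [m]) \<noteq> 0"] that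
      unfolding m_def by blast
    have mD: "m \<le> D" using m by blast
    \<comment> \<open>The relation divided by the \<open>m\<close>-th power of \<open>g k\<close>.
      It is again homogeneous, of degree \<open>(s - m) * d\<close>, so irreducibility applies to
      the product.\<close>
    define R where "R = (\<lambda>w. \<Sum>j\<in>{m..D}. \<Sum>e\<in>ebox k D.
      c (e @ [j]) * (lmon (\<lambda>i. g i w) e * (g k w ^ (j - m) * h w ^ (s - sum_list e - j))))"
    have R_H: "R \<in> H ((s - m) * d)" unfolding R_def
    proof (intro H_sum)
      fix j e assume j: "j \<in> {m..D}" and e: "e \<in> ebox k D"
      show "(\<lambda>w. c (e @ [j]) * (lmon (\<lambda>i. g i w) e * (g k w ^ (j - m) * h w ^ (s - sum_list e - j)))) \<in> H ((s - m) * d)"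
      \<comment> \<open>Only a nonzero coefficient guarantees \<open>sum_list e + j \<le> s\<close>;
        otherwise truncated subtraction could spoil the degree.\<close>
      proof (cases "c (e @ [j]) = 0")
        case False
        then have le: "sum_list e + j \<le> s" using Suc.prems(4)[of "e @ [j]"] j e by (simp add: ebox_snoc)
        have "(\<lambda>w. c (e @ [j]) * (lmon (\<lambda>i. g i w) e * (g k w ^ (j - m) * h w ^ (s - sum_list e - j))))
          \<in> H (sum_list e * d + ((j - m) * d + (s - sum_list e - j) * d))"
          using Suc.prems(3) h(1) e by (intro H_scale H_mult H_lmon H_power) (auto simp: ebox_def)
        moreover have "sum_list e * d + ((j - m) * d + (s - sum_list e - j) * d) = (s - m) * d"
          using le j by (simp flip: add_mult_distrib)
        ultimately show ?thesis by simp
      qed (simp add: H_zero)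
    qed
    have gk: "(\<lambda>w. g k w ^ m) \<in> H (m * d)" using Suc.prems(3) by (intro H_power) auto
    have "g k w ^ m * R w = 0" if w: "w \<in> cone (Z (Suc k))" for w
    proof -
      have "0 = (\<Sum>j\<le>D. \<Sum>e\<in>ebox k D. c (e @ [j]) * lmon (\<lambda>i. g i w) (e @ [j]) * h w ^ (s - sum_list (e @ [j])))"
        using Suc.prems(5)[OF w] by (simp add: sum_ebox_Suc)
      also have "\<dots> = (\<Sum>j\<in>{m..D}. \<Sum>e\<in>ebox k D. c (e @ [j]) * lmon (\<lambda>i. g i w) (e @ [j]) * h w ^ (s - sum_list (e @ [j])))"
        by (rule sum.mono_neutral_right) (auto intro!: sum.neutral simp: less)
      also have "\<dots> = g k w ^ m * R w"
        unfolding R_def sum_distrib_left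
      proof (intro sum.cong refl)
        fix j e assume j: "j \<in> {m..D}" and e: "e \<in> ebox k D"
        have "g k w ^ j = g k w ^ m * g k w ^ (j - m)" using j by (simp flip: power_add)
        moreover have "length e = k" using e by (simp add: ebox_def)
        ultimately show "c (e @ [j]) * lmon (\<lambda>i. g i w) (e @ [j]) * h w ^ (s - sum_list (e @ [j])) =
          g k w ^ m * (c (e @ [j]) * (lmon (\<lambda>i. g i w) e * (g k w ^ (j - m) * h w ^ (s - sum_list e - j))))"
          by (simp add: lmon_snoc mult_ac)
      qed
      finally show ?thesis by simp
    qed
    then have "(\<forall>w\<in>cone (Z (Suc k)). g k w ^ m = 0) \<or> (\<forall>w\<in>cone (Z (Suc k)). R w = 0)"
      using Suc.prems(1)[of "Suc k"] gk R_H by (intro irreducible_mult) auto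
    moreover have "\<not> (\<forall>w\<in>cone (Z (Suc k)). g k w ^ m = 0)"
      using Suc.prems(3)[of k] by auto
    ultimately have R0: "R w = 0" if "w \<in> cone (Z (Suc k))" for w using that by blast
    have "c (e @ [m]) = 0" if e: "e \<in> ebox k D" for e
    proof (rule Suc.IH[where s = "s - m" and c = "\<lambda>e. c (e @ [m])"])
      fix w assume w: "w \<in> cone (Z k)"
      then have gk0: "g k w = 0" using Suc.prems(3) by blast
      have "w \<in> cone (Z (Suc k))" using w cone_mono[OF Suc.prems(2)[of k]] by blast
      then have "0 = R w" using R0 by simp
      \<comment> \<open>Since \<open>g k\<close> vanishes on \<open>Z k\<close>, every term with
        \<open>j > m\<close> dies, while \<open>0 ^ 0 = 1\<close> keeps the term
        \<open>j = m\<close>.\<close>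
      also have "\<dots> = (\<Sum>j\<in>{m}. \<Sum>e\<in>ebox k D.
        c (e @ [j]) * (lmon (\<lambda>i. g i w) e * (g k w ^ (j - m) * h w ^ (s - sum_list e - j))))"
        unfolding R_def by (rule sum.mono_neutral_right) (use gk0 mD in \<open>auto intro!: sum.neutral\<close>)
      also have "\<dots> = (\<Sum>e\<in>ebox k D. c (e @ [m]) * lmon (\<lambda>i. g i w) e * h w ^ (s - m - sum_list e))"
        by (simp add: mult.assoc add.commute)
      finally show "(\<Sum>e\<in>ebox k D. c (e @ [m]) * lmon (\<lambda>i. g i w) e * h w ^ (s - m - sum_list e)) = 0" by simp
    next
      fix e assume "e \<in> ebox k D" "c (e @ [m]) \<noteq> 0"
      then show "sum_list e \<le> s - m" using Suc.prems(4)[of "e @ [m]"] mD by (simp add: ebox_snoc)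
    next
      show "closedin T (Z i) \<and> irreducible_in T (Z i)" if "i \<le> k" for i using Suc.prems(1) that by simp
      show "Z i \<subseteq> Z (Suc i)" if "i < k" for i using Suc.prems(2) that by simp
      show "g i \<in> H d \<and> (\<forall>w\<in>cone (Z i). g i w = 0) \<and> (\<exists>w\<in>cone (Z (Suc i)). g i w \<noteq> 0)"
        if "i < k" for i using Suc.prems(3) that by simp
    qed (rule e)
    with m show False by blast
  qed
qed

text \<open>For \<open>D = (a + 1) ^ N\<close> one has
  \<open>a * D + 1 \<le> (a + 1) * (D + 1)\<close>, and the \<open>N\<close>-th power of the right
  side is \<open>D * (D + 1) ^ N\<close>. This comparison of growth decides both dimension
  bounds.\<close>

lemma power_dominates: "\<exists>D::nat. (a * D + 1) ^ N < (D + 1) ^ Suc N"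
proof (intro exI)
  define K where "K = (a + 1) ^ N"
  have "(a * K + 1) ^ N \<le> ((a + 1) * (K + 1)) ^ N" by (intro power_mono) auto
  also have "\<dots> = K * (K + 1) ^ N" by (simp only: K_def power_mult_distrib)
  also have "\<dots> < (K + 1) * (K + 1) ^ N" by simp
  finally show "(a * K + 1) ^ N < (K + 1) ^ Suc N" by simp
qed

text \<open>\<open>dom\<close> expresses density of the parametrization through forms alone, so
  \<open>\<psi> x\<close> may be degenerate or represent no point of \<open>T\<close>. A chain
  longer than \<open>N\<close> gives too many monomials in the separating forms: some combination
  vanishes along \<open>\<psi>\<close>, hence on \<open>T\<close>, against their independence on the
  top set.\<close>

theorem krull_dim_le:
  fixes \<psi> :: "(nat \<Rightarrow> complex) \<Rightarrow> 'w"
  assumes poly: "\<And>m h. h \<in> H m \<Longrightarrow> (\<lambda>x. h (\<psi> x)) \<in> polyfuns N (a * m)"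
    and dom: "\<And>m h w. h \<in> H m \<Longrightarrow> (\<And>x. h (\<psi> x) = 0) \<Longrightarrow> w \<in> cone (topspace T) \<Longrightarrow> h w = 0"
  shows "krull_dim T \<le> enat N"
  unfolding krull_dim_def
proof (rule Sup_least, clarify)
  fix k Z
  assume Z: "\<forall>i\<le>k. closedin T (Z i) \<and> irreducible_in T (Z i)" and sub: "\<forall>i<k. Z i \<subset> Z (Suc i)"
  show "enat k \<le> enat N"
  proof (rule ccontr)
    assume "\<not> enat k \<le> enat N"
    then have kN: "Suc N \<le> k" by simp
    have ZT: "Z i \<subseteq> topspace T" if "i \<le> k" for i using Z that closedin_subset by blast
    have Z0: "Z i \<noteq> {}" if "i \<le> k" for i using Z that by (auto simp: irreducible_in_def)
    obtain L0 where L0: "L0 \<in> Z 0" using Z0[of 0] by auto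
    then obtain h0 w0 where h0: "h0 \<in> H 1" "rel L0 w0" "h0 w0 \<noteq> 0" using H_nonzero ZT[of 0] by blast
    have "\<exists>e. \<exists>g\<in>H e. (\<forall>w\<in>cone (Z i). g w = 0) \<and> (\<exists>w\<in>cone (Z (Suc i)). g w \<noteq> 0)" if i: "i < k" for i
    proof -
      obtain L where L: "L \<in> Z (Suc i)" "L \<notin> Z i" using sub i by blast
      then have "L \<in> topspace T - Z i" using ZT[of "Suc i"] i by auto
      then obtain e g where g: "g \<in> H e" "\<exists>w. rel L w \<and> g w \<noteq> 0" "\<forall>L'\<in>Z i. \<forall>w. rel L' w \<longrightarrow> g w = 0"
        using Z i unfolding closedin_iff by (meson less_imp_le)
      then show ?thesis using L by (auto simp: cone_def)
    qed
    then obtain \<delta> g' where g': "\<And>i. i < k \<Longrightarrow> g' i \<in> H (\<delta> i)"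
      "\<And>i. i < k \<Longrightarrow> (\<forall>w\<in>cone (Z i). g' i w = 0) \<and> (\<exists>w\<in>cone (Z (Suc i)). g' i w \<noteq> 0)"
      by metis
    \<comment> \<open>A common degree for the separating forms. They are brought to it by powers of
      \<open>h0\<close>, which is nonzero at a point of \<open>Z 0\<close> and so vanishes
      identically on no \<open>Z i\<close>.\<close>
    define d where "d = (\<Sum>i<k. \<delta> i)"
    have \<delta>d: "\<delta> i \<le> d" if "i < k" for i unfolding d_def using that by (intro member_le_sum) auto
    define h where "h w = h0 w ^ d" for w
    define g where "g i w = g' i w * h0 w ^ (d - \<delta> i)" for i w
    have Z0i: "Z 0 \<subseteq> Z i" if "i \<le> k" for i
      using that sub by (induction i) (auto simp: psubset_eq subset_iff)
    have h0n: "\<not> (\<forall>w\<in>cone (Z i). h0 w ^ n = 0)" if "i \<le> k" for i n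
      using h0 L0 Z0i[OF that] by (auto simp: cone_def)
    have h: "h \<in> H d" "\<exists>w\<in>cone (Z 0). h w \<noteq> 0"
      using H_power[OF h0(1), of d] h0n[of 0 d] by (auto simp: h_def[abs_def])
    have gH: "g i \<in> H d" if i: "i < k" for i
    proof -
      have "(\<lambda>w. g' i w * h0 w ^ (d - \<delta> i)) \<in> H (\<delta> i + (d - \<delta> i) * 1)"
        by (intro H_mult H_power g' h0 i)
      then show ?thesis using \<delta>d[OF i] by (simp add: g_def[abs_def])
    qed
    have gn: "\<exists>w\<in>cone (Z (Suc i)). g i w \<noteq> 0" if i: "i < k" for i
    proof (rule ccontr)
      assume "\<not> ?thesis"
      then have "g' i w * h0 w ^ (d - \<delta> i) = 0" if "w \<in> cone (Z (Suc i))" for w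
        using that unfolding g_def by blast
      then have "(\<forall>w\<in>cone (Z (Suc i)). g' i w = 0) \<or> (\<forall>w\<in>cone (Z (Suc i)). h0 w ^ (d - \<delta> i) = 0)"
        using i Z by (intro irreducible_mult[OF _ _ g'(1)[OF i] H_power[OF h0(1)]]) auto
      then show False using g'(2)[OF i] h0n[of "Suc i"] i by auto
    qed
    have g: "g i \<in> H d \<and> (\<forall>w\<in>cone (Z i). g i w = 0) \<and> (\<exists>w\<in>cone (Z (Suc i)). g i w \<noteq> 0)" if "i < k" for i
      using that gH gn g'(2) by (auto simp: g_def)
    obtain D where D: "(a * (k * d) * D + 1) ^ N < (D + 1) ^ Suc N" using power_dominates by blast
    \<comment> \<open>Degree of a monomial from \<open>ebox k D\<close> in the forms
      \<open>g i\<close> after a power of \<open>h\<close> has filled it up to \<open>k * D\<close>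
      factors.\<close>
    define m where "m = k * D * d"
    define f where "f e w = lmon (\<lambda>i. g i w) e * h w ^ (k * D - sum_list e)" for e w
    note le = sum_list_ebox[of _ k D]
    have fH: "f e \<in> H m" if e: "e \<in> ebox k D" for e
    proof -
      have "f e \<in> H (sum_list e * d + (k * D - sum_list e) * d)" unfolding f_def[abs_def]
        using e g h by (intro H_mult H_lmon H_power) (auto simp: ebox_def)
      then show ?thesis using le[OF e] by (simp add: m_def flip: add_mult_distrib)
    qed
    have "(a * m + 1) ^ N < card (ebox k D)"
    proof -
      have "(a * m + 1) ^ N < (D + 1) ^ Suc N" using D by (simp add: m_def mult_ac)
      also have "\<dots> \<le> (D + 1) ^ k" using kN by (intro power_increasing) auto
      finally show ?thesis by (simp add: card_ebox)
    qed
    from polyfuns_dependent[OF finite_ebox this, of "\<lambda>e x. f e (\<psi> x)"] obtain c where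
      c: "\<exists>e\<in>ebox k D. c e \<noteq> 0" "\<And>x. (\<Sum>e\<in>ebox k D. c e * f e (\<psi> x)) = 0" using poly[OF fH] by blast
    have "(\<Sum>e\<in>ebox k D. c e * f e w) = 0" if w: "w \<in> cone (Z k)" for w
    proof (rule dom[where h = "\<lambda>w. \<Sum>e\<in>ebox k D. c e * f e w" and m = m])
      show "(\<lambda>w. \<Sum>e\<in>ebox k D. c e * f e w) \<in> H m" by (intro H_sum H_scale fH)
      show "w \<in> cone (topspace T)" using w cone_mono[OF ZT[of k]] by auto
      show "(\<Sum>e\<in>ebox k D. c e * f e (\<psi> x)) = 0" for x by (rule c(2))
    qed
    then have rel0: "(\<Sum>e\<in>ebox k D. c e * lmon (\<lambda>i. g i w) e * h w ^ (k * D - sum_list e)) = 0"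
      if "w \<in> cone (Z k)" for w using that by (simp add: f_def mult.assoc)
    have "c e = 0" if "e \<in> ebox k D" for e
    proof (rule chain_independent[where Z = Z and k = k and g = g and h = h and d = d and c = c and s = "k * D" and D = D])
      show "closedin T (Z i) \<and> irreducible_in T (Z i)" if "i \<le> k" for i using Z that by blast
      show "Z i \<subseteq> Z (Suc i)" if "i < k" for i using sub that by blast
      show "g i \<in> H d \<and> (\<forall>w\<in>cone (Z i). g i w = 0) \<and> (\<exists>w\<in>cone (Z (Suc i)). g i w \<noteq> 0)"
        if "i < k" for i using g that by blast
      show "sum_list e \<le> k * D" if "e \<in> ebox k D" for e using le that by blast
    qed (rule h rel0 that; assumption?)+
    then show False using c(1) by blast
  qed
qed


text \<open>The forms \<open>f\<^sub>j\<close> have independent differentials along \<open>\<psi>\<close> at the origin, so comparing initial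
  terms shows that they are algebraically independent on the image of each coordinate subspace;
  hence the closures of these images strictly increase.\<close>

theorem krull_dim_ge:
  fixes \<psi> :: "(nat \<Rightarrow> complex) \<Rightarrow> 'w"
  assumes poly: "\<And>m h. h \<in> H m \<Longrightarrow> (\<lambda>x. h (\<psi> x)) \<in> polyfuns N (a * m)"
    and G: "G \<in> polyfuns N b" "G (\<lambda>_. 0) \<noteq> 0" "\<And>x. G x \<noteq> 0 \<Longrightarrow> \<exists>L\<in>topspace T. rel L (\<psi> x)"
    and f: "\<And>j. j < N \<Longrightarrow> f j \<in> H 1" "f0 \<in> H 1"
    and f0_lim: "\<And>y. ((\<lambda>t. f0 (\<psi> (\<lambda>i. t * y i))) \<longlongrightarrow> 1) (at 0)"
    and f_lim: "\<And>y j. j < N \<Longrightarrow> ((\<lambda>t. f j (\<psi> (\<lambda>i. t * y i)) / t) \<longlongrightarrow> y j) (at 0)"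
  shows "enat N \<le> krull_dim T"
proof -
  define C where "C i = {x :: nat \<Rightarrow> complex. \<forall>l\<ge>i. x l = 0}" for i
  have C_line: "(\<lambda>l. x l + t * (y l - x l)) \<in> C i" if "x \<in> C i" "y \<in> C i" for x y t i
    using that by (simp add: C_def)
  have C0: "(\<lambda>_. 0) \<in> C i" for i by (simp add: C_def)
  \<comment> \<open>The closure of the image of \<open>C i\<close>, given by equations because
    \<open>\<psi> x\<close> is only known to represent a point where
    \<open>G x \<noteq> 0\<close>.\<close>
  define Z where "Z i = {L \<in> topspace T. \<forall>m. \<forall>h\<in>H m. (\<forall>x\<in>C i. h (\<psi> x) = 0) \<longrightarrow> (\<forall>w. rel L w \<longrightarrow> h w = 0)}" for i
  have in_Z: "L \<in> Z i" if "x \<in> C i" "L \<in> topspace T" "rel L (\<psi> x)" for x L i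
    using that rel_inv[OF that(2) _ that(3)] unfolding Z_def by blast
  have closed: "closedin T (Z i)" for i
    unfolding closedin_iff
  proof (intro conjI ballI)
    fix L assume "L \<in> topspace T - Z i"
    then obtain m h w where "h \<in> H m" "\<forall>x\<in>C i. h (\<psi> x) = 0" "rel L w" "h w \<noteq> 0"
      unfolding Z_def by blast
    then show "\<exists>e. \<exists>h\<in>H e. (\<exists>w. rel L w \<and> h w \<noteq> 0) \<and> (\<forall>L'\<in>Z i. \<forall>w. rel L' w \<longrightarrow> h w = 0)"
      unfolding Z_def by blast
  qed (auto simp: Z_def)
  \<comment> \<open>\<open>G\<close> is nonzero at the origin, which lies in every
    \<open>C i\<close>; hence a form that is nonzero somewhere along \<open>C i\<close> is nonzero
    at a parameter that represents a point of \<open>T\<close>.\<close>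
  have generic: "\<exists>x\<in>C i. G x \<noteq> 0 \<and> h (\<psi> x) \<noteq> 0" if h: "h \<in> H m" "y \<in> C i" "h (\<psi> y) \<noteq> 0" for i h m y
    using polyfuns_nonzero_mult[OF poly[OF h(1)] G(1) h(3) G(2)] C_line[OF h(2) C0] by blast
  have irred: "irreducible_in T (Z i)" for i
    unfolding irreducible_in_def
  proof (intro conjI allI impI)
    show "Z i \<noteq> {}" using in_Z[OF C0] G(2,3) by blast
  next
    fix A B assume AB: "closedin T A \<and> closedin T B \<and> Z i \<subseteq> A \<union> B"
    have sep: "\<exists>m. \<exists>h\<in>H m. (\<exists>x\<in>C i. h (\<psi> x) \<noteq> 0) \<and> (\<forall>L'\<in>B. \<forall>w. rel L' w \<longrightarrow> h w = 0)"
      if B: "closedin T B" and nsub: "\<not> Z i \<subseteq> B" for B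
    proof -
      obtain L where L: "L \<in> Z i" "L \<notin> B" using nsub by blast
      then have "L \<in> topspace T - B" by (simp add: Z_def)
      then obtain e h w where h: "h \<in> H e" "rel L w" "h w \<noteq> 0" "\<forall>L'\<in>B. \<forall>w. rel L' w \<longrightarrow> h w = 0"
        using B unfolding closedin_iff by blast
      with L(1) have "\<not> (\<forall>x\<in>C i. h (\<psi> x) = 0)" unfolding Z_def by blast
      with h show ?thesis by blast
    qed
    show "Z i \<subseteq> A \<or> Z i \<subseteq> B"
    proof (rule ccontr)
      assume "\<not> ?thesis"
      then have nsub: "\<not> Z i \<subseteq> A" "\<not> Z i \<subseteq> B" by simp_all
      obtain m1 h1 x1 where
        h1: "h1 \<in> H m1" "x1 \<in> C i" "h1 (\<psi> x1) \<noteq> 0" "\<forall>L'\<in>A. \<forall>w. rel L' w \<longrightarrow> h1 w = 0"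
        using sep[OF _ nsub(1)] AB by blast
      obtain m2 h2 x2 where
        h2: "h2 \<in> H m2" "x2 \<in> C i" "h2 (\<psi> x2) \<noteq> 0" "\<forall>L'\<in>B. \<forall>w. rel L' w \<longrightarrow> h2 w = 0"
        using sep[OF _ nsub(2)] AB by blast
      obtain t where t: "h1 (\<psi> (\<lambda>l. x1 l + t * (x2 l - x1 l))) \<noteq> 0 \<and> h2 (\<psi> (\<lambda>l. x1 l + t * (x2 l - x1 l))) \<noteq> 0"
        using polyfuns_nonzero_mult[OF poly[OF h1(1)] poly[OF h2(1)] h1(3) h2(3)] by (rule exE)
      define x3 where "x3 = (\<lambda>l. x1 l + t * (x2 l - x1 l))"
      have x3: "x3 \<in> C i" "h1 (\<psi> x3) * h2 (\<psi> x3) \<noteq> 0"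
        using C_line[OF h1(2) h2(2)] t by (simp_all add: x3_def)
      have "\<exists>x\<in>C i. G x \<noteq> 0 \<and> h1 (\<psi> x) * h2 (\<psi> x) \<noteq> 0"
        by (rule generic[OF H_mult[OF h1(1) h2(1)] x3])
      then obtain x where x: "x \<in> C i" "G x \<noteq> 0" "h1 (\<psi> x) * h2 (\<psi> x) \<noteq> 0" by blast
      obtain L where L: "L \<in> topspace T" "rel L (\<psi> x)" using G(3)[OF x(2)] by blast
      have "L \<in> A \<union> B" using in_Z[OF x(1) L] AB by blast
      then show False using L(2) h1(4) h2(4) x(3) by auto
    qed
  qed
  have strict: "Z i \<subset> Z (Suc i)" if i: "i < N" for i
  proof -
    have "C i \<subseteq> C (Suc i)" by (auto simp: C_def)
    then have sub: "Z i \<subseteq> Z (Suc i)" unfolding Z_def by blast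
    \<comment> \<open>The \<open>Suc i\<close> forms \<open>f 0\<close>, ..., \<open>f i\<close>
      have \<open>(D + 1) ^ Suc i\<close> monomials in the box, more than the dimension available on
      \<open>C i\<close>, where only \<open>i\<close> variables survive.\<close>
    obtain D where D: "(a * Suc i * D + 1) ^ i < (D + 1) ^ Suc i" using power_dominates by blast
    define s where "s = Suc i * D"
    have le: "sum_list e \<le> s" if "e \<in> ebox (Suc i) D" for e
      unfolding s_def using that by (rule sum_list_ebox)
    define g where "g e w = lmon (\<lambda>j. f j w) e * f0 w ^ (s - sum_list e)" for e w
    have gH: "g e \<in> H s" if e: "e \<in> ebox (Suc i) D" for e
    proof -
      have "g e \<in> H (sum_list e * 1 + (s - sum_list e) * 1)" unfolding g_def[abs_def]
        using e f i by (intro H_mult H_lmon H_power) (auto simp: ebox_def)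
      then show ?thesis using le[OF e] by simp
    qed
    have "\<exists>p. p \<in> polyfuns i (a * s) \<and> (\<forall>x\<in>C i. g e (\<psi> x) = p x)" if e: "e \<in> ebox (Suc i) D" for e
    proof -
      obtain p where "p \<in> polyfuns i (a * s)" "\<And>x. (\<And>l. i \<le> l \<Longrightarrow> x l = 0) \<Longrightarrow> g e (\<psi> x) = p x"
        using polyfuns_truncate[OF poly[OF gH[OF e]], of i] i by (metis less_imp_le)
      then show ?thesis by (auto simp: C_def)
    qed
    then obtain p where p: "\<And>e. e \<in> ebox (Suc i) D \<Longrightarrow> p e \<in> polyfuns i (a * s)"
      "\<And>e x. e \<in> ebox (Suc i) D \<Longrightarrow> x \<in> C i \<Longrightarrow> g e (\<psi> x) = p e x" by metis
    have big: "card (ebox (Suc i) D) > (a * s + 1) ^ i"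
    proof -
      have "a * s = a * Suc i * D" by (simp only: s_def mult.assoc)
      then show ?thesis using D by (simp only: card_ebox)
    qed
    have "\<exists>c. (\<exists>e\<in>ebox (Suc i) D. c e \<noteq> 0) \<and> (\<forall>x. (\<Sum>e\<in>ebox (Suc i) D. c e * p e x) = 0)"
      by (rule polyfuns_dependent[OF finite_ebox big]) (rule p(1))
    then obtain c where
      c: "\<exists>e\<in>ebox (Suc i) D. c e \<noteq> 0" "\<And>x. (\<Sum>e\<in>ebox (Suc i) D. c e * p e x) = 0" by blast
    define h where "h w = (\<Sum>e\<in>ebox (Suc i) D. c e * g e w)" for w
    have hH: "h \<in> H s" unfolding h_def[abs_def] by (intro H_sum H_scale gH)
    have h0: "h (\<psi> x) = 0" if "x \<in> C i" for x
      using c(2)[of x] p(2)[OF _ that] by (simp add: h_def)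
    have "\<exists>x\<in>C (Suc i). h (\<psi> x) \<noteq> 0"
    proof (rule ccontr)
      assume "\<not> ?thesis"
      then have hz: "h (\<psi> x) = 0" if "x \<in> C (Suc i)" for x using that by blast
      have ex: "\<exists>n. \<exists>e\<in>ebox (Suc i) D. c e \<noteq> 0 \<and> sum_list e = n" using c(1) by blast
      \<comment> \<open>The least degree that occurs: after division by \<open>t ^ \<sigma>\<close>,
        letting \<open>t\<close> tend to 0 leaves the initial form of the relation.\<close>
      define \<sigma> where "\<sigma> = (LEAST n. \<exists>e\<in>ebox (Suc i) D. c e \<noteq> 0 \<and> sum_list e = n)"
      have \<sigma>: "\<exists>e\<in>ebox (Suc i) D. c e \<noteq> 0 \<and> sum_list e = \<sigma>" unfolding \<sigma>_def by (rule LeastI_ex[OF ex])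
      have \<sigma>_le: "\<sigma> \<le> sum_list e" if "e \<in> ebox (Suc i) D" "c e \<noteq> 0" for e
        unfolding \<sigma>_def using that by (intro Least_le) blast
      \<comment> \<open>Among the terms with \<open>c e \<noteq> 0\<close>, the factor
        \<open>0 ^ (sum_list e - \<sigma>)\<close> is 1 in degree \<open>\<sigma>\<close> and 0 in
        higher degrees.\<close>
      have lim0: "(\<Sum>e\<in>ebox (Suc i) D. c e * (0 ^ (sum_list e - \<sigma>) * lmon y e)) = 0" if y: "y \<in> C (Suc i)" for y
      proof -
        define F where "F j t = f j (\<psi> (\<lambda>l. t * y l))" for j t
        define F0 where "F0 t = f0 (\<psi> (\<lambda>l. t * y l))" for t
        define R where "R t = (\<Sum>e\<in>ebox (Suc i) D. c e * (t ^ (sum_list e - \<sigma>) * lmon (\<lambda>j. F j t / t) e * F0 t ^ (s - sum_list e)))" for t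
        have "(R \<longlongrightarrow> (\<Sum>e\<in>ebox (Suc i) D. c e * (0 ^ (sum_list e - \<sigma>) * lmon y e * 1 ^ (s - sum_list e)))) (at 0)"
          unfolding R_def[abs_def] lmon_def F_def F0_def
          using i by (intro tendsto_intros f_lim f0_lim) (auto simp: ebox_def)
        moreover have "R t = 0" if t: "t \<noteq> 0" for t
        proof -
          have "t ^ \<sigma> * R t = h (\<psi> (\<lambda>l. t * y l))"
            unfolding R_def h_def sum_distrib_left
          proof (intro sum.cong refl)
            fix e assume e: "e \<in> ebox (Suc i) D"
            show "t ^ \<sigma> * (c e * (t ^ (sum_list e - \<sigma>) * lmon (\<lambda>j. F j t / t) e * F0 t ^ (s - sum_list e))) =
              c e * g e (\<psi> (\<lambda>l. t * y l))"
            proof (cases "c e = 0")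
              case False
              then have "t ^ sum_list e = t ^ \<sigma> * t ^ (sum_list e - \<sigma>)"
                using \<sigma>_le[OF e] by (simp flip: power_add)
              moreover have "lmon (\<lambda>j. F j t) e = t ^ sum_list e * lmon (\<lambda>j. F j t / t) e"
                using t by (simp flip: lmon_scale)
              ultimately show ?thesis by (simp add: g_def F_def F0_def mult_ac)
            qed simp
          qed
          also have "\<dots> = 0" by (rule hz) (use y in \<open>simp add: C_def\<close>)
          finally show ?thesis using t by simp
        qed
        then have "(R \<longlongrightarrow> 0) (at 0)"
          by (intro tendsto_eventually) (simp add: eventually_at_filter)
        ultimately show ?thesis using LIM_unique by fastforce
      qed
      have indep: "(\<Sum>e\<in>ebox (Suc i) D. (c e * 0 ^ (sum_list e - \<sigma>)) * lmon x e) = 0" for x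
      proof -
        define y where "y l = (if l < Suc i then x l else 0)" for l
        have "lmon y e = lmon x e" if "e \<in> ebox (Suc i) D" for e
          using that by (auto simp: lmon_def ebox_def y_def intro!: prod.cong)
        moreover have "(\<Sum>e\<in>ebox (Suc i) D. c e * (0 ^ (sum_list e - \<sigma>) * lmon y e)) = 0"
          using lim0[of y] by (simp add: C_def y_def)
        ultimately show ?thesis by (simp add: mult.assoc)
      qed
      from lmon_independent[OF indep] \<sigma> show False by fastforce
    qed
    then obtain y where "y \<in> C (Suc i)" "h (\<psi> y) \<noteq> 0" by blast
    from generic[OF hH this] obtain x where x: "x \<in> C (Suc i)" "G x \<noteq> 0" "h (\<psi> x) \<noteq> 0" by blast
    obtain L where L: "L \<in> topspace T" "rel L (\<psi> x)" using G(3)[OF x(2)] by blast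
    have "L \<in> Z (Suc i)" by (rule in_Z[OF x(1) L])
    moreover have "L \<notin> Z i" using hH h0 L(2) x(3) unfolding Z_def by blast
    ultimately show ?thesis using sub by blast
  qed
  show ?thesis unfolding krull_dim_def
    by (intro Sup_upper CollectI exI[of _ N] exI[of _ Z]) (use closed irred strict in auto)
qed

end

subsection \<open>Forms as homogeneous functions\<close>

abbreviation (input) "coef \<equiv> Poly_Mapping.lookup"

definition mono_val :: "('v \<Rightarrow> complex) \<Rightarrow> ('v \<Rightarrow>\<^sub>0 nat) \<Rightarrow> complex" where
  "mono_val a m = (\<Prod>i\<in>Poly_Mapping.keys m. a i ^ coef m i)"

lemma mono_val_superset:
  assumes "finite A" "Poly_Mapping.keys m \<subseteq> A"
  shows "mono_val a m = (\<Prod>i\<in>A. a i ^ coef m i)"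
  unfolding mono_val_def using assms
  by (intro prod.mono_neutral_left) (auto simp: in_keys_iff)

lemma mono_val_add: "mono_val a (m + n) = mono_val a m * mono_val a n"
proof -
  define A where "A = Poly_Mapping.keys m \<union> Poly_Mapping.keys n"
  have "finite A" "Poly_Mapping.keys m \<subseteq> A" "Poly_Mapping.keys n \<subseteq> A" by (auto simp: A_def)
  moreover have "Poly_Mapping.keys (m + n) \<subseteq> A" unfolding A_def by (rule keys_add)
  ultimately show ?thesis
    by (simp add: mono_val_superset[of A] lookup_add power_add prod.distrib)
qed

lemma eval_poly_superset:
  assumes "finite A" "Poly_Mapping.keys p \<subseteq> A"
  shows "eval_poly a p = (\<Sum>m\<in>A. coef p m * mono_val a m)"
  unfolding eval_poly_def mono_val_def using assms
  by (intro sum.mono_neutral_left) (auto simp: in_keys_iff)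

lemma eval_poly_zero [simp]: "eval_poly a 0 = 0"
  by (simp add: eval_poly_def)

lemma eval_poly_single: "eval_poly a (Poly_Mapping.single m c) = c * mono_val a m"
  by (subst eval_poly_superset[of "{m}"]) auto

lemma eval_poly_add: "eval_poly a (p + q) = eval_poly a p + eval_poly a q"
proof -
  define A where "A = Poly_Mapping.keys p \<union> Poly_Mapping.keys q"
  have "finite A" "Poly_Mapping.keys p \<subseteq> A" "Poly_Mapping.keys q \<subseteq> A" by (auto simp: A_def)
  moreover have "Poly_Mapping.keys (p + q) \<subseteq> A" unfolding A_def by (rule keys_add)
  ultimately show ?thesis
    by (simp add: eval_poly_superset[of A] lookup_add algebra_simps sum.distrib)
qed

lemma eval_poly_sum: "eval_poly a (\<Sum>i\<in>I. p i) = (\<Sum>i\<in>I. eval_poly a (p i))"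
  by (induction I rule: infinite_finite_induct) (auto simp: eval_poly_add)

lemma poly_mapping_sum_single:
  "p = (\<Sum>m\<in>Poly_Mapping.keys p. Poly_Mapping.single m (coef p m))"
  by (rule poly_mapping_eqI)
    (auto simp: lookup_sum lookup_single when_def in_keys_iff sum.delta' if_distrib cong: if_cong)

lemma eval_poly_mult: "eval_poly a (p * q) = eval_poly a p * eval_poly a q"
proof -
  have "p * q = (\<Sum>m\<in>Poly_Mapping.keys p. \<Sum>n\<in>Poly_Mapping.keys q.
      Poly_Mapping.single (m + n) (coef p m * coef q n))"
    by (subst (1) poly_mapping_sum_single[of p], subst (1) poly_mapping_sum_single[of q])
      (simp add: sum_product mult_single)
  then have "eval_poly a (p * q) = (\<Sum>m\<in>Poly_Mapping.keys p. \<Sum>n\<in>Poly_Mapping.keys q.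
      (coef p m * mono_val a m) * (coef q n * mono_val a n))"
    by (simp add: eval_poly_sum eval_poly_single mono_val_add mult_ac)
  also have "\<dots> = eval_poly a p * eval_poly a q"
    by (simp add: eval_poly_def mono_val_def flip: sum_product)
  finally show ?thesis .
qed

lemma eval_poly_one [simp]: "eval_poly a 1 = 1"
  using eval_poly_single[of a 0 1] by (simp add: mono_val_def)

lemma forms_add: "p \<in> forms X e \<Longrightarrow> q \<in> forms X e \<Longrightarrow> p + q \<in> forms X e"
  using keys_add[of p q] by (auto simp: forms_def)

lemma forms_zero [simp]: "0 \<in> forms X e"
  by (simp add: forms_def)

lemma forms_sum: "(\<And>i. i \<in> I \<Longrightarrow> p i \<in> forms X e) \<Longrightarrow> (\<Sum>i\<in>I. p i) \<in> forms X e"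
  by (induction I rule: infinite_finite_induct) (auto intro: forms_add)

lemma deg_superset:
  assumes "finite A" "Poly_Mapping.keys m \<subseteq> A"
  shows "(\<Sum>i\<in>Poly_Mapping.keys m. coef m i) = (\<Sum>i\<in>A. coef m i)"
  using assms by (intro sum.mono_neutral_left) (auto simp: in_keys_iff)

lemma monomials_add:
  assumes "m \<in> monomials X d" "n \<in> monomials X e" shows "m + n \<in> monomials X (d + e)"
proof -
  define A where "A = Poly_Mapping.keys m \<union> Poly_Mapping.keys n"
  have A: "finite A" "Poly_Mapping.keys m \<subseteq> A" "Poly_Mapping.keys n \<subseteq> A" "A \<subseteq> X"
    using assms by (auto simp: A_def monomials_def)
  moreover have "Poly_Mapping.keys (m + n) \<subseteq> A" unfolding A_def by (rule keys_add)
  ultimately have "(\<Sum>i\<in>Poly_Mapping.keys (m + n). coef (m + n) i) =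
      (\<Sum>i\<in>A. coef (m + n) i)" by (intro deg_superset)
  with A \<open>Poly_Mapping.keys (m + n) \<subseteq> A\<close> assms show ?thesis
    by (auto simp: monomials_def deg_superset[of A m] deg_superset[of A n] lookup_add sum.distrib)
qed

lemma forms_mult:
  assumes "p \<in> forms X d" "q \<in> forms X e" shows "p * q \<in> forms X (d + e)"
  unfolding forms_def
proof (intro CollectI subsetI)
  fix k assume "k \<in> Poly_Mapping.keys (p * q)"
  then obtain m n where "m \<in> Poly_Mapping.keys p" "n \<in> Poly_Mapping.keys q" "k = m + n"
    using keys_mult[of p q] by blast
  then show "k \<in> monomials X (d + e)"
    using assms unfolding forms_def by (metis (mono_tags) mem_Collect_eq monomials_add subsetD)
qed

lemma forms_single: "m \<in> monomials X d \<Longrightarrow> Poly_Mapping.single m c \<in> forms X d"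
  by (simp add: forms_def)

lemma monomials_var: "i \<in> X \<Longrightarrow> Poly_Mapping.single i 1 \<in> monomials X 1"
  by (simp add: monomials_def)

lemma forms_const: "Poly_Mapping.single 0 c \<in> forms X 0"
  by (simp add: forms_def monomials_def)

lemma lookup_poly_scale [simp]: "coef (poly_scale c p) m = c * coef p m"
proof -
  have "poly_scale c p = Poly_Mapping.map ((*) c) p"
    by (simp add: poly_scale_def mult_map_scale_conv_mult)
  then show ?thesis by (simp add: Poly_Mapping.map.rep_eq when_def)
qed

lemma forms_scale: "p \<in> forms X d \<Longrightarrow> poly_scale c p \<in> forms X d"
  by (auto simp: forms_def in_keys_iff)

lemma eval_poly_scale_arg:
  assumes "F \<in> forms X e" shows "eval_poly (\<lambda>i. c * a i) F = c ^ e * eval_poly a F"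
  unfolding eval_poly_def sum_distrib_left
proof (intro sum.cong refl)
  fix m assume "m \<in> Poly_Mapping.keys F"
  then have "(\<Sum>i\<in>Poly_Mapping.keys m. coef m i) = e"
    using assms by (auto simp: forms_def monomials_def)
  then have "(\<Prod>i\<in>Poly_Mapping.keys m. c ^ coef m i) = c ^ e"
    by (metis power_sum)
  then show "coef F m * (\<Prod>i\<in>Poly_Mapping.keys m. (c * a i) ^ coef m i) =
    c ^ e * (coef F m * (\<Prod>i\<in>Poly_Mapping.keys m. a i ^ coef m i))"
    by (simp add: power_mult_distrib prod.distrib)
qed

lemma polyfuns_eval_poly:
  assumes F: "F \<in> forms X e" and f: "\<And>I. I \<in> X \<Longrightarrow> (\<lambda>x. f x I) \<in> polyfuns N D"
  shows "(\<lambda>x. eval_poly (f x) F) \<in> polyfuns N (D * e)"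
  unfolding eval_poly_def
proof (intro polyfuns_sum polyfuns_scale)
  fix m assume "m \<in> Poly_Mapping.keys F"
  then have m: "m \<in> monomials X e" using F by (auto simp: forms_def)
  have "(\<lambda>x. \<Prod>i\<in>Poly_Mapping.keys m. f x i ^ coef m i) \<in>
    polyfuns N (\<Sum>i\<in>Poly_Mapping.keys m. coef m i * D)"
    using m f by (intro polyfuns_prod polyfuns_power) (auto simp: monomials_def)
  moreover have "(\<Sum>i\<in>Poly_Mapping.keys m. coef m i * D) = D * e"
    using m by (simp add: monomials_def flip: sum_distrib_right)
  ultimately show "(\<lambda>x. \<Prod>i\<in>Poly_Mapping.keys m. f x i ^ coef m i) \<in> polyfuns N (D * e)"
    by simp
qed

lemma upoly_eval_poly: "(\<And>I. upoly (\<lambda>t. f t I)) \<Longrightarrow> upoly (\<lambda>t. eval_poly (f t) F)"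
  unfolding eval_poly_def by (intro upoly_intros)

subsection \<open>The Grassmannian and its Zariski topology\<close>

text \<open>Homogeneous polynomials as functions on arbitrary coordinate vectors, not only on
  Pluecker vectors. Together with \<open>prel\<close>, which attaches to a subspace the vectors of
  all its bases, they instantiate \<open>homogeneous_coordinates\<close>.\<close>

definition pforms :: "nat \<Rightarrow> nat \<Rightarrow> nat \<Rightarrow> nat \<Rightarrow> (((nat \<Rightarrow>\<^sub>0 nat) list \<Rightarrow> complex) \<Rightarrow> complex) set" where
  "pforms n d r e = {\<lambda>a. eval_poly a F | F. F \<in> forms (pluecker_indices n d r) e}"

definition prel :: "nat \<Rightarrow> nat cpoly set \<Rightarrow> ((nat \<Rightarrow>\<^sub>0 nat) list \<Rightarrow> complex) \<Rightarrow> bool" where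
  "prel r L w \<longleftrightarrow> (\<exists>b. is_basis r b L \<and> w = pluecker r b)"

lemma Grassmannian_basis:
  assumes "L \<in> Grassmannian n d r" "r > 0"
  obtains b where "is_basis r b L"
proof -
  have L: "cpoly.subspace L" "cpoly.dim L = r" using assms by (auto simp: Grassmannian_def)
  obtain B where B: "B \<subseteq> L" "cpoly.independent B" "L \<subseteq> cpoly.span B" "card B = cpoly.dim L"
    by (rule cpoly.basis_exists)
  \<comment> \<open>An infinite set has \<open>card\<close> 0, so the positive dimension makes
    \<open>B\<close> finite.\<close>
  have "finite B" using B(4) L(2) assms(2) card_ge_0_finite by metis
  then obtain b where "bij_betw b {..<r} B"
    using ex_bij_betw_nat_finite[of B] B(4) L(2) by (auto simp: atLeast0LessThan)
  then have "inj_on b {..<r}" "b ` {..<r} = B" by (auto simp: bij_betw_def)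
  moreover have "cpoly.span B = L" using cpoly.span_subspace[OF B(1,3) L(1)] .
  ultimately show ?thesis using B(2) that[of b] by (simp add: is_basis_def)
qed

lemma span_lincomb:
  fixes b :: "nat \<Rightarrow> 'v cpoly"
  assumes "v \<in> cpoly.span (b ` {..<r})" "inj_on b {..<r}"
  obtains g where "v = (\<Sum>i<r. poly_scale (g i) (b i))"
proof -
  obtain u where "v = (\<Sum>x\<in>b ` {..<r}. poly_scale (u x) x)"
    using assms(1) cpoly.span_finite[OF finite_imageI[OF finite_lessThan[of r], where h = b]] by auto
  then have "v = (\<Sum>i<r. poly_scale (u (b i)) (b i))"
    using assms(2) by (simp add: sum.reindex)
  then show ?thesis by (rule that)
qed

lemma pluecker_lincomb:
  assumes "\<And>j. j < r \<Longrightarrow> b' j = (\<Sum>i<r. poly_scale (g i j) (b i))"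
  shows "pluecker r b' I = det (mat r r (\<lambda>(i, j). g i j)) * pluecker r b I"
proof -
  have "mat r r (\<lambda>(i, j). coef (b' j) (I ! i)) =
    mat r r (\<lambda>(i, j). coef (b j) (I ! i)) * mat r r (\<lambda>(i, j). g i j)"
    by (rule eq_matI)
      (auto simp: assms scalar_prod_def lookup_sum mult.commute atLeast0LessThan)
  then show ?thesis unfolding pluecker_def
    by (simp add: det_mult[of _ r] mult.commute)
qed

lemma pform_lincomb:
  assumes "h \<in> pforms n d r e" "\<And>j. j < r \<Longrightarrow> b' j = (\<Sum>i<r. poly_scale (g i j) (b i))"
  shows "h (pluecker r b') = det (mat r r (\<lambda>(i, j). g i j)) ^ e * h (pluecker r b)"
proof -
  have "pluecker r b' = (\<lambda>I. det (mat r r (\<lambda>(i, j). g i j)) * pluecker r b I)"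
    using pluecker_lincomb[of r b' g b] assms(2) by blast
  then show ?thesis using assms(1) by (auto simp: pforms_def eval_poly_scale_arg)
qed

lemma pform_basis_change:
  assumes "h \<in> pforms n d r e" "is_basis r b L" "is_basis r b' L" "h (pluecker r b) = 0"
  shows "h (pluecker r b') = 0"
proof -
  have "\<exists>g. b' j = (\<Sum>i<r. poly_scale (g i) (b i))" if "j < r" for j
  proof -
    have "b' j \<in> cpoly.span (b' ` {..<r})" using that by (intro cpoly.span_base) auto
    then have "b' j \<in> cpoly.span (b ` {..<r})" using assms(2,3) by (simp add: is_basis_def)
    then show ?thesis using assms(2) by (metis is_basis_def span_lincomb)
  qed
  then obtain g where "\<And>j. j < r \<Longrightarrow> b' j = (\<Sum>i<r. poly_scale (g j i) (b i))" by metis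
  from pform_lincomb[OF assms(1), of b' "\<lambda>i j. g j i" b, OF this] assms(4) show ?thesis by simp
qed

lemma principal_open_iff:
  assumes "L \<in> Grassmannian n d r" "is_basis r b L" "F \<in> forms (pluecker_indices n d r) e"
  shows "L \<in> principal_open n d r F \<longleftrightarrow> eval_poly (pluecker r b) F \<noteq> 0"
proof -
  have h: "(\<lambda>a. eval_poly a F) \<in> pforms n d r e" using assms(3) by (auto simp: pforms_def)
  have "eval_poly (pluecker r b) F \<noteq> 0" if "is_basis r b' L" "eval_poly (pluecker r b') F \<noteq> 0" for b'
    using pform_basis_change[OF h assms(2) that(1)] that(2) by blast
  then show ?thesis using assms(1,2) by (auto simp: principal_open_def)
qed

lemma topspace_zariski_Gr:
  assumes "r > 0" shows "topspace (zariski_Gr n d r) = Grassmannian n d r"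
proof -
  have "L \<in> principal_open n d r 1" if "L \<in> Grassmannian n d r" for L
    using Grassmannian_basis[OF that assms] that by (auto simp: principal_open_def)
  moreover have "1 \<in> forms (pluecker_indices n d r) 0" using forms_const[of 1] by simp
  moreover have "principal_open n d r F \<subseteq> Grassmannian n d r" for F by (auto simp: principal_open_def)
  ultimately show ?thesis
    unfolding zariski_Gr_def topology_generated_by_topspace by fast
qed

text \<open>The product \<open>F * F'\<close> is again homogeneous and is nonzero exactly where both
  factors are. Principal open sets are thus closed under intersection and form a basis, not merely a
  subbasis.\<close>

lemma openin_zariski_Gr_principal:
  assumes "r > 0" "openin (zariski_Gr n d r) U" "L \<in> U"
  obtains e F where "F \<in> forms (pluecker_indices n d r) e" "L \<in> principal_open n d r F"
    "principal_open n d r F \<subseteq> U"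
proof -
  have "generate_topology_on {principal_open n d r F | F e. F \<in> forms (pluecker_indices n d r) e} U"
    using assms(2) by (simp add: zariski_Gr_def openin_topology_generated_by_iff)
  then have "\<exists>e F. F \<in> forms (pluecker_indices n d r) e \<and> L \<in> principal_open n d r F \<and> principal_open n d r F \<subseteq> U"
    using assms(3)
  proof (induction U rule: generate_topology_on.induct)
    case (Int a b)
    then obtain e F e' F' where F: "F \<in> forms (pluecker_indices n d r) e" "L \<in> principal_open n d r F" "principal_open n d r F \<subseteq> a"
      "F' \<in> forms (pluecker_indices n d r) e'" "L \<in> principal_open n d r F'" "principal_open n d r F' \<subseteq> b" by blast
    have "M \<in> principal_open n d r (F * F') \<longleftrightarrow> M \<in> principal_open n d r F \<and> M \<in> principal_open n d r F'" for M
    proof (cases "M \<in> Grassmannian n d r")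
      case True
      then obtain c where "is_basis r c M" using Grassmannian_basis assms(1) by blast
      then show ?thesis using True F(1,4) forms_mult[OF F(1,4)]
        by (simp add: principal_open_iff eval_poly_mult)
    qed (simp add: principal_open_def)
    then show ?case using forms_mult[OF F(1,4)] F by blast
  next
    case (UN K)
    then obtain k where "k \<in> K" "L \<in> k" by blast
    then show ?case using UN.IH[of k] by blast
  qed auto
  then show ?thesis using that by blast
qed

section \<open>Linear functionals on forms and their minors\<close>

definition lform :: "nat \<Rightarrow> nat \<Rightarrow> ((nat \<Rightarrow>\<^sub>0 nat) \<Rightarrow> complex) \<Rightarrow> nat cpoly \<Rightarrow> complex" where
  "lform n d \<kappa> p = (\<Sum>m\<in>monomials {..n} d. \<kappa> m * coef p m)"

lemma lform_add: "lform n d \<kappa> (p + q) = lform n d \<kappa> p + lform n d \<kappa> q"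
  by (simp add: lform_def lookup_add algebra_simps sum.distrib)

lemma lform_scale: "lform n d \<kappa> (poly_scale c p) = c * lform n d \<kappa> p"
  by (simp add: lform_def sum_distrib_left mult_ac)

lemma lform_sum: "lform n d \<kappa> (\<Sum>i\<in>I. p i) = (\<Sum>i\<in>I. lform n d \<kappa> (p i))"
  by (induction I rule: infinite_finite_induct) (auto simp: lform_add, auto simp: lform_def)

lemma finite_monomials:
  assumes "finite X" shows "finite (monomials X d :: ('v \<Rightarrow>\<^sub>0 nat) set)"
proof (rule finite_imageD)
  show "inj_on coef (monomials X d :: ('v \<Rightarrow>\<^sub>0 nat) set)"
    by (rule inj_onI, rule poly_mapping_eqI) simp
  have "coef ` (monomials X d :: ('v \<Rightarrow>\<^sub>0 nat) set) \<subseteq>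
      {f. \<forall>x. (x \<in> X \<longrightarrow> f x \<in> {..d}) \<and> (x \<notin> X \<longrightarrow> f x = 0)}"
  proof (clarsimp, intro conjI impI)
    fix m :: "'v \<Rightarrow>\<^sub>0 nat" and x assume m: "m \<in> monomials X d"
    show "coef m x \<le> d" 
    proof (cases "x \<in> Poly_Mapping.keys m")
      case True
      then have "coef m x \<le> (\<Sum>i\<in>Poly_Mapping.keys m. coef m i)"
        by (intro member_le_sum) auto
      then show ?thesis using m by (simp add: monomials_def)
    qed (simp add: in_keys_iff)
    show "coef m x = 0" if "x \<notin> X"
      using m that by (auto simp: monomials_def in_keys_iff)
  qed
  then show "finite (coef ` (monomials X d :: ('v \<Rightarrow>\<^sub>0 nat) set))"
    by (rule finite_subset) (intro finite_set_of_finite_funs assms finite_atMost)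
qed

lemma pforms_add: "h \<in> pforms n d r e \<Longrightarrow> h' \<in> pforms n d r e \<Longrightarrow> (\<lambda>w. h w + h' w) \<in> pforms n d r e"
  unfolding pforms_def by (auto simp flip: eval_poly_add intro: forms_add)

lemma pforms_mult: "h \<in> pforms n d r e \<Longrightarrow> h' \<in> pforms n d r e' \<Longrightarrow> (\<lambda>w. h w * h' w) \<in> pforms n d r (e + e')"
  unfolding pforms_def by (auto simp flip: eval_poly_mult intro: forms_mult)

lemma pforms_const: "(\<lambda>w. c) \<in> pforms n d r 0"
  unfolding pforms_def
  by (auto intro!: exI[of _ "Poly_Mapping.single 0 c"] simp: eval_poly_single forms_const mono_val_def)

lemma pforms_zero: "(\<lambda>w. 0) \<in> pforms n d r e"
  unfolding pforms_def by (auto intro!: exI[of _ 0])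

lemma pforms_sum: "(\<And>i. i \<in> I \<Longrightarrow> h i \<in> pforms n d r e) \<Longrightarrow> (\<lambda>w. \<Sum>i\<in>I. h i w) \<in> pforms n d r e"
  by (induction I rule: infinite_finite_induct) (auto intro: pforms_zero pforms_add)

lemma pforms_scale: "h \<in> pforms n d r e \<Longrightarrow> (\<lambda>w. c * h w) \<in> pforms n d r e"
  using pforms_mult[OF pforms_const, of h n d r e c] by simp

lemma pforms_coord: "I \<in> pluecker_indices n d r \<Longrightarrow> (\<lambda>w. w I) \<in> pforms n d r 1"
  unfolding pforms_def
  by (intro CollectI exI[of _ "Poly_Mapping.single (Poly_Mapping.single I 1) 1"] conjI forms_single monomials_var)
    (auto simp: eval_poly_single mono_val_def)

text \<open>Multilinear expansion along the rows.\<close>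

lemma pform_det_lform:
  "\<exists>h\<in>pforms n d r 1. \<forall>b. h (pluecker r b) = det (mat r r (\<lambda>(i, j). lform n d (\<kappa> i) (b j)))"
proof -
  define M where "M = monomials {..n} d"
  have M: "finite M" unfolding M_def by (rule finite_monomials) simp
  \<comment> \<open>The sum runs over all tuples of monomials, unordered and repeated ones included;
    \<open>pluecker_indices\<close> contains them all.\<close>
  define h where "h w = (\<Sum>f\<in>PiE {0..<r} (\<lambda>_. M). (\<Prod>i = 0..<r. \<kappa> i (f i)) * w (map f [0..<r]))"
    for w :: "(nat \<Rightarrow>\<^sub>0 nat) list \<Rightarrow> complex"
  have "h \<in> pforms n d r 1" unfolding h_def[abs_def]
    by (intro pforms_sum pforms_scale pforms_coord) (auto simp: pluecker_indices_def M_def PiE_iff)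
  moreover have "h (pluecker r b) = det (mat r r (\<lambda>(i, j). lform n d (\<kappa> i) (b j)))" for b
  proof -
    have "det (mat r r (\<lambda>(i, j). lform n d (\<kappa> i) (b j))) =
      (\<Sum>p | p permutes {0..<r}. signof p * (\<Prod>i = 0..<r. lform n d (\<kappa> i) (b (p i))))"
      by (rule det_mat_Leibniz)
    also have "\<dots> = (\<Sum>p | p permutes {0..<r}. signof p *
        (\<Sum>f\<in>PiE {0..<r} (\<lambda>_. M). \<Prod>i = 0..<r. \<kappa> i (f i) * coef (b (p i)) (f i)))"
      using M by (simp add: lform_def prod_sum_PiE flip: M_def)
    also have "\<dots> = (\<Sum>f\<in>PiE {0..<r} (\<lambda>_. M). (\<Prod>i = 0..<r. \<kappa> i (f i)) *
        (\<Sum>p | p permutes {0..<r}. signof p * (\<Prod>i = 0..<r. coef (b (p i)) (f i))))"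
      unfolding sum_distrib_left by (subst sum.swap) (simp add: prod.distrib mult_ac)
    also have "\<dots> = h (pluecker r b)"
      unfolding h_def pluecker_def det_mat_Leibniz by (auto intro!: sum.cong prod.cong)
    finally show ?thesis by simp
  qed
  ultimately show ?thesis by blast
qed

text \<open>A linear relation among the \<open>b j\<close> lies in the kernel of the matrix; a
  coincidence \<open>b i = b j\<close> is the relation with coefficients 1 and -1.\<close>

lemma independent_of_det:
  assumes "det (mat r r (\<lambda>(i, j). lform n d (\<kappa> i) (b j))) \<noteq> 0"
  shows "inj_on b {..<r}" "cpoly.independent (b ` {..<r})"
proof -
  define A where "A = mat r r (\<lambda>(i, j). lform n d (\<kappa> i) (b j))"
  have A: "A \<in> carrier_mat r r" by (simp add: A_def)
  have zero: "c j = 0" if c: "(\<Sum>j<r. poly_scale (c j) (b j)) = 0" and j: "j < r" for c j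
  proof -
    have "A *\<^sub>v vec r c = 0\<^sub>v r"
    proof (rule eq_vecI)
      fix i assume "i < dim_vec (0\<^sub>v r)"
      then have i: "i < r" by simp
      have "(A *\<^sub>v vec r c) $ i = lform n d (\<kappa> i) (\<Sum>j<r. poly_scale (c j) (b j))"
        using i by (simp add: A_def scalar_prod_def lform_sum lform_scale atLeast0LessThan mult.commute)
      then show "(A *\<^sub>v vec r c) $ i = 0\<^sub>v r $ i" using i c by (simp add: lform_def)
    qed (simp add: A_def)
    then have "vec r c = 0\<^sub>v r" using det_0_iff_vec_prod_zero[OF A] assms
      by (metis A_def vec_carrier)
    then show ?thesis using j by (metis index_vec index_zero_vec(1))
  qed
  show inj: "inj_on b {..<r}"
  proof (rule inj_onI, rule ccontr)
    fix i j assume ij: "i \<in> {..<r}" "j \<in> {..<r}" "b i = b j" "i \<noteq> j"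
    have "(\<Sum>k<r. poly_scale (if k = i then 1 else if k = j then - 1 else 0) (b k)) =
      (\<Sum>k<r. (if k = i then b k else 0) - (if k = j then b k else 0))"
      using ij(4) by (intro sum.cong) auto
    also have "\<dots> = 0" using ij by (simp add: sum_subtractf sum.delta)
    finally show False using zero[of "\<lambda>k. if k = i then 1 else if k = j then - 1 else 0" i] ij by auto
  qed
  show "cpoly.independent (b ` {..<r})"
  proof (rule cpoly.independent_if_scalars_zero)
    fix f x assume "(\<Sum>x\<in>b ` {..<r}. poly_scale (f x) x) = 0" "x \<in> b ` {..<r}"
    then show "f x = 0" using zero[of "\<lambda>j. f (b j)"] by (auto simp: sum.reindex[OF inj])
  qed simp
qed

lemma form_expand:
  assumes "p \<in> forms X d" "finite X"
  shows "p = (\<Sum>m\<in>monomials X d. poly_scale (coef p m) (Poly_Mapping.single m 1))"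
proof -
  have "p = (\<Sum>m\<in>Poly_Mapping.keys p. Poly_Mapping.single m (coef p m))"
    by (rule poly_mapping_sum_single)
  also have "\<dots> = (\<Sum>m\<in>Poly_Mapping.keys p. poly_scale (coef p m) (Poly_Mapping.single m 1))"
    by (simp add: poly_scale_def mult_single)
  also have "\<dots> = (\<Sum>m\<in>monomials X d. poly_scale (coef p m) (Poly_Mapping.single m 1))"
    using assms by (intro sum.mono_neutral_left) (auto simp: forms_def in_keys_iff finite_monomials)
  finally show ?thesis .
qed

text \<open>Extend the basis of \<open>L\<close> to one of the whole polynomial space. The
  functionals dual to the \<open>b i\<close> give the identity matrix, so the corresponding form of
  degree 1 takes the value 1.\<close>

lemma Grassmannian_nonzero_form:
  assumes "L \<in> Grassmannian n d r" "is_basis r b L"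
  shows "\<exists>h\<in>pforms n d r 1. h (pluecker r b) \<noteq> 0"
proof -
  have ind: "cpoly.independent (b ` {..<r})" and inj: "inj_on b {..<r}" and L: "cpoly.span (b ` {..<r}) = L"
    using assms(2) by (auto simp: is_basis_def)
  define E where "E = cpoly.extend_basis (b ` {..<r})"
  have E: "cpoly.independent E" "b ` {..<r} \<subseteq> E" "cpoly.span E = UNIV"
    using ind by (auto simp: E_def cpoly.independent_extend_basis cpoly.extend_basis_superset[THEN subsetD])
  define \<kappa> where "\<kappa> i m = cpoly.representation E (Poly_Mapping.single m 1) (b i)" for i m
  have lf: "lform n d (\<kappa> i) p = cpoly.representation E p (b i)" if p: "p \<in> forms_space n d" for i p
  proof -
    have "cpoly.representation E p =
       cpoly.representation E (\<Sum>m\<in>monomials {..n} d. poly_scale (coef p m) (Poly_Mapping.single m 1))"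
      using form_expand[of p "{..n}" d] p by (simp add: forms_space_def)
    also have "\<dots> = (\<lambda>c. \<Sum>m\<in>monomials {..n} d. coef p m * \<kappa>' m c)"
      if "\<kappa>' = (\<lambda>m. cpoly.representation E (Poly_Mapping.single m 1))" for \<kappa>'
      using E that by (simp add: cpoly.representation_sum cpoly.representation_scale)
    finally show ?thesis by (simp add: lform_def \<kappa>_def mult.commute)
  qed
  have "mat r r (\<lambda>(i, j). lform n d (\<kappa> i) (b j)) = 1\<^sub>m r"
  proof (rule eq_matI)
    fix i j assume "i < dim_row (1\<^sub>m r)" "j < dim_col (1\<^sub>m r)"
    then have ij: "i < r" "j < r" by auto
    have "b j \<in> L" using ij L cpoly.span_base[of "b j" "b ` {..<r}"] by auto
    then have "b j \<in> forms_space n d" using assms(1) by (auto simp: Grassmannian_def)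
    moreover have "cpoly.representation E (b j) = (\<lambda>v. if v = b j then 1 else 0)"
      using E ij by (intro cpoly.representation_basis) auto
    ultimately show "mat r r (\<lambda>(i, j). lform n d (\<kappa> i) (b j)) $$ (i, j) = 1\<^sub>m r $$ (i, j)"
      using ij inj by (auto simp: lf inj_on_eq_iff)
  qed auto
  moreover obtain h where "h \<in> pforms n d r 1"
    "\<forall>b. h (pluecker r b) = det (mat r r (\<lambda>(i, j). lform n d (\<kappa> i) (b j)))"
    using pform_det_lform[of n d r \<kappa>] by blast
  ultimately show ?thesis by (intro bexI[of _ h]) auto
qed

text \<open>With \<open>S\<close> arbitrary, the constructible set \<open>Sigma_var\<close> and the
  whole Grassmannian are treated alike. A closed set is separated from a point outside by a single
  form because principal open sets form a basis.\<close>

lemma homogeneous_coordinates_Gr: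
  assumes r: "r > 0" and S: "S \<subseteq> Grassmannian n d r"
  shows "homogeneous_coordinates (subtopology (zariski_Gr n d r) S) (pforms n d r) (prel r)"
proof
  have top: "topspace (subtopology (zariski_Gr n d r) S) = S"
    using S by (auto simp: topspace_zariski_Gr[OF r])
  show "\<exists>w. prel r L w" if "L \<in> topspace (subtopology (zariski_Gr n d r) S)" for L
    using that S Grassmannian_basis[OF _ r] unfolding top prel_def by (metis subsetD)
  show "h w' = 0" if "h \<in> pforms n d r e" "prel r L w" "prel r L w'" "h w = 0" for L h e w w'
    using that(2-4) pform_basis_change[OF that(1)] unfolding prel_def by blast
  show "\<exists>h\<in>pforms n d r 1. \<exists>w. prel r L w \<and> h w \<noteq> 0"
    if "L \<in> topspace (subtopology (zariski_Gr n d r) S)" for L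
  proof -
    have L: "L \<in> Grassmannian n d r" using that S unfolding top by blast
    then obtain b where b: "is_basis r b L" by (rule Grassmannian_basis[OF _ r])
    from Grassmannian_nonzero_form[OF L b] b show ?thesis by (auto simp: prel_def)
  qed
  show "closedin (subtopology (zariski_Gr n d r) S) A \<longleftrightarrow>
      A \<subseteq> topspace (subtopology (zariski_Gr n d r) S) \<and>
      (\<forall>L\<in>topspace (subtopology (zariski_Gr n d r) S) - A. \<exists>e. \<exists>h\<in>pforms n d r e.
        (\<exists>w. prel r L w \<and> h w \<noteq> 0) \<and> (\<forall>L'\<in>A. \<forall>w. prel r L' w \<longrightarrow> h w = 0))" for A
    unfolding top
  proof (intro iffI conjI ballI)
    assume A: "closedin (subtopology (zariski_Gr n d r) S) A"
    then show AS: "A \<subseteq> S" using closedin_subset[OF A] top by simp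
    fix L assume L: "L \<in> S - A"
    have "openin (subtopology (zariski_Gr n d r) S) (S - A)" using A top by (simp add: closedin_def)
    then obtain U where U: "openin (zariski_Gr n d r) U" "S - A = U \<inter> S" by (auto simp: openin_subtopology)
    then have "L \<in> U" using L by blast
    then obtain e F where F: "F \<in> forms (pluecker_indices n d r) e" "L \<in> principal_open n d r F"
      "principal_open n d r F \<subseteq> U" using openin_zariski_Gr_principal[OF r U(1)] by blast
    define h where "h a = eval_poly a F" for a
    have h: "h \<in> pforms n d r e" using F(1) by (auto simp: h_def[abs_def] pforms_def)
    have "h w = 0" if L': "L' \<in> A" "prel r L' w" for L' w
    proof -
      obtain b where b: "is_basis r b L'" "w = pluecker r b" using L' by (auto simp: prel_def)
      have "L' \<notin> principal_open n d r F" using F(3) U(2) L'(1) AS by blast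
      then show ?thesis using principal_open_iff[OF _ b(1) F(1)] L'(1) AS S b(2) by (auto simp: h_def)
    qed
    moreover have "\<exists>w. prel r L w \<and> h w \<noteq> 0" using F(2) by (auto simp: principal_open_def prel_def h_def)
    ultimately show "\<exists>e. \<exists>h\<in>pforms n d r e. (\<exists>w. prel r L w \<and> h w \<noteq> 0) \<and> (\<forall>L'\<in>A. \<forall>w. prel r L' w \<longrightarrow> h w = 0)"
      using h by blast
  next
    assume A: "A \<subseteq> S \<and> (\<forall>L\<in>S - A. \<exists>e. \<exists>h\<in>pforms n d r e.
      (\<exists>w. prel r L w \<and> h w \<noteq> 0) \<and> (\<forall>L'\<in>A. \<forall>w. prel r L' w \<longrightarrow> h w = 0))"
    have "\<exists>V. openin (zariski_Gr n d r) V \<and> L \<in> V \<and> V \<inter> A = {}" if L: "L \<in> S - A" for L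
    proof -
      obtain e F where F: "F \<in> forms (pluecker_indices n d r) e" "\<exists>w. prel r L w \<and> eval_poly w F \<noteq> 0"
        "\<forall>L'\<in>A. \<forall>w. prel r L' w \<longrightarrow> eval_poly w F = 0"
        using A L unfolding pforms_def by blast
      have "openin (zariski_Gr n d r) (principal_open n d r F)"
        unfolding zariski_Gr_def using F(1) by (intro topology_generated_by_Basis) blast
      moreover have "L \<in> principal_open n d r F"
        using F(2) L S by (auto simp: principal_open_def prel_def)
      moreover have "principal_open n d r F \<inter> A = {}"
        using F(3) by (auto simp: principal_open_def prel_def)
      ultimately show ?thesis by blast
    qed
    then obtain V where V: "\<And>L. L \<in> S - A \<Longrightarrow> openin (zariski_Gr n d r) (V L) \<and> L \<in> V L \<and> V L \<inter> A = {}"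
      by metis
    have "openin (zariski_Gr n d r) (\<Union>(V ` (S - A)))" using V by (intro openin_Union) blast
    moreover have "S - A = \<Union>(V ` (S - A)) \<inter> S" using V by blast
    ultimately have "openin (subtopology (zariski_Gr n d r) S) (S - A)"
      unfolding openin_subtopology by blast
    then show "closedin (subtopology (zariski_Gr n d r) S) A" using A top by (simp add: closedin_def)
  qed
qed (auto intro: pforms_add pforms_mult pforms_const pforms_zero)

section \<open>Forms along polynomial families of frames\<close>

lemma pluecker_polyfuns:
  assumes "\<And>j m. j < r \<Longrightarrow> (\<lambda>x. coef (b x j) m) \<in> polyfuns N D"
  shows "(\<lambda>x. pluecker r (b x) I) \<in> polyfuns N (r * D)"
  unfolding pluecker_def by (rule polyfuns_det) (use assms in auto)

lemma pform_polyfuns: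
  assumes "h \<in> pforms n d r e" "\<And>j m. j < r \<Longrightarrow> (\<lambda>x. coef (b x j) m) \<in> polyfuns N D"
  shows "(\<lambda>x. h (pluecker r (b x))) \<in> polyfuns N (r * D * e)"
proof -
  obtain F where "h = (\<lambda>a. eval_poly a F)" "F \<in> forms (pluecker_indices n d r) e"
    using assms(1) by (auto simp: pforms_def)
  then show ?thesis
    using polyfuns_eval_poly[of F _ e "\<lambda>x. pluecker r (b x)" N "r * D"] pluecker_polyfuns[of r b N D] assms(2)
    by blast
qed

lemma pform_upoly:
  assumes "h \<in> pforms n d r e" "\<And>j m. j < r \<Longrightarrow> upoly (\<lambda>t. coef (b t j) m)"
  shows "upoly (\<lambda>t. h (pluecker r (b t)))"
proof -
  obtain F where h: "h = (\<lambda>a. eval_poly a F)" using assms(1) by (auto simp: pforms_def)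
  show ?thesis unfolding h pluecker_def
    by (intro upoly_eval_poly upoly_det) (use assms(2) in auto)
qed

lemma pform_cong:
  "(\<And>j. j < r \<Longrightarrow> b j = b' j) \<Longrightarrow> pluecker r b = pluecker r b'"
  unfolding pluecker_def by (intro ext arg_cong[where f = det] eq_matI) auto

subsection \<open>Matrices as functions of two indices\<close>

lemma left_inverse:
  fixes M :: "nat \<Rightarrow> nat \<Rightarrow> 'a::field"
  assumes "det (mat r r (\<lambda>(i, j). M i j)) \<noteq> 0"
  obtains C where "\<And>i j. i < r \<Longrightarrow> j < r \<Longrightarrow> (\<Sum>l<r. C i l * M l j) = (if i = j then 1 else 0)"
proof -
  define A where "A = mat r r (\<lambda>(i, j). M i j)"
  define C where "C i l = adj_mat A $$ (i, l) / det A" for i l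
  have A: "A \<in> carrier_mat r r" by (simp add: A_def)
  have "(\<Sum>l<r. C i l * M l j) = (if i = j then 1 else 0)" if ij: "i < r" "j < r" for i j
  proof -
    have "(adj_mat A * A) $$ (i, j) = (\<Sum>l<r. adj_mat A $$ (i, l) * M l j)"
      using ij adj_mat(1)[OF A] by (simp add: A_def scalar_prod_def atLeast0LessThan)
    moreover have "(adj_mat A * A) $$ (i, j) = (if i = j then det A else 0)"
      using ij by (simp add: adj_mat(3)[OF A])
    ultimately have S: "(\<Sum>l<r. adj_mat A $$ (i, l) * M l j) = (if i = j then det A else 0)"
      by (rule trans[OF sym])
    have "(\<Sum>l<r. C i l * M l j) = (\<Sum>l<r. adj_mat A $$ (i, l) * M l j) / det A"
      by (simp add: C_def sum_divide_distrib)
    moreover have "det A \<noteq> 0" using assms by (simp add: A_def)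
    ultimately show ?thesis by (simp add: S)
  qed
  then show ?thesis by (rule that)
qed

text \<open>The reversed polynomial \<open>det (s A + I)\<close> is 1 at \<open>s = 0\<close>, so it
  is nonzero at some \<open>s \<noteq> 0\<close>, and \<open>t = 1 / s\<close> works.\<close>

lemma det_shift_nonzero:
  fixes A :: "nat \<Rightarrow> nat \<Rightarrow> complex"
  obtains t where "det (mat r r (\<lambda>(i, j). A i j + (if i = j then t else 0))) \<noteq> 0"
proof -
  define f where "f s = det (mat r r (\<lambda>(i, j). s * A i j + (if i = j then 1 else 0)))" for s
  have f: "upoly f" unfolding f_def by (intro upoly_det upoly_intros)
  have "mat r r (\<lambda>(i, j). 0 * A i j + (if i = j then 1 else 0)) = 1\<^sub>m r"
    by (rule eq_matI) auto
  then have "f 0 \<noteq> 0" by (simp add: f_def)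
  then obtain s where s: "s \<noteq> 0" "f s \<noteq> 0"
    using upoly_mult_zero[OF f upoly_id one_neq_zero] by blast
  have "mat r r (\<lambda>(i, j). s * A i j + (if i = j then 1 else 0)) =
      s \<cdot>\<^sub>m mat r r (\<lambda>(i, j). A i j + (if i = j then 1 / s else 0))"
    using s(1) by (intro eq_matI) (auto simp: distrib_left)
  then have "det (mat r r (\<lambda>(i, j). A i j + (if i = j then 1 / s else 0))) \<noteq> 0"
    using s(2) by (auto simp: f_def)
  then show ?thesis by (rule that)
qed

text \<open>In the Leibniz sum, a permutation other than the identity moves some index besides
  \<open>k\<close> and meets an off-diagonal zero there. Exchanging one row of an identity minor
  thus reads off a single chosen entry.\<close>

lemma det_replace_row:
  fixes y :: "nat \<Rightarrow> 'a::comm_ring_1"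
  assumes "k < r"
  shows "det (mat r r (\<lambda>(i, j). if i = k then y j else if i = j then 1 else 0)) = y k"
proof -
  define M where "M i j = (if i = k then y j else if i = j then 1 else 0)" for i j
  have "det (mat r r (\<lambda>(i, j). M i j)) =
      (\<Sum>p | p permutes {0..<r}. signof p * (\<Prod>i = 0..<r. M i (p i)))"
    by (rule det_mat_Leibniz)
  also have "\<dots> = (\<Sum>p\<in>{id}. signof p * (\<Prod>i = 0..<r. M i (p i)))"
  proof (rule sum.mono_neutral_right)
    show "{id} \<subseteq> {p. p permutes {0..<r}}" by (simp add: permutes_id)
    show "\<forall>p\<in>{p. p permutes {0..<r}} - {id}. signof p * (\<Prod>i = 0..<r. M i (p i)) = 0"
    proof
      fix p assume p: "p \<in> {p. p permutes {0..<r}} - {id}"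
      have "\<exists>i\<in>{0..<r}. i \<noteq> k \<and> p i \<noteq> i"
      proof (rule ccontr)
        assume "\<not> ?thesis"
        then have fixed: "p i = i" if "i \<noteq> k" for i
          using p that permutes_not_in[of p "{0..<r}" i] by (cases "i \<in> {0..<r}") auto
        have "inj p" using p permutes_inj by blast
        have "p k = k"
        proof (rule ccontr)
          assume "p k \<noteq> k"
          then have "p (p k) = p k" by (rule fixed)
          then show False using \<open>inj p\<close> \<open>p k \<noteq> k\<close> by (simp add: inj_eq)
        qed
        then have "p = id" using fixed by (metis eq_id_iff)
        then show False using p by simp
      qed
      then obtain i where i: "i \<in> {0..<r}" "i \<noteq> k" "p i \<noteq> i" by blast
      then have "M i (p i) = 0" by (simp add: M_def)
      then have "(\<Prod>i = 0..<r. M i (p i)) = 0"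
        using i(1) by (intro prod_zero bexI[of _ i]) simp_all
      then show "signof p * (\<Prod>i = 0..<r. M i (p i)) = 0" by simp
    qed
  qed (simp add: finite_permutations)
  also have "\<dots> = (\<Prod>i = 0..<r. M i i)" by simp
  also have "\<dots> = (\<Prod>i = 0..<r. if i = k then y k else 1)"
    by (intro prod.cong) (auto simp: M_def)
  also have "\<dots> = y k" using assms by (simp add: prod.delta)
  finally show ?thesis by (simp add: M_def)
qed

text \<open>The top block of a generic coefficient matrix is invertible.\<close>

lemma pform_echelon:
  assumes h: "h \<in> pforms n d r e" and rK: "r \<le> K"
    and van: "\<And>\<alpha>. h (pluecker r (\<lambda>j. w j + (\<Sum>k\<in>{r..<K}. poly_scale (\<alpha> k j) (w k)))) = 0"
  shows "h (pluecker r (\<lambda>j. \<Sum>k<K. poly_scale (A k j) (w k))) = 0"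
proof -
  \<comment> \<open>The diagonal shift makes the top \<open>r\<close> by \<open>r\<close> block
    invertible for generic \<open>t\<close> and gives back \<open>A\<close> at
    \<open>t = 0\<close>.\<close>
  define B where "B t k j = A k j + (if k = j then t else 0)" for t k j
  define f where "f t = h (pluecker r (\<lambda>j. \<Sum>k<K. poly_scale (B t k j) (w k)))" for t
  define g where "g t = det (mat r r (\<lambda>(k, j). B t k j))" for t
  have B: "upoly (\<lambda>t. B t k j)" for k j
    unfolding B_def by (cases "k = j") (auto intro!: upoly_intros)
  have "upoly f" unfolding f_def
    by (rule pform_upoly[OF h]) (auto simp: lookup_sum intro!: upoly_intros B)
  moreover have "upoly g" unfolding g_def by (intro upoly_det B)
  moreover obtain s where "g s \<noteq> 0" unfolding g_def B_def by (rule det_shift_nonzero)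
  moreover have "f t = 0" if gt: "g t \<noteq> 0" for t
  proof -
    obtain C where C: "\<And>i j. i < r \<Longrightarrow> j < r \<Longrightarrow> (\<Sum>l<r. C i l * B t l j) = (if i = j then 1 else 0)"
      using left_inverse[OF gt[unfolded g_def]] by blast
    \<comment> \<open>\<open>C\<close> inverts the top block, so this is the coefficient matrix
      times that inverse: the rows from \<open>r\<close> on hold the free entries of the echelon
      form.\<close>
    define \<alpha> where "\<alpha> k i = (\<Sum>l<r. B t k l * C l i)" for k i
    have \<alpha>: "(\<Sum>i<r. B t i j * \<alpha> k i) = B t k j" if j: "j < r" for k j
    proof -
      have "(\<Sum>i<r. B t i j * \<alpha> k i) = (\<Sum>i<r. \<Sum>l<r. B t k l * (C l i * B t i j))"
        by (simp add: \<alpha>_def sum_distrib_left mult_ac)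
      also have "\<dots> = (\<Sum>l<r. B t k l * (\<Sum>i<r. C l i * B t i j))"
        by (subst sum.swap) (simp add: sum_distrib_left)
      also have "\<dots> = (\<Sum>l<r. B t k l * (if l = j then 1 else 0))"
        using j by (intro sum.cong) (auto simp: C)
      also have "\<dots> = B t k j" using j by (simp add: if_distrib[of "\<lambda>z. _ * z"] cong: if_cong)
      finally show ?thesis .
    qed
    have "(\<Sum>k<K. poly_scale (B t k j) (w k)) =
        (\<Sum>i<r. poly_scale (B t i j) (w i + (\<Sum>k\<in>{r..<K}. poly_scale (\<alpha> k i) (w k))))" if j: "j < r" for j
    proof -
      have "(\<Sum>i<r. poly_scale (B t i j) (w i + (\<Sum>k\<in>{r..<K}. poly_scale (\<alpha> k i) (w k)))) =
        (\<Sum>i<r. poly_scale (B t i j) (w i)) + (\<Sum>i<r. \<Sum>k\<in>{r..<K}. poly_scale (B t i j * \<alpha> k i) (w k))"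
        by (simp add: cpoly.scale_right_distrib cpoly.scale_sum_right sum.distrib)
      also have "(\<Sum>i<r. \<Sum>k\<in>{r..<K}. poly_scale (B t i j * \<alpha> k i) (w k)) =
        (\<Sum>k\<in>{r..<K}. poly_scale (B t k j) (w k))"
        by (subst sum.swap) (simp add: \<alpha>[OF j] flip: cpoly.scale_sum_left)
      also have "(\<Sum>i<r. poly_scale (B t i j) (w i)) + \<dots> = (\<Sum>k<K. poly_scale (B t k j) (w k))"
        using rK sum.atLeastLessThan_concat[of 0 r K] by (simp add: atLeast0LessThan)
      finally show ?thesis by simp
    qed
    from pform_lincomb[OF h, of "\<lambda>j. \<Sum>k<K. poly_scale (B t k j) (w k)", OF this] show ?thesis
      unfolding f_def using van by simp
  qed
  ultimately have "f 0 = 0" by (rule upoly_mult_zero)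
  then show ?thesis by (simp add: f_def B_def cong: if_cong)
qed

subsection \<open>Quadratic forms in four variables\<close>

lemma monomials_SucE:
  fixes m :: "'v \<Rightarrow>\<^sub>0 nat"
  assumes "m \<in> monomials X (Suc d)"
  obtains a m' where "a \<in> X" "m' \<in> monomials X d" "m = Poly_Mapping.single a 1 + m'"
proof -
  have "Poly_Mapping.keys m \<noteq> {}" using assms by (auto simp: monomials_def)
  then obtain a where a: "a \<in> Poly_Mapping.keys m" by blast
  define m' where "m' = m - Poly_Mapping.single a 1"
  have eq: "m = Poly_Mapping.single a 1 + m'"
    by (rule poly_mapping_eqI) (use a in \<open>auto simp: m'_def lookup_add lookup_minus lookup_single when_def in_keys_iff\<close>)
  have sub: "Poly_Mapping.keys m' \<subseteq> Poly_Mapping.keys m"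
    by (auto simp: m'_def in_keys_iff lookup_minus)
  have "(\<Sum>i\<in>Poly_Mapping.keys m. coef m i) =
    (\<Sum>i\<in>Poly_Mapping.keys m. (if i = a then 1 else 0) + coef m' i)"
  proof (intro sum.cong refl)
    fix i
    from arg_cong[OF eq, of "\<lambda>p. coef p i"]
    show "coef m i = (if i = a then 1 else 0) + coef m' i"
      by (auto simp: lookup_add lookup_single when_def)
  qed
  also have "\<dots> = 1 + (\<Sum>i\<in>Poly_Mapping.keys m'. coef m' i)"
    using a sub by (simp add: sum.distrib deg_superset[of "Poly_Mapping.keys m" m'])
  finally have "m' \<in> monomials X d" using assms sub by (auto simp: monomials_def)
  then show ?thesis using that[OF _ _ eq] a assms by (auto simp: monomials_def)
qed

lemma monomials_0: "monomials X 0 = {0}"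
proof -
  have "m = 0" if "m \<in> monomials X 0" for m :: "'a \<Rightarrow>\<^sub>0 nat"
    using that by (intro poly_mapping_eqI) (auto simp: monomials_def in_keys_iff)
  then show ?thesis by (auto simp: monomials_def)
qed

definition var :: "nat \<Rightarrow> nat cpoly" where
  "var i = Poly_Mapping.single (Poly_Mapping.single i 1) 1"

definition lin :: "(nat \<Rightarrow> complex) \<Rightarrow> nat cpoly" where
  "lin u = (\<Sum>i<4. poly_scale (u i) (var i))"

lemma linear_formE:
  assumes "p \<in> forms_space 3 1" obtains u where "p = lin u"
proof -
  have eq: "monomials {..3::nat} 1 = (\<lambda>i. Poly_Mapping.single i 1) ` {..<4}"
  proof (intro equalityI subsetI)
    fix m assume "m \<in> monomials {..3::nat} 1"
    then obtain a m' where "a \<in> {..3}" "m' \<in> monomials {..3::nat} 0" "m = Poly_Mapping.single a 1 + m'"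
      using monomials_SucE[of m "{..3}" 0] by auto
    then show "m \<in> (\<lambda>i. Poly_Mapping.single i 1) ` {..<4}" by (auto simp: monomials_0)
  qed (auto simp: monomials_def)
  have inj: "inj_on (\<lambda>i. Poly_Mapping.single i (1::nat)) {..<4::nat}"
    by (rule inj_onI) (metis lookup_single_eq lookup_single_not_eq zero_neq_one)
  have "p = (\<Sum>m\<in>monomials {..3} 1. poly_scale (coef p m) (Poly_Mapping.single m 1))"
    using assms by (intro form_expand) (simp_all add: forms_space_def)
  also have "\<dots> = lin (\<lambda>i. coef p (Poly_Mapping.single i 1))"
    unfolding eq lin_def var_def by (subst sum.reindex[OF inj]) simp
  finally show ?thesis by (rule that)
qed

lemma lin_form: "lin u \<in> forms_space 3 1"
  unfolding lin_def forms_space_def var_def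
  by (intro forms_sum forms_scale forms_single monomials_var) auto

text \<open>This order of the ten quadratic monomials gives the explicit coefficient lists
  \<open>frame_dual\<close>, \<open>square_dual\<close> and \<open>tangent_dual\<close> their
  meaning.\<close>

definition quad_pairs :: "(nat \<times> nat) list" where
  "quad_pairs = [(0,0), (0,1), (0,2), (0,3), (1,1), (1,2), (1,3), (2,2), (2,3), (3,3)]"

definition quad_mono :: "nat \<Rightarrow> (nat \<Rightarrow>\<^sub>0 nat)" where
  "quad_mono k = (case quad_pairs ! k of (a, b) \<Rightarrow> Poly_Mapping.single a 1 + Poly_Mapping.single b 1)"

lemma less_10_cases:
  fixes k :: nat
  shows "k < 10 \<longleftrightarrow> k = 0 \<or> k = 1 \<or> k = 2 \<or> k = 3 \<or> k = 4 \<or> k = 5 \<or> k = 6 \<or> k = 7 \<or> k = 8 \<or> k = 9"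
  by auto

lemma single_add_single_eq_iff:
  "Poly_Mapping.single a (1::nat) + Poly_Mapping.single b 1 = Poly_Mapping.single c 1 + Poly_Mapping.single d 1 \<longleftrightarrow>
    (a = c \<and> b = d) \<or> (a = d \<and> b = c)"
proof
  assume "Poly_Mapping.single a (1::nat) + Poly_Mapping.single b 1 = Poly_Mapping.single c 1 + Poly_Mapping.single d 1"
  then have *: "(if a = x then 1 else 0) + (if b = x then 1 else 0) = ((if c = x then 1 else 0) + (if d = x then 1 else 0) :: nat)" for x
    by (drule_tac arg_cong[where f = "\<lambda>m. coef m x"]) (auto simp: lookup_add lookup_single when_def split: if_splits)
  show "(a = c \<and> b = d) \<or> (a = d \<and> b = c)"
  proof (cases "a = c")
    case True
    then show ?thesis using *[of b] by (simp split: if_split_asm)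
  next
    case False
    then have "d = a" using *[of a] by (simp split: if_split_asm)
    then show ?thesis using False *[of c] by (simp split: if_split_asm)
  qed
qed (auto simp: add.commute)

lemma quad_monomials: "monomials {..3::nat} 2 = quad_mono ` {..<10}"
proof (intro equalityI subsetI)
  fix m assume "m \<in> monomials {..3::nat} 2"
  then obtain a m' where a: "a \<le> 3" "m' \<in> monomials {..3::nat} 1" "m = Poly_Mapping.single a 1 + m'"
    using monomials_SucE[of m "{..3}" 1] by (auto simp: numeral_2_eq_2)
  then obtain b m'' where b: "b \<le> 3" "m'' \<in> monomials {..3::nat} 0" "m' = Poly_Mapping.single b 1 + m''"
    using monomials_SucE[of m' "{..3}" 0] by auto
  have m: "m = Poly_Mapping.single a 1 + Poly_Mapping.single b 1" "m = Poly_Mapping.single b 1 + Poly_Mapping.single a 1"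
    using a b by (auto simp: monomials_0 add.commute)
  have "a = 0 \<or> a = 1 \<or> a = 2 \<or> a = 3" "b = 0 \<or> b = 1 \<or> b = 2 \<or> b = 3" using a(1) b(1) by auto
  moreover have "(a, b) \<in> set quad_pairs \<or> (b, a) \<in> set quad_pairs"
    using calculation by (auto simp: quad_pairs_def)
  ultimately obtain k where "k < length quad_pairs" "quad_pairs ! k = (a, b) \<or> quad_pairs ! k = (b, a)"
    by (metis in_set_conv_nth)
  then show "m \<in> quad_mono ` {..<10}" using m
    by (auto simp: quad_mono_def quad_pairs_def[THEN arg_cong[where f = length]] intro!: image_eqI[of _ _ k])
next
  fix m assume "m \<in> quad_mono ` {..<10}"
  then obtain k where k: "k < 10" "m = quad_mono k" by auto
  then obtain a b where ab: "quad_pairs ! k = (a, b)" "a \<le> 3" "b \<le> 3"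
    by (auto simp: less_10_cases quad_pairs_def)
  then show "m \<in> monomials {..3} 2"
    using monomials_add[OF monomials_var[of a "{..3}"] monomials_var[of b "{..3}"]] k
    by (simp add: quad_mono_def numeral_2_eq_2)
qed

lemma quad_mono_inj: "k < 10 \<Longrightarrow> l < 10 \<Longrightarrow> quad_mono k = quad_mono l \<longleftrightarrow> k = l"
proof -
  assume kl: "k < 10" "l < 10"
  have len: "length quad_pairs = 10" and dist: "distinct quad_pairs"
    and sorted: "\<forall>(a, b)\<in>set quad_pairs. a \<le> b" by (simp_all add: quad_pairs_def)
  obtain a b where ab: "quad_pairs ! k = (a, b)" by fastforce
  obtain c d where cd: "quad_pairs ! l = (c, d)" by fastforce
  have le: "a \<le> b" "c \<le> d" using sorted kl len ab cd by (metis nth_mem case_prodD)+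
  have "quad_mono k = quad_mono l \<longleftrightarrow> (a = c \<and> b = d) \<or> (a = d \<and> b = c)"
    unfolding quad_mono_def ab cd by (simp only: case_prod_conv single_add_single_eq_iff)
  also have "\<dots> \<longleftrightarrow> (a, b) = (c, d)" using le by auto
  also have "\<dots> \<longleftrightarrow> k = l" using kl len dist nth_eq_iff_index_eq[of quad_pairs k l] by (simp add: ab cd)
  finally show "quad_mono k = quad_mono l \<longleftrightarrow> k = l" .
qed

definition quad_var :: "nat \<Rightarrow> nat cpoly" where
  "quad_var k = Poly_Mapping.single (quad_mono k) 1"

lemma lookup_quad_var: "k < 10 \<Longrightarrow> l < 10 \<Longrightarrow> coef (quad_var k) (quad_mono l) = (if k = l then 1 else 0)"
  by (simp add: quad_var_def lookup_single when_def quad_mono_inj)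

lemma quad_expand:
  assumes "p \<in> forms_space 3 2"
  shows "p = (\<Sum>k<10. poly_scale (coef p (quad_mono k)) (quad_var k))"
proof -
  have "p = (\<Sum>m\<in>monomials {..3} 2. poly_scale (coef p m) (Poly_Mapping.single m 1))"
    using assms by (intro form_expand) (simp_all add: forms_space_def)
  also have "\<dots> = (\<Sum>k<10. poly_scale (coef p (quad_mono k)) (quad_var k))"
    unfolding quad_monomials by (subst sum.reindex) (auto simp: inj_on_def quad_mono_inj quad_var_def)
  finally show ?thesis .
qed

lemma quad_var_form: "k < 10 \<Longrightarrow> quad_var k \<in> forms_space 3 2"
  by (auto simp: quad_var_def forms_space_def quad_monomials intro!: forms_single)

definition bil_coeff :: "(nat \<Rightarrow> complex) \<Rightarrow> (nat \<Rightarrow> complex) \<Rightarrow> nat \<Rightarrow> complex" where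
  "bil_coeff u v k = (case quad_pairs ! k of (a, b) \<Rightarrow> if a = b then u a * v a else u a * v b + u b * v a)"

lemma lin_mult: "lin u * lin v = (\<Sum>i<4. \<Sum>j<4. poly_scale (u i * v j) (var i * var j))"
  unfolding lin_def sum_product
  by (intro sum.cong refl) (simp add: poly_scale_def mult_single mult_ac flip: mult.assoc)

lemma lookup_lin_mult:
  assumes "k < 10" shows "coef (lin u * lin v) (quad_mono k) = bil_coeff u v k"
proof -
  obtain a b where ab: "quad_pairs ! k = (a, b)" "a < 4" "b < 4"
    using assms by (auto simp: less_10_cases quad_pairs_def)
  have "coef (var i * var j) (quad_mono k) =
      (if (i = a \<and> j = b) \<or> (i = b \<and> j = a) then 1 else 0)" for i j
    using ab by (simp add: var_def mult_single quad_mono_def lookup_single when_def single_add_single_eq_iff del: One_nat_def)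
  then have "coef (lin u * lin v) (quad_mono k) =
    (\<Sum>i<4. \<Sum>j<4. u i * v j * (if (i = a \<and> j = b) \<or> (i = b \<and> j = a) then 1 else 0))"
    by (simp add: lin_mult lookup_sum)
  also have "\<dots> = (\<Sum>i<4. \<Sum>j<4. (if i = a then if j = b then u i * v j else 0 else 0) +
      (if a \<noteq> b then if i = b then if j = a then u i * v j else 0 else 0 else 0))"
    by (intro sum.cong refl) auto
  also have "\<dots> = bil_coeff u v k"
  proof -
    have if_sum: "(\<Sum>j<(4::nat). if P then f j else 0) = (if P then \<Sum>j<4. f j else 0)"
      for P and f :: "nat \<Rightarrow> complex" by simp
    show ?thesis
      using ab(2,3) by (simp only: if_sum sum.distrib) (auto simp: bil_coeff_def ab(1) if_sum)
  qed
  finally show ?thesis .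
qed

lemma lin_mult_form: "lin u * lin v \<in> forms_space 3 2"
  using forms_mult[OF lin_form[of u, unfolded forms_space_def] lin_form[of v, unfolded forms_space_def]]
  by (simp add: forms_space_def numeral_2_eq_2)

definition quad_functional :: "(nat \<Rightarrow> complex) \<Rightarrow> nat cpoly \<Rightarrow> complex" where
  "quad_functional c p = (\<Sum>k<10. c k * coef p (quad_mono k))"

lemma quad_functional_lform: "quad_functional c = lform 3 2 (\<lambda>m. \<Sum>k<10. if m = quad_mono k then c k else 0)"
proof
  fix p
  have "lform 3 2 (\<lambda>m. \<Sum>k<10. if m = quad_mono k then c k else 0) p =
    (\<Sum>l<10. (\<Sum>k<10. if quad_mono l = quad_mono k then c k else 0) * coef p (quad_mono l))"
    unfolding lform_def quad_monomials by (subst sum.reindex) (auto simp: inj_on_def quad_mono_inj)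
  also have "\<dots> = (\<Sum>l<10. c l * coef p (quad_mono l))"
  proof (intro sum.cong refl arg_cong2[where f = "(*)"])
    fix l :: nat assume "l \<in> {..<10}"
    then have "(\<Sum>k<10. if quad_mono l = quad_mono k then c k else 0) = (\<Sum>k<10. if l = k then c k else 0)"
      by (intro sum.cong) (auto simp: quad_mono_inj)
    then show "(\<Sum>k<10. if quad_mono l = quad_mono k then c k else 0) = c l"
      using \<open>l \<in> {..<10}\<close> by simp
  qed
  finally show "quad_functional c p = lform 3 2 (\<lambda>m. \<Sum>k<10. if m = quad_mono k then c k else 0) p"
    by (simp add: quad_functional_def)
qed

lemma pform_det_quad:
  obtains h where "h \<in> pforms 3 2 r 1"
    "\<And>b. h (pluecker r b) = det (mat r r (\<lambda>(i, j). quad_functional (c i) (b j)))"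
  using pform_det_lform[of 3 2 r "\<lambda>i m. \<Sum>k<10. if m = quad_mono k then c i k else 0"]
  unfolding quad_functional_lform by blast

lemma independent_of_quad_det:
  assumes "det (mat r r (\<lambda>(i, j). quad_functional (c i) (b j))) \<noteq> 0"
  shows "inj_on b {..<r}" "cpoly.independent (b ` {..<r})"
  using independent_of_det[of r 3 2 "\<lambda>i m. \<Sum>k<10. if m = quad_mono k then c i k else 0" b] assms
  unfolding quad_functional_lform by blast+

lemma forms_space_subspace: "cpoly.subspace (forms_space n d)"
  by (rule cpoly.subspaceI) (auto simp: forms_space_def forms_add forms_scale)

lemma Grassmannian_span:
  assumes "inj_on b {..<r}" "cpoly.independent (b ` {..<r})" "\<And>j. j < r \<Longrightarrow> b j \<in> forms_space n d"
  shows "cpoly.span (b ` {..<r}) \<in> Grassmannian n d r" "is_basis r b (cpoly.span (b ` {..<r}))"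
proof -
  have "cpoly.span (b ` {..<r}) \<subseteq> forms_space n d"
    by (rule cpoly.span_minimal) (use assms forms_space_subspace in auto)
  moreover have "cpoly.dim (cpoly.span (b ` {..<r})) = r"
    using assms by (simp add: cpoly.dim_eq_card_independent card_image)
  ultimately show "cpoly.span (b ` {..<r}) \<in> Grassmannian n d r" by (simp add: Grassmannian_def)
  show "is_basis r b (cpoly.span (b ` {..<r}))" using assms by (simp add: is_basis_def)
qed

subsection \<open>The dimension of the Grassmannian\<close>

definition coord_fun :: "nat \<Rightarrow> nat \<Rightarrow> complex" where
  "coord_fun k l = (if l = k then 1 else 0)"

lemma quad_functional_coord_fun: "k < 10 \<Longrightarrow> quad_functional (coord_fun k) p = coef p (quad_mono k)"
  by (simp add: quad_functional_def coord_fun_def if_distrib[of "\<lambda>z. z * _"] cong: if_cong)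

text \<open>The big cell of the Grassmannian: an identity block on top of a free 5 by 5 block, whose
  entry in row \<open>k\<close> and column \<open>j\<close> is parameter number
  \<open>5 * (k - 5) + j\<close>.\<close>

definition Gr_frame :: "(nat \<Rightarrow> complex) \<Rightarrow> nat \<Rightarrow> nat cpoly" where
  "Gr_frame x j = quad_var j + (\<Sum>k\<in>{5..<10}. poly_scale (x (5 * (k - 5) + j)) (quad_var k))"

lemma lookup_Gr_frame:
  assumes "j < 5" "l < 10"
  shows "coef (Gr_frame x j) (quad_mono l) =
    (if l < 5 then if l = j then 1 else 0 else x (5 * (l - 5) + j))"
  using assms
  by (auto simp: Gr_frame_def lookup_add lookup_sum lookup_quad_var if_distrib[of "\<lambda>z. _ * z"] cong: if_cong)

lemma Gr_frame_polyfuns: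
  assumes "j < 5" shows "(\<lambda>x. coef (Gr_frame x j) m) \<in> polyfuns 25 1"
proof -
  have "(\<lambda>x. coef (quad_var j) m +
      (\<Sum>k\<in>{5..<10}. coef (quad_var k) m * x (5 * (k - 5) + j))) \<in> polyfuns 25 1"
    using assms by (intro polyfuns_add polyfuns_const polyfuns_sum polyfuns_scale polyfuns_coord) auto
  then show ?thesis by (simp add: Gr_frame_def lookup_add lookup_sum mult.commute)
qed

theorem krull_dim_Gr: "krull_dim (zariski_Gr 3 2 5) = 25"
proof -
  have top: "topspace (zariski_Gr 3 2 5) = Grassmannian 3 2 5" by (simp add: topspace_zariski_Gr)
  have "homogeneous_coordinates (subtopology (zariski_Gr 3 2 5) (topspace (zariski_Gr 3 2 5))) (pforms 3 2 5) (prel 5)"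
    unfolding top by (rule homogeneous_coordinates_Gr) auto
  then interpret homogeneous_coordinates "zariski_Gr 3 2 5" "pforms 3 2 5" "prel 5"
    by (simp add: subtopology_topspace)
  have poly: "(\<lambda>x. h (pluecker 5 (Gr_frame x))) \<in> polyfuns 25 (5 * m)" if "h \<in> pforms 3 2 5 m" for h m
    using pform_polyfuns[OF that, where N = 25 and D = 1 and b = Gr_frame] Gr_frame_polyfuns by simp
  have "krull_dim (zariski_Gr 3 2 5) \<le> enat 25"
  proof (rule krull_dim_le[OF poly])
    fix m h w assume h: "h \<in> pforms 3 2 5 m" and van: "\<And>x. h (pluecker 5 (Gr_frame x)) = 0"
      and w: "w \<in> cone (topspace (zariski_Gr 3 2 5))"
    obtain L b where L: "L \<in> Grassmannian 3 2 5" "is_basis 5 b L" "w = pluecker 5 b"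
      using w by (auto simp: cone_def prel_def top)
    define A where "A k j = coef (b j) (quad_mono k)" for k j
    have "b j = (\<Sum>k<10. poly_scale (A k j) (quad_var k))" if "j < 5" for j
      unfolding A_def
    proof (rule quad_expand)
      have "b j \<in> L" using L(2) that cpoly.span_base[of "b j" "b ` {..<5}"] by (auto simp: is_basis_def)
      then show "b j \<in> forms_space 3 2" using L(1) by (auto simp: Grassmannian_def)
    qed
    then have w: "w = pluecker 5 (\<lambda>j. \<Sum>k<10. poly_scale (A k j) (quad_var k))"
      unfolding L(3) by (intro pform_cong)
    show "h w = 0" unfolding w
    proof (rule pform_echelon[OF h])
      fix \<alpha> :: "nat \<Rightarrow> nat \<Rightarrow> complex"
      define x where "x l = \<alpha> (l div 5 + 5) (l mod 5)" for l
      have "pluecker 5 (\<lambda>j. quad_var j + (\<Sum>k\<in>{5..<10}. poly_scale (\<alpha> k j) (quad_var k))) = pluecker 5 (Gr_frame x)"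
        by (intro pform_cong) (simp add: Gr_frame_def x_def)
      then show "h (pluecker 5 (\<lambda>j. quad_var j + (\<Sum>k\<in>{5..<10}. poly_scale (\<alpha> k j) (quad_var k)))) = 0"
        by (simp add: van)
    qed simp
  qed
  moreover have "enat 25 \<le> krull_dim (zariski_Gr 3 2 5)"
  proof -
    have det1: "det (mat 5 5 (\<lambda>(i, j). quad_functional (coord_fun i) (Gr_frame x j))) = 1" for x
    proof -
      have "mat 5 5 (\<lambda>(i, j). quad_functional (coord_fun i) (Gr_frame x j)) = 1\<^sub>m 5"
        by (rule eq_matI) (auto simp: quad_functional_coord_fun lookup_Gr_frame)
      then show ?thesis by simp
    qed
    obtain f0 where f0: "f0 \<in> pforms 3 2 5 1"
      "\<And>b. f0 (pluecker 5 b) = det (mat 5 5 (\<lambda>(i, j). quad_functional (coord_fun i) (b j)))"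
      using pform_det_quad[of 5 coord_fun] by blast
    have "\<exists>h\<in>pforms 3 2 5 1. \<forall>x. h (pluecker 5 (Gr_frame x)) = x l" if l: "l < 25" for l
    proof -
      define k where "k = l mod 5"
      \<comment> \<open>Exchanging row \<open>k\<close> of the leading minor for the coordinate
        \<open>l div 5 + 5\<close> leaves the parameter \<open>x l\<close> as its value, because
        \<open>l = 5 * (l div 5) + k\<close>.\<close>
      define c where "c i = (if i = k then coord_fun (l div 5 + 5) else coord_fun i)" for i
      obtain h where h: "h \<in> pforms 3 2 5 1"
        "\<And>b. h (pluecker 5 b) = det (mat 5 5 (\<lambda>(i, j). quad_functional (c i) (b j)))"
        using pform_det_quad[of 5 c] by blast
      have "h (pluecker 5 (Gr_frame x)) = x l" for x
      proof -
        have "mat 5 5 (\<lambda>(i, j). quad_functional (c i) (Gr_frame x j)) =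
          mat 5 5 (\<lambda>(i, j). if i = k then x (5 * (l div 5) + j) else if i = j then 1 else 0)"
          using l by (intro eq_matI) (auto simp: c_def quad_functional_coord_fun lookup_Gr_frame)
        moreover have "det (mat 5 5 (\<lambda>(i, j). if i = k then x (5 * (l div 5) + j) else if i = j then 1 else 0)) =
          x (5 * (l div 5) + k)"
          by (rule det_replace_row) (simp add: k_def)
        ultimately show ?thesis by (simp add: h(2) k_def)
      qed
      with h(1) show ?thesis by blast
    qed
    then obtain f where f: "\<And>l. l < 25 \<Longrightarrow> f l \<in> pforms 3 2 5 1"
      "\<And>l x. l < 25 \<Longrightarrow> f l (pluecker 5 (Gr_frame x)) = x l" by metis
    show ?thesis
    proof (rule krull_dim_ge[OF poly, where G = "\<lambda>_. 1" and b = 0 and f = f and ?f0.0 = f0])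
      show "(\<lambda>_. 1) \<in> polyfuns 25 0" by (rule polyfuns_const)
      show "\<exists>L\<in>topspace (zariski_Gr 3 2 5). prel 5 L (pluecker 5 (Gr_frame x))" for x
      proof -
        have "det (mat 5 5 (\<lambda>(i, j). quad_functional (coord_fun i) (Gr_frame x j))) \<noteq> 0"
          by (simp add: det1)
        note ind = independent_of_quad_det[OF this]
        have "Gr_frame x j \<in> forms_space 3 2" if "j < 5" for j
          unfolding Gr_frame_def using that
          by (intro cpoly.subspace_add cpoly.subspace_sum cpoly.subspace_scale forms_space_subspace quad_var_form) auto
        from Grassmannian_span[OF ind this] show ?thesis by (auto simp: top prel_def)
      qed
      show "((\<lambda>t. f0 (pluecker 5 (Gr_frame (\<lambda>i. t * y i)))) \<longlongrightarrow> 1) (at 0)" for y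
        by (simp add: f0(2) det1)
      show "((\<lambda>t. f j (pluecker 5 (Gr_frame (\<lambda>i. t * y i))) / t) \<longlongrightarrow> y j) (at 0)" if "j < 25" for y j
        by (rule tendsto_eventually) (simp add: eventually_at_filter f(2)[OF that])
    qed (use f(1) f0(1) in auto)
  qed
  ultimately show ?thesis by (simp add: numeral_eq_enat antisym)
qed

subsection \<open>Forms vanishing on the frames in a span\<close>

lemma span_image_sum:
  fixes w :: "nat \<Rightarrow> 'v cpoly"
  assumes "v \<in> cpoly.span (w ` {..<K})"
  obtains a where "v = (\<Sum>k<K. poly_scale (a k) (w k))"
proof -
  have "cpoly.subspace {v. \<exists>a. v = (\<Sum>k<K. poly_scale (a k) (w k))}"
  proof (rule cpoly.subspaceI, goal_cases)
    case 1
    show ?case by (auto intro!: exI[of _ "\<lambda>_. 0"])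
  next
    case (2 x y)
    then obtain a b where "x = (\<Sum>k<K. poly_scale (a k) (w k))" "y = (\<Sum>k<K. poly_scale (b k) (w k))" by auto
    then have "x + y = (\<Sum>k<K. poly_scale (a k + b k) (w k))"
      by (simp add: cpoly.scale_left_distrib sum.distrib)
    then show ?case by (intro CollectI exI)
  next
    case (3 c x)
    then obtain a where "x = (\<Sum>k<K. poly_scale (a k) (w k))" by auto
    then have "poly_scale c x = (\<Sum>k<K. poly_scale (c * a k) (w k))"
      by (simp add: cpoly.scale_sum_right)
    then show ?case by (intro CollectI exI)
  qed
  moreover have "w ` {..<K} \<subseteq> {v. \<exists>a. v = (\<Sum>k<K. poly_scale (a k) (w k))}"
  proof clarify
    fix l assume "l < K"
    then have "w l = (\<Sum>k<K. poly_scale (if k = l then 1 else 0) (w k))"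
      by (simp add: if_distrib[of "\<lambda>z. poly_scale z _"] cong: if_cong)
    then show "\<exists>a. w l = (\<Sum>k<K. poly_scale (a k) (w k))"
      by (intro exI[of _ "\<lambda>k. if k = l then 1 else 0"])
  qed
  ultimately have "cpoly.span (w ` {..<K}) \<subseteq> {v. \<exists>a. v = (\<Sum>k<K. poly_scale (a k) (w k))}"
    by (intro cpoly.span_minimal)
  then show ?thesis using assms that by blast
qed

text \<open>All coefficient matrices are allowed, including those of dependent frames. The condition
  is therefore polynomial in \<open>w\<close>, passes to limits, and depends only on the span of
  \<open>w\<close>.\<close>

definition vanishes_on_frames ::
    "(((nat \<Rightarrow>\<^sub>0 nat) list \<Rightarrow> complex) \<Rightarrow> complex) \<Rightarrow> nat \<Rightarrow> (nat \<Rightarrow> nat cpoly) \<Rightarrow> nat \<Rightarrow> bool" where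
  "vanishes_on_frames h r w K \<longleftrightarrow> (\<forall>A. h (pluecker r (\<lambda>j. \<Sum>k<K. poly_scale (A k j) (w k))) = 0)"

lemma vanishes_on_framesD:
  assumes "vanishes_on_frames h r w K" "\<And>j. j < r \<Longrightarrow> b j \<in> cpoly.span (w ` {..<K})"
  shows "h (pluecker r b) = 0"
proof -
  have "\<forall>j. \<exists>a. j < r \<longrightarrow> b j = (\<Sum>k<K. poly_scale (a k) (w k))"
    using assms(2) span_image_sum by metis
  then obtain A where "\<And>j. j < r \<Longrightarrow> b j = (\<Sum>k<K. poly_scale (A j k) (w k))" by metis
  then have "pluecker r b = pluecker r (\<lambda>j. \<Sum>k<K. poly_scale (A j k) (w k))" by (intro pform_cong)
  then show ?thesis using assms(1)[unfolded vanishes_on_frames_def, rule_format, of "\<lambda>k j. A j k"] by simp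
qed

lemma vanishes_on_frames_trans:
  assumes "vanishes_on_frames h r w' K'" "\<And>k. k < K \<Longrightarrow> w k \<in> cpoly.span (w' ` {..<K'})"
  shows "vanishes_on_frames h r w K"
  unfolding vanishes_on_frames_def
proof
  fix A
  show "h (pluecker r (\<lambda>j. \<Sum>k<K. poly_scale (A k j) (w k))) = 0"
    using assms(2) by (intro vanishes_on_framesD[OF assms(1)] cpoly.span_sum cpoly.span_scale) auto
qed

text \<open>For each fixed coefficient matrix the value of \<open>h\<close> on the frame is a
  polynomial in \<open>t\<close>, to which \<open>upoly_mult_zero\<close> applies.\<close>

lemma vanishes_on_frames_density:
  assumes h: "h \<in> pforms n d r e" and w: "\<And>k m. k < K \<Longrightarrow> upoly (\<lambda>t. coef (w t k) m)"
    and g: "upoly g" "g s \<noteq> 0" and van: "\<And>t. g t \<noteq> 0 \<Longrightarrow> vanishes_on_frames h r (w t) K"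
  shows "vanishes_on_frames h r (w t) K"
  unfolding vanishes_on_frames_def
proof
  fix A
  have "upoly (\<lambda>t. h (pluecker r (\<lambda>j. \<Sum>k<K. poly_scale (A k j) (w t k))))"
    by (rule pform_upoly[OF h]) (auto simp: lookup_sum intro!: upoly_intros w)
  from upoly_mult_zero[OF this g, of t] van
  show "h (pluecker r (\<lambda>j. \<Sum>k<K. poly_scale (A k j) (w t k))) = 0"
    unfolding vanishes_on_frames_def by blast
qed

lemma upoly_common_nonzero:
  assumes "finite I" "\<And>i. i \<in> I \<Longrightarrow> upoly (f i)" "\<And>i. i \<in> I \<Longrightarrow> \<exists>t. f i t \<noteq> 0"
  shows "\<exists>t. (\<Prod>i\<in>I. f i t) \<noteq> 0"
  using assms
proof (induction I rule: finite_induct)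
  case (insert i I)
  obtain s t where st: "f i s \<noteq> 0" "(\<Prod>i\<in>I. f i t) \<noteq> 0" using insert by blast
  have "upoly (f i)" "upoly (\<lambda>t. \<Prod>i\<in>I. f i t)" using insert.prems(1) by (auto intro: upoly_intros)
  from upoly_mult_zero[OF this st(2), of s] st(1) show ?case using insert.hyps by auto
qed auto

lemma upoly_quadratic_nonzero: "c \<noteq> 0 \<Longrightarrow> \<exists>t::complex. a + b * t + c * t\<^sup>2 \<noteq> 0"
proof (rule ccontr)
  assume c: "c \<noteq> 0" "\<not> (\<exists>t. a + b * t + c * t\<^sup>2 \<noteq> 0)"
  then have "a + b * t + c * t\<^sup>2 = 0" for t by blast
  from this[of 0] this[of 1] this[of "- 1"] have "a = 0" "a + b + c = 0" "a - b + c = 0" by simp_all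
  moreover have "2 * c = (a + b + c) + (a - b + c) - 2 * a" by simp
  ultimately have "2 * c = 0" by (simp only:) simp
  with c show False by simp
qed

subsection \<open>Squares of the points of a rational cubic curve\<close>

definition cubic_point :: "(nat \<Rightarrow> nat \<Rightarrow> complex) \<Rightarrow> complex \<Rightarrow> complex \<Rightarrow> nat \<Rightarrow> complex" where
  "cubic_point V s t i = (\<Sum>k<4. s ^ (3 - k) * t ^ k * V k i)"

text \<open>The coefficient of \<open>s ^ (6 - n) * t ^ n\<close> in the square of the linear form
  at the moving point: a binary sextic with values in quadratic forms. The curve given by
  \<open>V\<close> may be degenerate.\<close>

definition sq_coeff :: "(nat \<Rightarrow> nat \<Rightarrow> complex) \<Rightarrow> nat \<Rightarrow> nat cpoly" where
  "sq_coeff V n = (\<Sum>k<4. \<Sum>l<4. if k + l = n then lin (V k) * lin (V l) else 0)"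

lemma lin_sum: "lin (\<lambda>i. \<Sum>k\<in>K. c k * u k i) = (\<Sum>k\<in>K. poly_scale (c k) (lin (u k)))"
proof -
  have "lin (\<lambda>i. \<Sum>k\<in>K. c k * u k i) = (\<Sum>i<4. \<Sum>k\<in>K. poly_scale (c k) (poly_scale (u k i) (var i)))"
    by (simp add: lin_def cpoly.scale_sum_left)
  also have "\<dots> = (\<Sum>k\<in>K. poly_scale (c k) (lin (u k)))"
    by (subst sum.swap) (simp add: lin_def cpoly.scale_sum_right)
  finally show ?thesis .
qed

lemma lin_scale: "lin (\<lambda>i. c * u i) = poly_scale c (lin u)"
  by (simp add: lin_def cpoly.scale_sum_right)

lemma poly_scale_mult:
  fixes p q :: "'v cpoly"
  shows "poly_scale a p * poly_scale b q = poly_scale (a * b) (p * q)"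
proof -
  have "(Poly_Mapping.single 0 (a * b) :: 'v cpoly) = Poly_Mapping.single 0 a * Poly_Mapping.single 0 b"
    by (simp add: mult_single)
  then show ?thesis unfolding poly_scale_def by (simp only: mult_ac)
qed

lemma lin_cong: "(\<And>i. i < 4 \<Longrightarrow> u i = v i) \<Longrightarrow> lin u = lin v"
  by (simp add: lin_def)

lemma cubic_point_square:
  "lin (cubic_point V s t) ^ 2 = (\<Sum>n<7. poly_scale (s ^ (6 - n) * t ^ n) (sq_coeff V n))"
proof -
  have "lin (cubic_point V s t) = (\<Sum>k<4. poly_scale (s ^ (3 - k) * t ^ k) (lin (V k)))"
    unfolding cubic_point_def[abs_def] by (rule lin_sum)
  then have "lin (cubic_point V s t) ^ 2 =
    (\<Sum>k<4. \<Sum>l<4. poly_scale (s ^ (3 - k) * t ^ k * (s ^ (3 - l) * t ^ l)) (lin (V k) * lin (V l)))"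
    by (simp add: power2_eq_square sum_product poly_scale_mult)
  also have "\<dots> = (\<Sum>k<4. \<Sum>l<4. \<Sum>n<7. if k + l = n then poly_scale (s ^ (6 - n) * t ^ n) (lin (V k) * lin (V l)) else 0)"
  proof (intro sum.cong refl)
    fix k l :: nat assume "k \<in> {..<4}" "l \<in> {..<4}"
    then have kl: "k + l < 7" "6 - (k + l) = (3 - k) + (3 - l)" by auto
    then have "s ^ (3 - k) * t ^ k * (s ^ (3 - l) * t ^ l) = s ^ (6 - (k + l)) * t ^ (k + l)"
      by (simp only: power_add mult_ac)
    then show "poly_scale (s ^ (3 - k) * t ^ k * (s ^ (3 - l) * t ^ l)) (lin (V k) * lin (V l)) =
      (\<Sum>n<7. if k + l = n then poly_scale (s ^ (6 - n) * t ^ n) (lin (V k) * lin (V l)) else 0)"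
      using kl(1) by simp
  qed
  also have "\<dots> = (\<Sum>k<4. \<Sum>n<7. \<Sum>l<4. if k + l = n then poly_scale (s ^ (6 - n) * t ^ n) (lin (V k) * lin (V l)) else 0)"
    by (intro sum.cong refl sum.swap)
  also have "\<dots> = (\<Sum>n<7. \<Sum>k<4. \<Sum>l<4. if k + l = n then poly_scale (s ^ (6 - n) * t ^ n) (lin (V k) * lin (V l)) else 0)"
    by (rule sum.swap)
  also have "\<dots> = (\<Sum>n<7. poly_scale (s ^ (6 - n) * t ^ n) (sq_coeff V n))"
    unfolding sq_coeff_def cpoly.scale_sum_right by (intro sum.cong refl) auto
  finally show ?thesis .
qed

lemma cubic_point_square_in_span:
  "lin (cubic_point V s t) ^ 2 \<in> cpoly.span (sq_coeff V ` {..<7})"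
  unfolding cubic_point_square by (intro cpoly.span_sum cpoly.span_scale cpoly.span_base) auto

text \<open>The Vandermonde matrix at the nodes 0, ..., \<open>N - 1\<close> is invertible: a kernel
  vector would be a nonzero polynomial of degree below \<open>N\<close> with \<open>N\<close>
  roots.\<close>

lemma interpolation_weights:
  obtains C :: "nat \<Rightarrow> nat \<Rightarrow> complex" where
    "\<And>n m. n < N \<Longrightarrow> m < N \<Longrightarrow> (\<Sum>l<N. C n l * of_nat l ^ m) = (if n = m then 1 else 0)"
proof -
  define M where "M = mat N N (\<lambda>(l, m). of_nat l ^ m :: complex)"
  have M: "M \<in> carrier_mat N N" by (simp add: M_def)
  have "det M \<noteq> 0"
  proof
    assume "det M = 0"
    then obtain v where v: "v \<in> carrier_vec N" "v \<noteq> 0\<^sub>v N" "M *\<^sub>v v = 0\<^sub>v N"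
      using det_0_iff_vec_prod_zero[OF M] by auto
    define p where "p = (\<Sum>m<N. monom (v $ m) m)"
    have root: "poly p (of_nat l) = 0" if "l < N" for l
    proof -
      have "(M *\<^sub>v v) $ l = (\<Sum>m<N. of_nat l ^ m * v $ m)"
        using that v(1) by (simp add: M_def scalar_prod_def atLeast0LessThan)
      then show ?thesis using v(3) that by (simp add: p_def poly_sum poly_monom mult.commute)
    qed
    have coeff: "coeff p m = (if m < N then v $ m else 0)" for m
      by (simp add: p_def coeff_sum)
    have "p \<noteq> 0"
    proof
      assume "p = 0"
      then have "v = 0\<^sub>v N" using v(1) coeff by (intro eq_vecI) (auto split: if_splits, metis coeff_0)
      with v(2) show False by simp
    qed
    have "N > 0"
    proof (rule ccontr)
      assume "\<not> N > 0"
      then show False using \<open>p \<noteq> 0\<close> by (simp add: p_def)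
    qed
    have "degree p \<le> N - 1" by (rule degree_le) (use \<open>N > 0\<close> in \<open>auto simp: coeff\<close>)
    have "N = card ((of_nat :: nat \<Rightarrow> complex) ` {..<N})" by (simp add: card_image inj_on_def)
    also have "\<dots> \<le> card {x. poly p x = 0}"
      using root \<open>p \<noteq> 0\<close> by (intro card_mono poly_roots_finite) auto
    also have "\<dots> \<le> degree p" using \<open>p \<noteq> 0\<close> by (rule card_poly_roots_bound)
    finally show False using \<open>degree p \<le> N - 1\<close> \<open>N > 0\<close> by simp
  qed
  then show ?thesis using left_inverse[of N "\<lambda>l m. of_nat l ^ m"] that unfolding M_def by blast
qed

text \<open>A sextic is determined by seven values; its coefficients are recovered from those at 0,
  ..., 6 by the interpolation weights.\<close>

lemma sq_coeff_in_span:
  assumes "n < 7" "\<And>t. lin (cubic_point V 1 t) ^ 2 \<in> cpoly.span S"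
  shows "sq_coeff V n \<in> cpoly.span S"
proof -
  obtain C :: "nat \<Rightarrow> nat \<Rightarrow> complex" where
    C: "\<And>n m. n < 7 \<Longrightarrow> m < 7 \<Longrightarrow> (\<Sum>l<7. C n l * of_nat l ^ m) = (if n = m then 1 else 0)"
    using interpolation_weights[of 7] by metis
  have "(\<Sum>l<7. poly_scale (C n l) (lin (cubic_point V 1 (of_nat l)) ^ 2)) =
    (\<Sum>l<7. \<Sum>m<7. poly_scale (C n l * of_nat l ^ m) (sq_coeff V m))"
    by (simp add: cubic_point_square cpoly.scale_sum_right)
  also have "\<dots> = (\<Sum>m<7. poly_scale (\<Sum>l<7. C n l * of_nat l ^ m) (sq_coeff V m))"
    by (subst sum.swap) (simp add: cpoly.scale_sum_left)
  also have "\<dots> = (\<Sum>m<7. if n = m then sq_coeff V m else 0)"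
    using assms(1) by (intro sum.cong) (auto simp: C)
  also have "\<dots> = sq_coeff V n" using assms(1) by simp
  finally have "sq_coeff V n = (\<Sum>l<7. poly_scale (C n l) (lin (cubic_point V 1 (of_nat l)) ^ 2))" by simp
  then show ?thesis using assms(2) by (auto intro!: cpoly.span_sum cpoly.span_scale)
qed

abbreviation "vanishes_on_cubic h V \<equiv> vanishes_on_frames h 5 (sq_coeff V) 7"

text \<open>The squares of the points of a curve span its seven coefficient forms, so the span
  depends on the points alone and not on their parametrization or scaling.\<close>

lemma vanishes_on_cubic_reparam:
  assumes "vanishes_on_cubic h V'"
    and "\<And>s t. \<exists>c s' t'. \<forall>i<4. cubic_point V s t i = c * cubic_point V' s' t' i"
  shows "vanishes_on_cubic h V"
proof (rule vanishes_on_frames_trans[OF assms(1)], rule sq_coeff_in_span)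
  fix t
  obtain c s' t' where "\<forall>i<4. cubic_point V 1 t i = c * cubic_point V' s' t' i" using assms(2) by blast
  then have "lin (cubic_point V 1 t) = poly_scale c (lin (cubic_point V' s' t'))"
    unfolding lin_scale[symmetric] by (intro lin_cong) auto
  then have "lin (cubic_point V 1 t) ^ 2 = poly_scale (c * c) (lin (cubic_point V' s' t') ^ 2)"
    by (simp add: power2_eq_square poly_scale_mult)
  then show "lin (cubic_point V 1 t) ^ 2 \<in> cpoly.span (sq_coeff V' ` {..<7})"
    by (simp add: cubic_point_square_in_span cpoly.span_scale)
qed

lemma upoly_lookup_lin_mult:
  assumes "\<And>i. i < 4 \<Longrightarrow> upoly (\<lambda>t. u t i)" "\<And>i. i < 4 \<Longrightarrow> upoly (\<lambda>t. v t i)"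
  shows "upoly (\<lambda>t. coef (lin (u t) * lin (v t)) m)"
  unfolding lin_mult lookup_sum lookup_poly_scale by (intro upoly_intros assms) auto

lemma upoly_lookup_sq_coeff:
  assumes "\<And>k i. k < 4 \<Longrightarrow> i < 4 \<Longrightarrow> upoly (\<lambda>t. V t k i)"
  shows "upoly (\<lambda>t. coef (sq_coeff (V t) n) m)"
proof -
  have "upoly (\<lambda>t. coef (if k + l = n then lin (V t k) * lin (V t l) else 0) m)"
    if "k < 4" "l < 4" for k l
    using that by (cases "k + l = n") (auto intro: upoly_lookup_lin_mult assms upoly_const)
  then show ?thesis unfolding sq_coeff_def lookup_sum by (intro upoly_intros) auto
qed

subsection \<open>A normal form for rational cubic curves\<close>

text \<open>Coefficients of the rows \<open>s q\<^sub>0\<close>, \<open>t q\<^sub>1\<close>, \<open>(s + t) q\<^sub>2\<close> with binary quadratic forms \<open>q\<^sub>i\<close>, and of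
  a binary cubic in the last row.\<close>

definition normal_cubic :: "(nat \<Rightarrow> complex) \<Rightarrow> nat \<Rightarrow> nat \<Rightarrow> complex" where
  "normal_cubic x k i = [[x 0, 0, x 6, x 9], [x 1, x 3, x 6 + x 7, x 10],
     [x 2, x 4, x 7 + x 8, x 11], [0, x 5, x 8, x 12]] ! k ! i"

lemma sum_lessThan_4: "(\<Sum>k<(4::nat). f k) = f 0 + f 1 + f 2 + (f 3 :: 'a::comm_monoid_add)"
  by (simp add: numeral_eq_Suc)

lemma normal_cubic_point:
  "cubic_point (normal_cubic x) s t 0 = s * (x 0 * s\<^sup>2 + x 1 * (s * t) + x 2 * t\<^sup>2)"
  "cubic_point (normal_cubic x) s t 1 = t * (x 3 * s\<^sup>2 + x 4 * (s * t) + x 5 * t\<^sup>2)"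
  "cubic_point (normal_cubic x) s t 2 = (s + t) * (x 6 * s\<^sup>2 + x 7 * (s * t) + x 8 * t\<^sup>2)"
  "cubic_point (normal_cubic x) s t 3 = x 9 * s ^ 3 + x 10 * (s\<^sup>2 * t) + x 11 * (s * t\<^sup>2) + x 12 * t ^ 3"
  by (simp_all add: cubic_point_def sum_lessThan_4 normal_cubic_def power2_eq_square power3_eq_cube algebra_simps)

lemma all_less_4: "(\<forall>i<4. P i) \<longleftrightarrow> P 0 \<and> P 1 \<and> P 2 \<and> P (3::nat)"
proof -
  have "i < 4 \<longleftrightarrow> i = 0 \<or> i = 1 \<or> i = 2 \<or> i = 3" for i :: nat by auto
  then show ?thesis by auto
qed

text \<open>The first three coordinates split off the linear forms \<open>a i * s + b i * t\<close>,
  whose roots are to be moved to fixed positions; the last coordinate remains a free cubic.\<close>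

definition factored_cubic :: "(nat \<Rightarrow> complex) \<Rightarrow> (nat \<Rightarrow> complex) \<Rightarrow> (nat \<Rightarrow> nat \<Rightarrow> complex) \<Rightarrow> nat \<Rightarrow> nat \<Rightarrow> complex" where
  "factored_cubic a b q k i = (if i < 3
     then [a i * q i 0, a i * q i 1 + b i * q i 0, a i * q i 2 + b i * q i 1, b i * q i 2] ! k
     else q i k)"

lemma factored_cubic_point:
  "i < 3 \<Longrightarrow> cubic_point (factored_cubic a b q) s t i =
    (a i * s + b i * t) * (q i 0 * s\<^sup>2 + q i 1 * (s * t) + q i 2 * t\<^sup>2)"
  "cubic_point (factored_cubic a b q) s t 3 = q 3 0 * s ^ 3 + q 3 1 * (s\<^sup>2 * t) + q 3 2 * (s * t\<^sup>2) + q 3 3 * t ^ 3"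
  by (simp_all add: cubic_point_def sum_lessThan_4 factored_cubic_def power2_eq_square power3_eq_cube algebra_simps)

lemma quadratic_subst:
  "\<exists>u v w. \<forall>s t. q0 * (\<alpha> * s + \<beta> * t)\<^sup>2 + q1 * ((\<alpha> * s + \<beta> * t) * (\<gamma> * s + \<delta> * t)) + q2 * (\<gamma> * s + \<delta> * t)\<^sup>2 =
    u * s\<^sup>2 + v * (s * t) + (w::complex) * t\<^sup>2"
  by (rule exI[of _ "q0 * \<alpha>\<^sup>2 + q1 * \<alpha> * \<gamma> + q2 * \<gamma>\<^sup>2"],
      rule exI[of _ "2 * q0 * \<alpha> * \<beta> + q1 * (\<alpha> * \<delta> + \<beta> * \<gamma>) + 2 * q2 * \<gamma> * \<delta>"],
      rule exI[of _ "q0 * \<beta>\<^sup>2 + q1 * \<beta> * \<delta> + q2 * \<delta>\<^sup>2"])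
    (simp add: power2_eq_square algebra_simps)

lemma cubic_subst:
  "\<exists>u v w z. \<forall>s t. q0 * (\<alpha> * s + \<beta> * t) ^ 3 + q1 * ((\<alpha> * s + \<beta> * t)\<^sup>2 * (\<gamma> * s + \<delta> * t)) +
      q2 * ((\<alpha> * s + \<beta> * t) * (\<gamma> * s + \<delta> * t)\<^sup>2) + q3 * (\<gamma> * s + \<delta> * t) ^ 3 =
    u * s ^ 3 + v * (s\<^sup>2 * t) + w * (s * t\<^sup>2) + (z::complex) * t ^ 3"
  by (rule exI[of _ "q0 * \<alpha> ^ 3 + q1 * \<alpha>\<^sup>2 * \<gamma> + q2 * \<alpha> * \<gamma>\<^sup>2 + q3 * \<gamma> ^ 3"],
      rule exI[of _ "3 * q0 * \<alpha>\<^sup>2 * \<beta> + q1 * (2 * \<alpha> * \<beta> * \<gamma> + \<alpha>\<^sup>2 * \<delta>) + q2 * (\<beta> * \<gamma>\<^sup>2 + 2 * \<alpha> * \<gamma> * \<delta>) + 3 * q3 * \<gamma>\<^sup>2 * \<delta>"],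
      rule exI[of _ "3 * q0 * \<alpha> * \<beta>\<^sup>2 + q1 * (2 * \<alpha> * \<beta> * \<delta> + \<beta>\<^sup>2 * \<gamma>) + q2 * (\<alpha> * \<delta>\<^sup>2 + 2 * \<beta> * \<gamma> * \<delta>) + 3 * q3 * \<gamma> * \<delta>\<^sup>2"],
      rule exI[of _ "q0 * \<beta> ^ 3 + q1 * \<beta>\<^sup>2 * \<delta> + q2 * \<beta> * \<delta>\<^sup>2 + q3 * \<delta> ^ 3"])
    (simp add: power2_eq_square power3_eq_cube algebra_simps)

text \<open>Three pairwise non-proportional linear forms become \<open>s\<close>, \<open>t\<close>
  and \<open>s + t\<close> after a linear change of parameters, up to scalars that the quadratic
  factors absorb. This spends the three-dimensional freedom of reparametrization.\<close>

lemma vanishes_on_factored_cubic_generic: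
  assumes van: "\<And>x. vanishes_on_cubic h (normal_cubic x)"
    and gen: "a 0 * b 1 - a 1 * b 0 \<noteq> 0" "a 0 * b 2 - a 2 * b 0 \<noteq> 0" "a 1 * b 2 - a 2 * b 1 \<noteq> 0"
  shows "vanishes_on_cubic h (factored_cubic a b q)"
proof -
  define D where "D = a 0 * b 1 - a 1 * b 0"
  \<comment> \<open>Cramer's rule: the third linear form is \<open>\<kappa>\<close> times the first
    plus \<open>\<mu>\<close> times the second. These two summands become the new parameters
    \<open>s'\<close> and \<open>t'\<close>, so the third form becomes
    \<open>s' + t'\<close>.\<close>
  define \<kappa> where "\<kappa> = (a 2 * b 1 - a 1 * b 2) / D"
  define \<mu> where "\<mu> = (a 0 * b 2 - a 2 * b 0) / D"
  have D: "D \<noteq> 0" and \<kappa>: "\<kappa> \<noteq> 0" and \<mu>: "\<mu> \<noteq> 0" using gen by (auto simp: D_def \<kappa>_def \<mu>_def)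
  have l2: "a 2 = \<kappa> * a 0 + \<mu> * a 1" "b 2 = \<kappa> * b 0 + \<mu> * b 1"
    unfolding \<kappa>_def \<mu>_def using D by (simp_all add: field_simps) (simp_all add: D_def algebra_simps)
  \<comment> \<open>Coefficients of the inverse substitution, which expresses \<open>s\<close> and
    \<open>t\<close> through \<open>s'\<close> and \<open>t'\<close>.\<close>
  define \<alpha> where "\<alpha> = b 1 / (D * \<kappa>)"
  define \<beta> where "\<beta> = - b 0 / (D * \<mu>)"
  define \<gamma> where "\<gamma> = - a 1 / (D * \<kappa>)"
  define \<delta> where "\<delta> = a 0 / (D * \<mu>)"
  have inv: "\<alpha> * (\<kappa> * (a 0 * s + b 0 * t)) + \<beta> * (\<mu> * (a 1 * s + b 1 * t)) = s"
    "\<gamma> * (\<kappa> * (a 0 * s + b 0 * t)) + \<delta> * (\<mu> * (a 1 * s + b 1 * t)) = t" for s t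
    unfolding \<alpha>_def \<beta>_def \<gamma>_def \<delta>_def using D \<kappa> \<mu>
    by (simp_all add: field_simps) (simp_all add: D_def algebra_simps)
  have "\<exists>u v w. \<forall>s t. q i 0 * (\<alpha> * s + \<beta> * t)\<^sup>2 + q i 1 * ((\<alpha> * s + \<beta> * t) * (\<gamma> * s + \<delta> * t)) +
      q i 2 * (\<gamma> * s + \<delta> * t)\<^sup>2 = u * s\<^sup>2 + v * (s * t) + w * t\<^sup>2" for i by (rule quadratic_subst)
  then obtain u v w where r: "\<And>i s t. q i 0 * (\<alpha> * s + \<beta> * t)\<^sup>2 + q i 1 * ((\<alpha> * s + \<beta> * t) * (\<gamma> * s + \<delta> * t)) +
      q i 2 * (\<gamma> * s + \<delta> * t)\<^sup>2 = u i * s\<^sup>2 + v i * (s * t) + w i * t\<^sup>2" by metis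
  obtain u3 v3 w3 z3 where r3: "\<And>s t. q 3 0 * (\<alpha> * s + \<beta> * t) ^ 3 + q 3 1 * ((\<alpha> * s + \<beta> * t)\<^sup>2 * (\<gamma> * s + \<delta> * t)) +
      q 3 2 * ((\<alpha> * s + \<beta> * t) * (\<gamma> * s + \<delta> * t)\<^sup>2) + q 3 3 * (\<gamma> * s + \<delta> * t) ^ 3 =
    u3 * s ^ 3 + v3 * (s\<^sup>2 * t) + w3 * (s * t\<^sup>2) + z3 * t ^ 3" using cubic_subst by metis
  \<comment> \<open>The divisions compensate for the factors \<open>\<kappa>\<close> and
    \<open>\<mu>\<close> contained in \<open>s'\<close> and \<open>t'\<close>.\<close>
  define x where "x k = [u 0 / \<kappa>, v 0 / \<kappa>, w 0 / \<kappa>, u 1 / \<mu>, v 1 / \<mu>, w 1 / \<mu>, u 2, v 2, w 2, u3, v3, w3, z3] ! k" for k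
  have x: "x 0 = u 0 / \<kappa>" "x 1 = v 0 / \<kappa>" "x 2 = w 0 / \<kappa>" "x 3 = u 1 / \<mu>" "x 4 = v 1 / \<mu>" "x 5 = w 1 / \<mu>"
    "x 6 = u 2" "x 7 = v 2" "x 8 = w 2" "x 9 = u3" "x 10 = v3" "x 11 = w3" "x 12 = z3"
    by (simp_all add: x_def)
  show ?thesis
  proof (rule vanishes_on_cubic_reparam[OF van[of x]])
    fix s t
    define s' where "s' = \<kappa> * (a 0 * s + b 0 * t)"
    define t' where "t' = \<mu> * (a 1 * s + b 1 * t)"
    have st: "\<alpha> * s' + \<beta> * t' = s" "\<gamma> * s' + \<delta> * t' = t" unfolding s'_def t'_def by (rule inv)+
    have "cubic_point (factored_cubic a b q) s t 0 = cubic_point (normal_cubic x) s' t' 0"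
    proof -
      have "cubic_point (normal_cubic x) s' t' 0 = (s' / \<kappa>) * (u 0 * s'\<^sup>2 + v 0 * (s' * t') + w 0 * t'\<^sup>2)"
        unfolding normal_cubic_point x by (simp add: algebra_simps add_divide_distrib)
      also have "\<dots> = (s' / \<kappa>) * (q 0 0 * s\<^sup>2 + q 0 1 * (s * t) + q 0 2 * t\<^sup>2)"
        unfolding r[symmetric] st ..
      also have "s' / \<kappa> = a 0 * s + b 0 * t" using \<kappa> by (simp add: s'_def)
      finally show ?thesis by (simp add: factored_cubic_point)
    qed
    moreover have "cubic_point (factored_cubic a b q) s t 1 = cubic_point (normal_cubic x) s' t' 1"
    proof -
      have "cubic_point (normal_cubic x) s' t' 1 = (t' / \<mu>) * (u 1 * s'\<^sup>2 + v 1 * (s' * t') + w 1 * t'\<^sup>2)"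
        unfolding normal_cubic_point x by (simp add: algebra_simps add_divide_distrib)
      also have "\<dots> = (t' / \<mu>) * (q 1 0 * s\<^sup>2 + q 1 1 * (s * t) + q 1 2 * t\<^sup>2)"
        unfolding r[symmetric] st ..
      also have "t' / \<mu> = a 1 * s + b 1 * t" using \<mu> by (simp add: t'_def)
      finally show ?thesis using factored_cubic_point(1)[of 1 a b q s t] by simp
    qed
    moreover have "cubic_point (factored_cubic a b q) s t 2 = cubic_point (normal_cubic x) s' t' 2"
    proof -
      have "cubic_point (normal_cubic x) s' t' 2 = (s' + t') * (u 2 * s'\<^sup>2 + v 2 * (s' * t') + w 2 * t'\<^sup>2)"
        unfolding normal_cubic_point x ..
      also have "\<dots> = (s' + t') * (q 2 0 * s\<^sup>2 + q 2 1 * (s * t) + q 2 2 * t\<^sup>2)"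
        unfolding r[symmetric] st ..
      also have "s' + t' = a 2 * s + b 2 * t" by (simp add: s'_def t'_def l2 algebra_simps)
      finally show ?thesis using factored_cubic_point(1)[of 2 a b q s t] by simp
    qed
    moreover have "cubic_point (factored_cubic a b q) s t 3 = cubic_point (normal_cubic x) s' t' 3"
      unfolding normal_cubic_point x r3[symmetric] st factored_cubic_point ..
    ultimately have "\<forall>i<4. cubic_point (factored_cubic a b q) s t i = 1 * cubic_point (normal_cubic x) s' t' i"
      unfolding all_less_4 by simp
    then show "\<exists>c s' t'. \<forall>i<4. cubic_point (factored_cubic a b q) s t i = c * cubic_point (normal_cubic x) s' t' i"
      by blast
  qed
qed

lemma vanishes_on_factored_cubic:
  assumes h: "h \<in> pforms 3 2 5 e" and van: "\<And>x. vanishes_on_cubic h (normal_cubic x)"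
  shows "vanishes_on_cubic h (factored_cubic a b q)"
proof -
  \<comment> \<open>The directions of motion (1, 0), (0, 1), (1, 1) of the three linear forms are
    pairwise independent, so each determinant in \<open>g\<close> is quadratic in the line parameter
    with leading coefficient 1 or -1.\<close>
  define a' where "a' t i = a i + t * [1, 0, 1] ! i" for t :: complex and i
  define b' where "b' t i = b i + t * [0, 1, 1] ! i" for t :: complex and i
  define g where "g p t = a' t (fst p) * b' t (snd p) - a' t (snd p) * b' t (fst p)" for t p
  define I where "I = {(0::nat, 1::nat), (0, 2), (1, 2)}"
  have up: "upoly (\<lambda>t. a' t i)" "upoly (\<lambda>t. b' t i)" for i unfolding a'_def b'_def by (intro upoly_intros)+
  have "\<exists>t. g p t \<noteq> 0" if "p \<in> I" for p
  proof -
    have "\<exists>A B C. C \<noteq> 0 \<and> (\<forall>t. g p t = A + B * t + C * t\<^sup>2)"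
      using that unfolding I_def
    proof (elim insertE, goal_cases)
      case 1
      show ?case by (rule exI[of _ "a 0 * b 1 - a 1 * b 0"], rule exI[of _ "a 0 + b 1"], rule exI[of _ 1])
        (simp add: 1 g_def a'_def b'_def power2_eq_square algebra_simps)
    next
      case 2
      show ?case by (rule exI[of _ "a 0 * b 2 - a 2 * b 0"], rule exI[of _ "a 0 + b 2 - b 0"], rule exI[of _ 1])
        (simp add: 2 g_def a'_def b'_def power2_eq_square algebra_simps)
    next
      case 3
      show ?case by (rule exI[of _ "a 1 * b 2 - a 2 * b 1"], rule exI[of _ "a 1 - a 2 - b 1"], rule exI[of _ "- 1"])
        (simp add: 3 g_def a'_def b'_def power2_eq_square algebra_simps)
    qed auto
    then show ?thesis using upoly_quadratic_nonzero by metis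
  qed
  moreover have upg: "upoly (g p)" for p unfolding g_def by (intro upoly_intros up)
  ultimately obtain s where s: "(\<Prod>p\<in>I. g p s) \<noteq> 0"
    using upoly_common_nonzero[of I g] by (auto simp: I_def)
  have "vanishes_on_cubic h (factored_cubic (a' 0) (b' 0) q)"
  proof (rule vanishes_on_frames_density[OF h, where w = "\<lambda>t. sq_coeff (factored_cubic (a' t) (b' t) q)"
        and g = "\<lambda>t. \<Prod>p\<in>I. g p t" and s = s and t = 0])
    show "(\<Prod>p\<in>I. g p s) \<noteq> 0" by (rule s)
    show "upoly (\<lambda>t. \<Prod>p\<in>I. g p t)" by (intro upoly_intros upg)
    show "upoly (\<lambda>t. coef (sq_coeff (factored_cubic (a' t) (b' t) q) k) m)" for k m
    proof (rule upoly_lookup_sq_coeff)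
      fix k i :: nat assume "k < 4" "i < 4"
      then have "k = 0 \<or> k = 1 \<or> k = 2 \<or> k = 3" by auto
      then show "upoly (\<lambda>t. factored_cubic (a' t) (b' t) q k i)"
        by (elim disjE; cases "i < 3") (auto simp: factored_cubic_def intro!: upoly_intros up)
    qed
    show "vanishes_on_cubic h (factored_cubic (a' t) (b' t) q)" if "(\<Prod>p\<in>I. g p t) \<noteq> 0" for t
      by (rule vanishes_on_factored_cubic_generic[OF van]) (use that in \<open>auto simp: I_def g_def\<close>)
  qed
  then show ?thesis by (simp add: a'_def[abs_def] b'_def[abs_def])
qed

text \<open>A complex binary cubic has a linear factor: \<open>t\<close> if \<open>c 0 = 0\<close>,
  and otherwise \<open>s - z t\<close> for a root \<open>z\<close> of the dehomogenized
  cubic.\<close>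

lemma binary_cubic_factor:
  fixes c :: "nat \<Rightarrow> complex"
  obtains a b q where "c 0 = a * q 0" "c 1 = a * q 1 + b * q 0" "c 2 = a * q 2 + b * q 1" "c 3 = b * q (2::nat)"
proof (cases "c 0 = 0")
  case True
  show ?thesis by (rule that[of 0 "\<lambda>k. c (k + 1)" 1]) (use True in \<open>auto simp: numeral_eq_Suc\<close>)
next
  case False
  have "\<not> constant (poly [:c 3, c 2, c 1, c 0:])"
    using False by (simp add: constant_degree)
  then obtain z where z: "poly [:c 3, c 2, c 1, c 0:] z = 0" using fundamental_theorem_of_algebra by blast
  have "c 3 = - (z * (c 2 + z * (c 1 + z * c 0)))"
    using z by (simp add: eq_neg_iff_add_eq_0)
  \<comment> \<open>The entries of \<open>q\<close> are the quotient coefficients of Horner's scheme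
    at \<open>z\<close>.\<close>
  then show ?thesis
    by (intro that[of 1 "\<lambda>k. [c 0, c 1 + c 0 * z, c 2 + (c 1 + c 0 * z) * z] ! k" "- z"])
      (simp_all add: algebra_simps)
qed

lemma vanishes_on_all_cubics:
  assumes h: "h \<in> pforms 3 2 5 e" and van: "\<And>x. vanishes_on_cubic h (normal_cubic x)"
  shows "vanishes_on_cubic h V"
proof -
  have "\<exists>a b q. V 0 i = a * q 0 \<and> V 1 i = a * q 1 + b * q 0 \<and> V 2 i = a * q 2 + b * q 1 \<and> V 3 i = b * q (2::nat)" for i
    using binary_cubic_factor[of "\<lambda>k. V k i"] by metis
  then obtain a b q where abq: "\<And>i. V 0 i = a i * q i 0 \<and> V 1 i = a i * q i 1 + b i * q i 0 \<and>
    V 2 i = a i * q i 2 + b i * q i 1 \<and> V 3 i = b i * q i (2::nat)" by metis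
  define q' where "q' i = (if i < 3 then q i else (\<lambda>k. V k i))" for i
  have eq: "factored_cubic a b q' k i = V k i" if "k < 4" for k i
  proof -
    have "k = 0 \<or> k = 1 \<or> k = 2 \<or> k = 3" using that by auto
    then show ?thesis using abq[of i] by (elim disjE) (auto simp: factored_cubic_def q'_def)
  qed
  have "sq_coeff V n = sq_coeff (factored_cubic a b q') n" for n
  proof -
    have "lin (V k) = lin (factored_cubic a b q' k)" if "k < 4" for k
      by (intro lin_cong) (simp add: eq that)
    then show ?thesis unfolding sq_coeff_def by (auto intro!: sum.cong)
  qed
  then have "sq_coeff V = sq_coeff (factored_cubic a b q')" by blast
  then show ?thesis using vanishes_on_factored_cubic[OF h van] by simp
qed

section \<open>Polynomial frames over normalized cubics\<close>

lemma polyfuns_lookup_lin_mult: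
  assumes "\<And>i. i < 4 \<Longrightarrow> (\<lambda>x. u x i) \<in> polyfuns N D" "\<And>i. i < 4 \<Longrightarrow> (\<lambda>x. v x i) \<in> polyfuns N D'"
  shows "(\<lambda>x. coef (lin (u x) * lin (v x)) m) \<in> polyfuns N (D + D')"
proof -
  have "(\<lambda>x. \<Sum>i<4. \<Sum>j<4. coef (var i * var j) m * (u x i * v x j)) \<in> polyfuns N (D + D')"
    by (intro polyfuns_sum polyfuns_scale polyfuns_mult assms) auto
  then show ?thesis by (simp add: lin_mult lookup_sum mult.commute)
qed

lemma polyfuns_lookup_sq_coeff:
  assumes "\<And>k i. k < 4 \<Longrightarrow> i < 4 \<Longrightarrow> (\<lambda>x. V x k i) \<in> polyfuns N D"
  shows "(\<lambda>x. coef (sq_coeff (V x) n) m) \<in> polyfuns N (D + D)"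
proof -
  have "(\<lambda>x. coef (if k + l = n then lin (V x k) * lin (V x l) else 0) m) \<in> polyfuns N (D + D)"
    if kl: "k < 4" "l < 4" for k l
    using kl by (cases "k + l = n") (auto intro: polyfuns_lookup_lin_mult assms simp: polyfuns_zero)
  then show ?thesis unfolding sq_coeff_def lookup_sum by (intro polyfuns_sum) auto
qed

lemma normal_cubic_cong: "(\<And>i. i \<le> 12 \<Longrightarrow> x i = x' i) \<Longrightarrow> normal_cubic x = normal_cubic x'"
  unfolding normal_cubic_def by (intro ext) simp

text \<open>Twelve parameters for the curve, whose last coefficient is normalized to \<open>1\<close>, and ten for the
  echelon form of a frame in the seven-dimensional span of its squares.\<close>

definition Sigma_frame :: "(nat \<Rightarrow> complex) \<Rightarrow> nat \<Rightarrow> nat cpoly" where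
  "Sigma_frame y j = (let w = sq_coeff (normal_cubic (y(12 := 1)))
     in w j + (\<Sum>k\<in>{5..<7}. poly_scale (y (12 + 2 * j + (k - 5))) (w k)))"

lemma Sigma_frame_polyfuns:
  assumes "j < 5" shows "(\<lambda>y. coef (Sigma_frame y j) m) \<in> polyfuns 22 3"
proof -
  have coord: "(\<lambda>y. (y(12 := 1)) i) \<in> polyfuns 22 1" if "i \<le> 12" for i
    using that polyfuns_coord[of i 22] polyfuns_const[of 1] by (cases "i = 12") auto
  have "(\<lambda>y. normal_cubic (y(12 := 1)) k i) \<in> polyfuns 22 1" if "k < 4" "i < 4" for k i
  proof -
    have "k = 0 \<or> k = 1 \<or> k = 2 \<or> k = 3" "i = 0 \<or> i = 1 \<or> i = 2 \<or> i = 3" using that by auto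
    then show ?thesis unfolding normal_cubic_def
      by (elim disjE) (simp_all del: fun_upd_apply add: coord[unfolded One_nat_def] polyfuns_add polyfuns_const)
  qed
  then have w: "(\<lambda>y. coef (sq_coeff (normal_cubic (y(12 := 1))) n) m) \<in> polyfuns 22 2" for n m
    using polyfuns_lookup_sq_coeff[of "\<lambda>y. normal_cubic (y(12 := 1))" 22 1] by (simp add: numeral_2_eq_2)
  have "(\<lambda>y. coef (sq_coeff (normal_cubic (y(12 := 1))) j) m +
     (\<Sum>k\<in>{5..<7}. y (12 + 2 * j + (k - 5)) * coef (sq_coeff (normal_cubic (y(12 := 1))) k) m)) \<in> polyfuns 22 3"
  proof (intro polyfuns_add polyfuns_sum)
    show "(\<lambda>y. coef (sq_coeff (normal_cubic (y(12 := 1))) j) m) \<in> polyfuns 22 3"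
      by (rule polyfuns_mono[OF w]) simp
    fix k :: nat assume "k \<in> {5..<7}"
    then have "(\<lambda>y. y (12 + 2 * j + (k - 5))) \<in> polyfuns 22 1" using assms by (intro polyfuns_coord) auto
    from polyfuns_mult[OF this w[of k m]]
    show "(\<lambda>y. y (12 + 2 * j + (k - 5)) * coef (sq_coeff (normal_cubic (y(12 := 1))) k) m) \<in> polyfuns 22 3"
      by (simp add: numeral_3_eq_3)
  qed
  then show ?thesis by (simp add: Sigma_frame_def Let_def lookup_add lookup_sum)
qed

text \<open>If \<open>x 12 = 1\<close>, echelon frames suffice. Dividing all coefficients by
  \<open>x 12\<close> keeps the same projective points, which covers \<open>x 12 \<noteq> 0\<close>;
  the value 0 is reached by moving this coefficient alone.\<close>

lemma vanishes_on_normal_cubic: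
  assumes h: "h \<in> pforms 3 2 5 e" and van: "\<And>y. h (pluecker 5 (Sigma_frame y)) = 0"
  shows "vanishes_on_cubic h (normal_cubic x)"
proof -
  have one: "vanishes_on_cubic h (normal_cubic x)" if x: "x 12 = 1" for x
    unfolding vanishes_on_frames_def
  proof
    fix A
    show "h (pluecker 5 (\<lambda>j. \<Sum>k<7. poly_scale (A k j) (sq_coeff (normal_cubic x) k))) = 0"
    proof (rule pform_echelon[OF h])
      fix \<alpha> :: "nat \<Rightarrow> nat \<Rightarrow> complex"
      \<comment> \<open>Entry 12 of \<open>y\<close> is the first frame coefficient, since the curve
        reads the constant 1 in its place. The formula inverts the numbering
        \<open>12 + 2 * j + (k - 5)\<close>.\<close>
      define y where "y i = (if i < 12 then x i else \<alpha> ((i - 12) mod 2 + 5) ((i - 12) div 2))" for i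
      have "normal_cubic (y(12 := 1)) = normal_cubic x"
        by (rule normal_cubic_cong) (auto simp: y_def x)
      moreover have "y (12 + 2 * j + (k - 5)) = \<alpha> k j" if "k \<in> {5..<7}" for j k
      proof -
        have "k = 5 \<or> k = 6" using that by auto
        then show ?thesis by (auto simp: y_def)
      qed
      ultimately have "pluecker 5 (\<lambda>j. sq_coeff (normal_cubic x) j + (\<Sum>k\<in>{5..<7}. poly_scale (\<alpha> k j) (sq_coeff (normal_cubic x) k))) =
        pluecker 5 (Sigma_frame y)"
        by (intro pform_cong) (simp add: Sigma_frame_def Let_def)
      then show "h (pluecker 5 (\<lambda>j. sq_coeff (normal_cubic x) j + (\<Sum>k\<in>{5..<7}. poly_scale (\<alpha> k j) (sq_coeff (normal_cubic x) k)))) = 0"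
        by (simp add: van)
    qed simp
  qed
  have nonzero: "vanishes_on_cubic h (normal_cubic x)" if x: "x 12 \<noteq> 0" for x
  proof (rule vanishes_on_cubic_reparam[OF one[of "\<lambda>i. x i / x 12"]])
    fix s t
    have "\<forall>i<4. cubic_point (normal_cubic x) s t i = x 12 * cubic_point (normal_cubic (\<lambda>i. x i / x 12)) s t i"
      unfolding all_less_4 normal_cubic_point using x by (simp add: field_simps)
    then show "\<exists>c s' t'. \<forall>i<4. cubic_point (normal_cubic x) s t i =
        c * cubic_point (normal_cubic (\<lambda>i. x i / x 12)) s' t' i" by blast
  qed (use x in simp)
  have "vanishes_on_cubic h (normal_cubic (x(12 := x 12 + 0)))"
  proof (rule vanishes_on_frames_density[OF h, where w = "\<lambda>t. sq_coeff (normal_cubic (x(12 := x 12 + t)))"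
        and g = "\<lambda>t. x 12 + t" and s = "1 - x 12" and t = 0])
    show "upoly (\<lambda>t. coef (sq_coeff (normal_cubic (x(12 := x 12 + t))) k) m)" for k m
    proof (rule upoly_lookup_sq_coeff)
      fix k i :: nat assume "k < 4" "i < 4"
      then have "k = 0 \<or> k = 1 \<or> k = 2 \<or> k = 3" "i = 0 \<or> i = 1 \<or> i = 2 \<or> i = 3" by auto
      then show "upoly (\<lambda>t. normal_cubic (x(12 := x 12 + t)) k i)" unfolding normal_cubic_def
        by (elim disjE) (auto intro: upoly_intros)
    qed
    show "upoly (\<lambda>t. x 12 + t)" by (intro upoly_intros)
    show "vanishes_on_cubic h (normal_cubic (x(12 := x 12 + t)))" if "x 12 + t \<noteq> 0" for t
      by (rule nonzero) (use that in simp)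
  qed simp
  then show ?thesis by simp
qed

subsection \<open>Rational cubic curves through six points\<close>

text \<open>Generically the first four points are a basis. General position of the last two is then
  a condition on their coordinates \<open>c\<close> and \<open>d\<close> alone.\<close>

definition six_points :: "(nat \<Rightarrow> nat \<Rightarrow> complex) \<Rightarrow> (nat \<Rightarrow> complex) \<Rightarrow> (nat \<Rightarrow> complex) \<Rightarrow> nat \<Rightarrow> nat \<Rightarrow> complex" where
  "six_points q c d i = (if i < 4 then q i
     else if i = 4 then \<lambda>l. \<Sum>k<4. c k * q k l else (\<lambda>l. \<Sum>k<4. d k * q k l))"

lemma binary_cubic_product:
  fixes c d :: "nat \<Rightarrow> complex"
  assumes "i < 4"
  shows "\<exists>T. \<forall>s t. (\<Prod>j\<in>{..<4} - {i}. d j * t - c j * s) = (\<Sum>k<4. s ^ (3 - k) * t ^ k * T k)"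
proof -
  have three: "\<exists>T. \<forall>s t. (d1 * t - c1 * s) * ((d2 * t - c2 * s) * (d3 * t - c3 * s)) = (\<Sum>k<4. s ^ (3 - k) * t ^ k * T k)"
    for c1 c2 c3 d1 d2 d3 :: complex
    by (rule exI[of _ "\<lambda>k. [- c1 * c2 * c3, c1 * c2 * d3 + c1 * d2 * c3 + d1 * c2 * c3,
        - (c1 * d2 * d3 + d1 * c2 * d3 + d1 * d2 * c3), d1 * d2 * d3] ! k"])
      (simp add: sum_lessThan_4 power2_eq_square power3_eq_cube algebra_simps)
  have "i = 0 \<or> i = 1 \<or> i = 2 \<or> i = 3" using assms by auto
  moreover have "{..<4} - {0} = {1, 2, 3::nat}" "{..<4} - {1} = {0, 2, 3::nat}"
    "{..<4} - {2} = {0, 1, 3::nat}" "{..<4} - {3} = {0, 1, 2::nat}" by auto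
  ultimately show ?thesis by (elim disjE) (simp_all add: three)
qed

text \<open>The curve \<open>\<Sum>\<^sub>i c\<^sub>i d\<^sub>i \<Prod>\<^sub>j\<^sub>\<noteq>\<^sub>i (d\<^sub>j t - c\<^sub>j s) q\<^sub>i\<close> passes through \<open>q\<^sub>i\<close> at \<open>(d\<^sub>i, c\<^sub>i)\<close> and through the
  two remaining points at \<open>(0, 1)\<close> and \<open>(1, 0)\<close>.\<close>

lemma vanishes_on_six_points_generic:
  assumes van: "\<And>V. vanishes_on_cubic h V"
    and gen: "\<And>i. i < 4 \<Longrightarrow> c i \<noteq> 0" "\<And>i. i < 4 \<Longrightarrow> d i \<noteq> 0"
      "\<And>i j. i < 4 \<Longrightarrow> j < 4 \<Longrightarrow> i \<noteq> j \<Longrightarrow> c i * d j - c j * d i \<noteq> 0"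
  shows "vanishes_on_frames h 5 (\<lambda>i. lin (six_points q c d i) ^ 2) 6"
proof -
  have "\<forall>i. \<exists>T. i < 4 \<longrightarrow> (\<forall>s t. (\<Prod>j\<in>{..<4} - {i}. d j * t - c j * s) = (\<Sum>k<4. s ^ (3 - k) * t ^ k * T k))"
    using binary_cubic_product[of _ d c] by simp
  from choice[OF this] obtain T where
    T: "\<And>i s t. i < 4 \<Longrightarrow> (\<Prod>j\<in>{..<4} - {i}. d j * t - c j * s) = (\<Sum>k<4. s ^ (3 - k) * t ^ k * T i k)"
    by blast
  define V where "V k l = (\<Sum>i<4. c i * d i * T i k * q i l)" for k l
  have cp: "cubic_point V s t l = (\<Sum>i<4. c i * d i * (\<Prod>j\<in>{..<4} - {i}. d j * t - c j * s) * q i l)" for s t l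
  proof -
    have "cubic_point V s t l = (\<Sum>i<4. \<Sum>k<4. c i * d i * (s ^ (3 - k) * t ^ k * T i k) * q i l)"
      unfolding cubic_point_def V_def sum_distrib_left by (subst sum.swap) (simp add: mult_ac)
    also have "\<dots> = (\<Sum>i<4. c i * d i * (\<Prod>j\<in>{..<4} - {i}. d j * t - c j * s) * q i l)"
      by (intro sum.cong) (auto simp: T sum_distrib_left sum_distrib_right)
    finally show ?thesis .
  qed
  have "\<exists>\<gamma> s t. \<gamma> \<noteq> 0 \<and> cubic_point V s t = (\<lambda>l. \<gamma> * six_points q c d k l)" if k: "k < 6" for k
  proof -
    consider "k < 4" | "k = 4" | "k = 5" using k by linarith
    then show ?thesis
    proof cases
      case 1
      \<comment> \<open>At the parameter \<open>(d k, c k)\<close> each summand with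
        \<open>i \<noteq> k\<close> contains the factor for \<open>j = k\<close>, which vanishes;
        \<open>\<gamma>\<close> is what remains of the summand \<open>k\<close>.\<close>
      define \<gamma> where "\<gamma> = c k * d k * (\<Prod>j\<in>{..<4} - {k}. d j * c k - c j * d k)"
      have "\<gamma> \<noteq> 0" using gen 1 by (auto simp: \<gamma>_def mult.commute)
      moreover have "cubic_point V (d k) (c k) l = \<gamma> * six_points q c d k l" for l
      proof -
        have "(\<Prod>j\<in>{..<4} - {i}. d j * c k - c j * d k) = 0" if "i \<noteq> k" for i
          using that 1 by (intro prod_zero bexI[of _ k]) auto
        then have "cubic_point V (d k) (c k) l = (\<Sum>i\<in>{k}. c i * d i * (\<Prod>j\<in>{..<4} - {i}. d j * c k - c j * d k) * q i l)"
          unfolding cp using 1 by (intro sum.mono_neutral_right) auto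
        then show ?thesis using 1 by (simp add: \<gamma>_def six_points_def)
      qed
      ultimately show ?thesis by blast
    next
      case 2
      define \<gamma> where "\<gamma> = (\<Prod>j<4. d j)"
      have "\<gamma> \<noteq> 0" using gen by (auto simp: \<gamma>_def)
      moreover have "cubic_point V 0 1 l = \<gamma> * six_points q c d k l" for l
      proof -
        have "d i * (\<Prod>j\<in>{..<4} - {i}. d j) = \<gamma>" if "i < 4" for i
          using that by (simp add: \<gamma>_def prod.remove[of "{..<4}" i])
        then have "c i * d i * (\<Prod>j\<in>{..<4} - {i}. d j) * q i l = \<gamma> * (c i * q i l)" if "i < 4" for i
          using that by (metis mult.assoc mult.left_commute)
        then have "(\<Sum>i<4. c i * d i * (\<Prod>j\<in>{..<4} - {i}. d j) * q i l) = (\<Sum>i<4. \<gamma> * (c i * q i l))"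
          by (intro sum.cong refl) simp_all
        then show ?thesis using 2 by (simp add: cp six_points_def sum_distrib_left)
      qed
      ultimately show ?thesis by blast
    next
      case 3
      \<comment> \<open>The outer sign accounts for \<open>c i\<close> taking the place of the
        factor \<open>- c i\<close> missing from the product.\<close>
      define \<gamma> where "\<gamma> = - (\<Prod>j<4. - c j)"
      have "\<gamma> \<noteq> 0" using gen by (auto simp: \<gamma>_def)
      moreover have "cubic_point V 1 0 l = \<gamma> * six_points q c d k l" for l
      proof -
        have "c i * (\<Prod>j\<in>{..<4} - {i}. - c j) = \<gamma>" if "i < 4" for i
          using that by (simp add: \<gamma>_def prod.remove[of "{..<4}" i "\<lambda>j. - c j"])
        then have "c i * d i * (\<Prod>j\<in>{..<4} - {i}. - c j) * q i l = \<gamma> * (d i * q i l)" if "i < 4" for i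
          using that by (metis mult.assoc mult.left_commute)
        then have "(\<Sum>i<4. c i * d i * (\<Prod>j\<in>{..<4} - {i}. - c j) * q i l) = (\<Sum>i<4. \<gamma> * (d i * q i l))"
          by (intro sum.cong refl) simp_all
        then show ?thesis using 3 by (simp add: cp six_points_def sum_distrib_left)
      qed
      ultimately show ?thesis by blast
    qed
  qed
  then have "lin (six_points q c d k) ^ 2 \<in> cpoly.span (sq_coeff V ` {..<7})" if k: "k < 6" for k
  proof -
    obtain \<gamma> s t where \<gamma>: "\<gamma> \<noteq> 0" "cubic_point V s t = (\<lambda>l. \<gamma> * six_points q c d k l)"
      using \<open>\<And>k. k < 6 \<Longrightarrow> \<exists>\<gamma> s t. \<gamma> \<noteq> 0 \<and> cubic_point V s t = (\<lambda>l. \<gamma> * six_points q c d k l)\<close>[OF k] by blast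
    have "lin (cubic_point V s t) ^ 2 = poly_scale (\<gamma> * \<gamma>) (lin (six_points q c d k) ^ 2)"
      unfolding \<gamma>(2) lin_scale power2_eq_square poly_scale_mult ..
    then have "lin (six_points q c d k) ^ 2 = poly_scale (1 / (\<gamma> * \<gamma>)) (lin (cubic_point V s t) ^ 2)"
      using \<gamma>(1) by simp
    then show ?thesis by (simp add: cubic_point_square_in_span cpoly.span_scale)
  qed
  then show ?thesis by (rule vanishes_on_frames_trans[OF van[of V]])
qed

lemma upoly_lookup_lin_square:
  assumes "\<And>i. i < 4 \<Longrightarrow> upoly (\<lambda>t. u t i)"
  shows "upoly (\<lambda>t. coef (lin (u t) ^ 2) m)"
  unfolding power2_eq_square by (rule upoly_lookup_lin_mult) (use assms in auto)

lemma vanishes_on_six_points: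
  assumes h: "h \<in> pforms 3 2 5 e" and van: "\<And>V. vanishes_on_cubic h V"
  shows "vanishes_on_frames h 5 (\<lambda>i. lin (six_points q c d i) ^ 2) 6"
proof -
  \<comment> \<open>The slopes 1 and \<open>k + 1\<close> give the quadratics in \<open>g\<close>
    the nonzero leading coefficients \<open>i + 1\<close> and \<open>j - i\<close>; with slope
    \<open>k\<close> instead, \<open>d 0\<close> would not move.\<close>
  define c' where "c' t k = c k + t" for t :: complex and k
  define d' where "d' t k = d k + of_nat (k + 1) * t" for t :: complex and k :: nat
  define g where "g p t = (case p of (i, j) \<Rightarrow> if i = j then c' t i * d' t i else c' t i * d' t j - c' t j * d' t i)" for p t
  define I where "I = {..<4::nat} \<times> {..<4::nat}"
  have up: "upoly (\<lambda>t. c' t k)" "upoly (\<lambda>t. d' t k)" for k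
    unfolding c'_def d'_def by (intro upoly_intros)+
  have upg: "upoly (g p)" for p
  proof -
    obtain i j where p: "p = (i, j)" by fastforce
    have "upoly (\<lambda>t. g p t)"
      by (cases "i = j") (auto simp: p g_def intro!: upoly_intros up)
    then show ?thesis .
  qed
  have "\<exists>t. g p t \<noteq> 0" for p
  proof -
    obtain i j where p: "p = (i, j)" by fastforce
    have "\<exists>A B C. C \<noteq> 0 \<and> (\<forall>t. g p t = A + B * t + C * t\<^sup>2)"
    proof (cases "i = j")
      case True
      show ?thesis
      proof (intro exI conjI allI)
        show "of_nat (i + 1) \<noteq> (0 :: complex)" by (simp only: of_nat_eq_0_iff)
        show "g p t = c i * d i + (d i + c i * of_nat (i + 1)) * t + of_nat (i + 1) * t\<^sup>2" for t
          using True by (simp add: p g_def c'_def d'_def power2_eq_square algebra_simps)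
      qed
    next
      case False
      show ?thesis
      proof (intro exI conjI allI)
        show "of_nat j - of_nat i \<noteq> (0 :: complex)" using False by simp
        show "g p t = (c i * d j - c j * d i) + (d j - d i + c i * of_nat (j + 1) - c j * of_nat (i + 1)) * t +
            (of_nat j - of_nat i) * t\<^sup>2" for t
          using False by (simp add: p g_def c'_def d'_def power2_eq_square algebra_simps)
      qed
    qed
    then show ?thesis using upoly_quadratic_nonzero by metis
  qed
  then obtain s where s: "(\<Prod>p\<in>I. g p s) \<noteq> 0"
    using upoly_common_nonzero[of I g] upg by (auto simp: I_def)
  have "vanishes_on_frames h 5 (\<lambda>i. lin (six_points q (c' 0) (d' 0) i) ^ 2) 6"
  proof (rule vanishes_on_frames_density[OF h, where w = "\<lambda>t i. lin (six_points q (c' t) (d' t) i) ^ 2"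
        and g = "\<lambda>t. \<Prod>p\<in>I. g p t" and s = s and t = 0])
    show "upoly (\<lambda>t. \<Prod>p\<in>I. g p t)" by (intro upoly_intros upg)
    show "(\<Prod>p\<in>I. g p s) \<noteq> 0" by (rule s)
    show "upoly (\<lambda>t. coef (lin (six_points q (c' t) (d' t) k) ^ 2) m)" for k m
    proof (rule upoly_lookup_lin_square)
      fix i
      show "upoly (\<lambda>t. six_points q (c' t) (d' t) k i)"
        by (cases "k < 4"; cases "k = 4") (auto simp: six_points_def intro!: upoly_intros up)
    qed
    show "vanishes_on_frames h 5 (\<lambda>i. lin (six_points q (c' t) (d' t) i) ^ 2) 6" if t: "(\<Prod>p\<in>I. g p t) \<noteq> 0" for t
    proof (rule vanishes_on_six_points_generic[OF van])
      have gt: "g (i, j) t \<noteq> 0" if "i < 4" "j < 4" for i j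
        using t that by (auto simp: I_def)
      show "c' t i \<noteq> 0" "d' t i \<noteq> 0" if "i < 4" for i
        using gt[OF that that] by (auto simp: g_def)
      show "c' t i * d' t j - c' t j * d' t i \<noteq> 0" if "i < 4" "j < 4" "i \<noteq> j" for i j
        using gt[OF that(1,2)] that(3) by (simp add: g_def)
    qed
  qed
  then show ?thesis by (simp add: c'_def[abs_def] d'_def[abs_def])
qed

text \<open>Adding \<open>t\<close> times the coordinate vectors makes the first four points a basis
  for generic \<open>t\<close>; the last two stay fixed and acquire coordinates in it, which is the
  situation of \<open>six_points\<close>.\<close>

lemma vanishes_on_six_squares:
  assumes h: "h \<in> pforms 3 2 5 e" and van: "\<And>V. vanishes_on_cubic h V"
  shows "vanishes_on_frames h 5 (\<lambda>i. lin (q i) ^ 2) 6"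
proof -
  define q' where "q' t i l = q i l + (if i = l then t else 0)" for t :: complex and i l :: nat
  define p where "p t i = (if i < 4 then q' t i else q i)" for t i
  define g where "g t = det (mat 4 4 (\<lambda>(i, l). q' t i l))" for t
  have up: "upoly (\<lambda>t. q' t i l)" for i l
    by (cases "i = l") (auto simp: q'_def intro!: upoly_intros)
  obtain s where s: "g s \<noteq> 0" unfolding g_def q'_def by (rule det_shift_nonzero)
  have "vanishes_on_frames h 5 (\<lambda>i. lin (p 0 i) ^ 2) 6"
  proof (rule vanishes_on_frames_density[OF h, where w = "\<lambda>t i. lin (p t i) ^ 2"
        and g = g and s = s and t = 0])
    show "upoly g" unfolding g_def by (intro upoly_det up)
    show "g s \<noteq> 0" by (rule s)
    show "upoly (\<lambda>t. coef (lin (p t k) ^ 2) m)" for k m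
    proof (rule upoly_lookup_lin_square)
      show "upoly (\<lambda>t. p t k i)" for i
        by (cases "k < 4") (auto simp: p_def intro!: upoly_intros up)
    qed
    show "vanishes_on_frames h 5 (\<lambda>i. lin (p t i) ^ 2) 6" if t: "g t \<noteq> 0" for t
    proof -
      obtain C where C: "\<And>i j. i < 4 \<Longrightarrow> j < 4 \<Longrightarrow> (\<Sum>l<4. C i l * q' t l j) = (if i = j then 1 else 0)"
        using left_inverse[OF t[unfolded g_def]] by blast
      define coord where "coord v m = (\<Sum>l'<4. v l' * C l' m)" for v m
      have coord: "(\<Sum>m<4. coord v m * q' t m l) = v l" if l: "l < 4" for v l
      proof -
        have "(\<Sum>m<4. coord v m * q' t m l) = (\<Sum>l'<4. v l' * (\<Sum>m<4. C l' m * q' t m l))"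
          unfolding coord_def sum_distrib_left sum_distrib_right by (subst sum.swap) (simp add: mult.assoc)
        also have "\<dots> = (\<Sum>l'<4. if l' = l then v l' else 0)"
          using l by (intro sum.cong) (auto simp: C)
        finally show ?thesis using l by simp
      qed
      have "lin (p t i) = lin (six_points (q' t) (coord (q 4)) (coord (q 5)) i)" if i: "i < 6" for i
      proof -
        consider "i < 4" | "i = 4" | "i = 5" using i by linarith
        then show ?thesis
          by cases (auto simp: p_def six_points_def coord intro!: lin_cong)
      qed
      then show ?thesis
        using vanishes_on_six_points[OF h van, of "q' t" "coord (q 4)" "coord (q 5)"]
        by (simp add: vanishes_on_frames_def)
    qed
  qed
  moreover have "p 0 = q" by (auto simp: p_def q'_def fun_eq_iff)
  ultimately show ?thesis by simp
qed

section \<open>The upper bound for the dimension of Sigma\<close>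

lemma Sigma_var_subset: "Sigma_var n d r s \<subseteq> Grassmannian n d r"
  by (auto simp: Sigma_var_def)

lemma topspace_Sigma:
  "topspace (subtopology (zariski_Gr 3 2 5) (Sigma_var 3 2 5 6)) = Sigma_var 3 2 5 6"
  using Sigma_var_subset[of 3 2 5 6] by (auto simp: topspace_zariski_Gr)

text \<open>Vanishing spreads from \<open>Sigma_frame\<close> to frames over normalized, factored
  and arbitrary cubics, and from there to frames in any six squares. This is the domination
  hypothesis of \<open>krull_dim_le\<close>.\<close>

theorem krull_dim_Sigma_le: "krull_dim (subtopology (zariski_Gr 3 2 5) (Sigma_var 3 2 5 6)) \<le> enat 22"
proof -
  interpret homogeneous_coordinates "subtopology (zariski_Gr 3 2 5) (Sigma_var 3 2 5 6)" "pforms 3 2 5" "prel 5"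
    by (rule homogeneous_coordinates_Gr[OF _ Sigma_var_subset]) simp
  show ?thesis
  proof (rule krull_dim_le)
    show "(\<lambda>y. h (pluecker 5 (Sigma_frame y))) \<in> polyfuns 22 (15 * m)" if "h \<in> pforms 3 2 5 m" for m h
      using pform_polyfuns[OF that, where N = 22 and D = 3 and b = Sigma_frame] Sigma_frame_polyfuns by simp
    fix m h w assume h: "h \<in> pforms 3 2 5 m" and van: "\<And>y. h (pluecker 5 (Sigma_frame y)) = 0"
      and w: "w \<in> cone (topspace (subtopology (zariski_Gr 3 2 5) (Sigma_var 3 2 5 6)))"
    have cubics: "vanishes_on_cubic h V" for V
      by (rule vanishes_on_all_cubics[OF h vanishes_on_normal_cubic[OF h van]])
    obtain L b where L: "L \<in> Sigma_var 3 2 5 6" "is_basis 5 b L" "w = pluecker 5 b"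
      using w unfolding topspace_Sigma by (auto simp: cone_def prel_def)
    then obtain Q where Q: "finite Q" "card Q = 6" "Q \<subseteq> forms_space 3 1" "L \<subseteq> cpoly.span ((\<lambda>q. q ^ 2) ` Q)"
      by (auto simp: Sigma_var_def power_independent_sets_def)
    obtain f :: "nat \<Rightarrow> nat cpoly" where "bij_betw f {..<6} Q"
      using ex_bij_betw_nat_finite[OF Q(1)] Q(2) by (auto simp: atLeast0LessThan)
    then have f: "f ` {..<6} = Q" by (simp add: bij_betw_def)
    have "\<exists>u. f i = lin u" if "i < 6" for i
      using that f Q(3) linear_formE[of "f i"] by blast
    then obtain u where u: "\<And>i. i < 6 \<Longrightarrow> f i = lin (u i)" by metis
    have "(\<lambda>q. q ^ 2) ` Q = (\<lambda>i. lin (u i) ^ 2) ` {..<6}"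
      unfolding f[symmetric] image_image by (intro image_cong) (auto simp: u)
    moreover have "b j \<in> L" if "j < 5" for j
      using L(2) that cpoly.span_base[of "b j" "b ` {..<5}"] by (auto simp: is_basis_def)
    ultimately have "b j \<in> cpoly.span ((\<lambda>i. lin (u i) ^ 2) ` {..<6})" if "j < 5" for j
      using that Q(4) by auto
    then show "h w = 0" unfolding L(3)
      by (rule vanishes_on_framesD[OF vanishes_on_six_squares[OF h cubics]])
  qed
qed

subsection \<open>A frame with injective differential\<close>

lemma tendsto_det:
  fixes f :: "'a \<Rightarrow> nat \<Rightarrow> nat \<Rightarrow> complex"
  assumes "\<And>i j. i < r \<Longrightarrow> j < r \<Longrightarrow> ((\<lambda>t. f t i j) \<longlongrightarrow> A i j) F"
  shows "((\<lambda>t. det (mat r r (\<lambda>(i, j). f t i j))) \<longlongrightarrow> det (mat r r (\<lambda>(i, j). A i j))) F"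
  unfolding det_mat_Leibniz
  by (intro tendsto_sum tendsto_mult tendsto_const tendsto_prod assms) (auto simp: permutes_in_image)

text \<open>The symmetric bilinear form that polarizes the functional with coefficient list
  \<open>c\<close>: on the diagonal it is the value of the functional on the square of a linear
  form.\<close>

definition quad_form :: "complex list \<Rightarrow> (nat \<Rightarrow> complex) \<Rightarrow> (nat \<Rightarrow> complex) \<Rightarrow> complex" where
  "quad_form c u v = (\<Sum>k<10. c ! k * bil_coeff u v k)"

lemma quad_functional_lin_mult: "quad_functional ((!) c) (lin u * lin v) = quad_form c u v"
  by (simp add: quad_functional_def quad_form_def lookup_lin_mult)

lemma quad_functional_diff_scale:
  "quad_functional c (p - poly_scale a q) = quad_functional c p - a * quad_functional c q"
  by (simp add: quad_functional_def lookup_minus sum_subtractf sum_distrib_left algebra_simps)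

lemma bil_coeff_add: "bil_coeff (\<lambda>l. u l + t * v l) (\<lambda>l. u l + t * v l) k =
    bil_coeff u u k + t * (2 * bil_coeff u v k + t * bil_coeff v v k)"
  by (simp add: bil_coeff_def algebra_simps split: prod.split)

lemma quad_form_add: "quad_form c (\<lambda>l. u l + t * v l) (\<lambda>l. u l + t * v l) =
    quad_form c u u + t * (2 * quad_form c u v + t * quad_form c v v)"
  by (simp add: quad_form_def bil_coeff_add algebra_simps sum.distrib sum_distrib_left)

lemma quad_form_expand: "quad_form c u v = c ! 0 * (u 0 * v 0) + c ! 1 * (u 0 * v 1 + u 1 * v 0) +
    c ! 2 * (u 0 * v 2 + u 2 * v 0) + c ! 3 * (u 0 * v 3 + u 3 * v 0) + c ! 4 * (u 1 * v 1) +
    c ! 5 * (u 1 * v 2 + u 2 * v 1) + c ! 6 * (u 1 * v 3 + u 3 * v 1) + c ! 7 * (u 2 * v 2) +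
    c ! 8 * (u 2 * v 3 + u 3 * v 2) + c ! 9 * (u 3 * v 3)"
proof -
  have ten: "(\<Sum>k<(10::nat). f k) = f 0 + f 1 + f 2 + f 3 + f 4 + f 5 + f 6 + f 7 + f 8 + f 9" for f :: "nat \<Rightarrow> complex"
    by (simp add: numeral_eq_Suc)
  show ?thesis by (simp add: quad_form_def ten bil_coeff_def quad_pairs_def)
qed

text \<open>Six points depending on \<open>17\<close> parameters, the last one moving in a plane only, and five further
  parameters for a hyperplane in the span of their squares.\<close>

definition pt_base :: "nat \<Rightarrow> nat \<Rightarrow> complex" where
  "pt_base i l = [[1, 0, 0, 0], [0, 1, 0, 0], [0, 0, 1, 0], [0, 0, 0, 1], [1, 1, 0, 1], [2, 0, -1, 1]] ! i ! l"

text \<open>One nonzero coordinate of each form is kept fixed, which removes its scaling. The last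
  form keeps two, -1 and 1 in positions 2 and 3; this slices the one-parameter family of six-tuples
  that belong to the same \<Lambda>.\<close>

definition pt_dir :: "(nat \<Rightarrow> complex) \<Rightarrow> nat \<Rightarrow> nat \<Rightarrow> complex" where
  "pt_dir x i l = [[0, x 0, x 1, x 2], [x 3, 0, x 4, x 5], [x 6, x 7, 0, x 8], [x 9, x 10, x 11, 0],
     [0, x 12, x 13, x 14], [x 15, x 16, 0, 0]] ! i ! l"

definition pt :: "(nat \<Rightarrow> complex) \<Rightarrow> nat \<Rightarrow> nat \<Rightarrow> complex" where
  "pt x i l = pt_base i l + pt_dir x i l"

text \<open>In the differential of the frame, the motion of the last form carries the factor
  \<open>hyp_base\<close>; at a base point with all entries 0 its two parameters would be
  invisible.\<close>

definition hyp_base :: "nat \<Rightarrow> complex" where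
  "hyp_base i = [0, 0, 0, 1, 1] ! i"

definition hyp :: "(nat \<Rightarrow> complex) \<Rightarrow> nat \<Rightarrow> complex" where
  "hyp x i = hyp_base i + x (17 + i)"

text \<open>When the six squares are independent, these frames give the hyperplanes of their span
  that do not contain the last square.\<close>

definition hyp_frame :: "(nat \<Rightarrow> complex) \<Rightarrow> nat \<Rightarrow> nat cpoly" where
  "hyp_frame x j = lin (pt x j) ^ 2 - poly_scale (hyp x j) (lin (pt x 5) ^ 2)"

definition frame_value :: "complex list \<Rightarrow> nat \<Rightarrow> complex" where
  "frame_value c j = quad_form c (pt_base j) (pt_base j) - hyp_base j * quad_form c (pt_base 5) (pt_base 5)"

text \<open>Dual bases of the frame and of the six squares at the origin.\<close>

definition frame_dual :: "complex list list" where
  "frame_dual = [[1, -1/2, 1, 0, 0, 0, 0, 0, 0, 0],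
     [0, -1/2, 0, 0, 1, 0, 0, 0, 0, 0],
     [0, 0, 1/4, 0, 0, 0, 0, 1, 0, 0],
     [0, -1/2, 1/4, 0, 0, 0, 0, 0, 0, 0],
     [0, 1/2, 0, 0, 0, 0, 0, 0, 0, 0]]"

definition square_dual :: "complex list list" where
  "square_dual = [[1, -1/2, 1, 0, 0, 0, 0, 0, 0, 0],
     [0, -1/2, 0, 0, 1, 0, 0, 0, 0, 0],
     [0, 0, 1/4, 0, 0, 0, 0, 1, 0, 0],
     [0, -1/2, 1/4, 0, 0, 0, 0, 0, 0, 1],
     [0, 1/2, 0, 0, 0, 0, 0, 0, 0, 0],
     [0, 0, -1/4, 0, 0, 0, 0, 0, 0, 0]]"

text \<open>Functionals that vanish on the frame at the origin; entry \<open>l\<close> extracts the parameter \<open>x\<^sub>l\<close> from the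
  differential of the frame.\<close>

definition tangent_dual :: "(nat \<times> complex list) list list" where
  "tangent_dual =
    [[(0, [0, 1/2, 0, 0, 0, 0, -1/2, 0, 0, 0])],
     [(0, [0, 0, 1/2, 0, 0, 0, 0, 0, -1, 0])],
     [(0, [0, 0, 0, 1/2, 0, 0, -1/2, 0, 1, 0])],
     [(1, [0, 1/2, -1/2, -1/2, 0, 0, 0, 0, 0, 0])],
     [(1, [0, 0, 0, 0, 0, 1/2, 0, 0, 0, 0])],
     [(1, [0, 0, -1/2, -1/2, 0, 0, 1/2, 0, 0, 0])],
     [(2, [0, -1/2, 1/2, 1/2, 0, 0, 0, 0, 0, 0])],
     [(2, [0, 0, 0, 0, 0, 1/2, 0, 0, 0, 0])],
     [(2, [0, -1/4, 0, 1/4, 0, 0, 0, 0, 1/2, 0])],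
     [(3, [0, -1/2, 1/2, 1/2, 0, -1, 0, 0, 0, 0])],
     [(3, [0, -1/2, 0, 0, 0, -1/2, 1/2, 0, 0, 0])],
     [(3, [0, 0, -1/4, 0, 0, -1/4, 0, 0, 1/2, 0]), (4, [0, 0, 1/4, 0, 0, 1/4, 0, 0, -1/2, 0])],
     [(4, [0, 0, -1/2, -1/2, 0, 1/2, 1/2, 0, 0, 0])],
     [(3, [0, 0, 0, 0, 0, -1/2, 0, 0, 0, 0]), (4, [0, 0, 0, 0, 0, 1/2, 0, 0, 0, 0])],
     [(3, [0, 0, 0, 0, 0, -1/2, 0, 0, 0, 0]), (4, [0, -1/2, 0, 0, 0, 0, 1/2, 0, 0, 0])],
     [(3, [0, 0, 0, 0, 0, -1/2, 0, 0, 0, 0]), (4, [0, 0, 1/2, 0, 0, 1/2, 0, 0, -1, 0])],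
     [(3, [0, 0, 0, 0, 0, 1/2, 0, 0, 0, 0])],
     [(0, [0, 0, 0, 0, 0, 0, 0, 0, 0, -1])],
     [(1, [0, 0, 0, 0, 0, 0, 0, 0, 0, -1])],
     [(2, [0, 0, 0, 0, 0, 0, 0, 0, 0, -1])],
     [(3, [0, 0, 0, 0, 0, 0, 0, 0, 0, -1])],
     [(3, [0, 0, 0, 0, 0, -1, 0, 0, 0, 0]), (4, [0, -1, 0, 0, 0, 0, 1, 0, 0, -1])]]"

section \<open>First-order expansion of the frame at the base point\<close>

lemma less_6_cases: "i < 6 \<longleftrightarrow> i = 0 \<or> i = 1 \<or> i = 2 \<or> i = 3 \<or> i = 4 \<or> i = (5::nat)"
  by auto

lemma less_5_cases: "i < 5 \<longleftrightarrow> i = 0 \<or> i = 1 \<or> i = 2 \<or> i = 3 \<or> i = (4::nat)"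
  by auto

lemma less_4_cases: "i < 4 \<longleftrightarrow> i = 0 \<or> i = 1 \<or> i = 2 \<or> i = (3::nat)"
  by auto

lemma pt_dir_scale: "i < 6 \<Longrightarrow> l < 4 \<Longrightarrow> pt_dir (\<lambda>k. t * x k) i l = t * pt_dir x i l"
  unfolding less_6_cases less_4_cases by (elim disjE) (simp_all add: pt_dir_def)

lemma pt_polyfuns: "i < 6 \<Longrightarrow> l < 4 \<Longrightarrow> (\<lambda>x. pt x i l) \<in> polyfuns 22 1"
  unfolding pt_def less_6_cases less_4_cases
  by (intro polyfuns_add polyfuns_const, elim disjE)
    (simp_all add: pt_dir_def polyfuns_const polyfuns_coord[unfolded One_nat_def])

lemma lookup_pt_square_polyfuns:
  "i < 6 \<Longrightarrow> (\<lambda>x. coef (lin (pt x i) ^ 2) m) \<in> polyfuns 22 2"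
  using polyfuns_lookup_lin_mult[of "\<lambda>x. pt x i" 22 1 "\<lambda>x. pt x i" 1 m] pt_polyfuns[of i]
  by (simp add: power2_eq_square numeral_2_eq_2)

lemma hyp_frame_polyfuns:
  assumes "j < 5" shows "(\<lambda>x. coef (hyp_frame x j) m) \<in> polyfuns 22 3"
proof -
  have "(\<lambda>x. hyp x j) \<in> polyfuns 22 1"
    unfolding hyp_def using assms by (intro polyfuns_add polyfuns_const polyfuns_coord) auto
  then have "(\<lambda>x. hyp x j * coef (lin (pt x 5) ^ 2) m) \<in> polyfuns 22 (1 + 2)"
    by (rule polyfuns_mult[OF _ lookup_pt_square_polyfuns]) simp
  then have "(\<lambda>x. coef (lin (pt x j) ^ 2) m +
      (- 1) * (hyp x j * coef (lin (pt x 5) ^ 2) m)) \<in> polyfuns 22 3"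
    using polyfuns_mono[OF lookup_pt_square_polyfuns[of j m], of 3] assms
    by (intro polyfuns_add polyfuns_scale) (auto simp: numeral_3_eq_3)
  then show ?thesis by (simp add: hyp_frame_def lookup_minus)
qed

lemma quad_functional_polyfuns:
  "(\<And>m. (\<lambda>x. coef (p x) m) \<in> polyfuns N D) \<Longrightarrow> (\<lambda>x. quad_functional c (p x)) \<in> polyfuns N D"
  unfolding quad_functional_def by (intro polyfuns_sum polyfuns_scale)

lemma quad_functional_hyp_frame:
  "quad_functional ((!) c) (hyp_frame x j) = quad_form c (pt x j) (pt x j) - hyp x j * quad_form c (pt x 5) (pt x 5)"
  by (simp add: hyp_frame_def quad_functional_diff_scale power2_eq_square quad_functional_lin_mult)

text \<open>Derivative at the origin, in direction \<open>y\<close>, of the functional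
  \<open>c\<close> on the \<open>j\<close>-th frame vector. The factors 2 come from differentiating
  squares, the last two terms from the product rule.\<close>

definition hyp_differential :: "complex list \<Rightarrow> nat \<Rightarrow> (nat \<Rightarrow> complex) \<Rightarrow> complex" where
  "hyp_differential c j y = 2 * quad_form c (pt_base j) (pt_dir y j) - y (17 + j) * quad_form c (pt_base 5) (pt_base 5) -
     2 * hyp_base j * quad_form c (pt_base 5) (pt_dir y 5)"

lemma quad_form_cong: "(\<And>l. l < 4 \<Longrightarrow> u l = u' l) \<Longrightarrow> (\<And>l. l < 4 \<Longrightarrow> v l = v' l) \<Longrightarrow> quad_form c u v = quad_form c u' v'"
  by (simp add: quad_form_expand)

lemma quad_form_pt:
  assumes "i < 6"
  shows "quad_form c (pt (\<lambda>k. t * y k) i) (pt (\<lambda>k. t * y k) i) = quad_form c (pt_base i) (pt_base i) +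
    t * (2 * quad_form c (pt_base i) (pt_dir y i) + t * quad_form c (pt_dir y i) (pt_dir y i))"
  unfolding quad_form_add[symmetric]
  by (rule quad_form_cong) (simp_all add: pt_def pt_dir_scale assms)

text \<open>The forms and the hyperplane coefficients are affine in \<open>t\<close>, so the value
  is a polynomial in \<open>t\<close>; \<open>R\<close> collects everything beyond first
  order.\<close>

lemma hyp_frame_line:
  assumes "j < 5"
  obtains R where "\<And>t. quad_functional ((!) c) (hyp_frame (\<lambda>k. t * y k) j) =
      frame_value c j +
      t * (hyp_differential c j y + t * R t)" "continuous_on UNIV R"
proof (rule that)
  define B where "B i = quad_form c (pt_base i) (pt_base i)" for i
  define M where "M i = quad_form c (pt_base i) (pt_dir y i)" for i
  define E where "E i = quad_form c (pt_dir y i) (pt_dir y i)" for i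
  define R where "R t = E j - hyp_base j * E 5 - y (17 + j) * (2 * M 5 + t * E 5)" for t
  show "quad_functional ((!) c) (hyp_frame (\<lambda>k. t * y k) j) =
      frame_value c j +
      t * (hyp_differential c j y + t * R t)" for t
    using assms
    by (simp add: quad_functional_hyp_frame quad_form_pt hyp_differential_def hyp_def R_def frame_value_def flip: B_def M_def E_def)
      (simp add: algebra_simps)
  show "continuous_on UNIV R" unfolding R_def by (intro continuous_intros)
qed

lemma frame_dual_base:
  assumes "i < 5" "j < 5"
  shows "frame_value (frame_dual ! i) j =
    (if i = j then 1 else 0)"
  using assms unfolding less_5_cases
  by (elim disjE) (simp_all add: frame_value_def quad_form_expand frame_dual_def pt_base_def hyp_base_def)

lemma square_dual_base:
  assumes "i < 6" "j < 6"
  shows "quad_form (square_dual ! i) (pt_base j) (pt_base j) = (if i = j then 1 else 0)"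
  using assms unfolding less_6_cases
  by (elim disjE) (simp_all add: quad_form_expand square_dual_def pt_base_def)

lemma less_22_cases: "l < 22 \<longleftrightarrow> l = 0 \<or> l = 1 \<or> l = 2 \<or> l = 3 \<or> l = 4 \<or> l = 5 \<or> l = 6 \<or> l = 7 \<or> l = 8 \<or> l = 9 \<or>
    l = 10 \<or> l = 11 \<or> l = 12 \<or> l = 13 \<or> l = 14 \<or> l = 15 \<or> l = 16 \<or> l = 17 \<or> l = 18 \<or> l = 19 \<or> l = 20 \<or> l = (21::nat)"
  by presburger

lemma tangent_dual_base:
  assumes "l < 22" "(i, c) \<in> set (tangent_dual ! l)"
  shows "i < 5" "j < 5 \<Longrightarrow> frame_value c j = 0"
proof -
  have "\<forall>(i, c)\<in>set (concat tangent_dual). i < 5 \<and>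
    (\<forall>j<5. frame_value c j = 0)"
    unfolding less_5_cases by (auto simp: tangent_dual_def frame_value_def quad_form_expand pt_base_def hyp_base_def)
  moreover have "(i, c) \<in> set (concat tangent_dual)"
  proof -
    have "length tangent_dual = 22" by (simp add: tangent_dual_def)
    then have "tangent_dual ! l \<in> set tangent_dual" using assms(1) by simp
    then show ?thesis using assms(2) by auto
  qed
  ultimately show "i < 5" "j < 5 \<Longrightarrow> frame_value c j = 0"
    by blast+
qed

lemma tangent_dual_differential:
  assumes "l < 22"
  shows "(\<Sum>(i, c)\<leftarrow>tangent_dual ! l. hyp_differential c i y) = y l"
  using assms unfolding less_22_cases
  by (elim disjE) (simp_all add: tangent_dual_def hyp_differential_def quad_form_expand pt_base_def pt_dir_def hyp_base_def add_divide_distrib)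

lemma frame_dual_lim:
  assumes "i < 5" "j < 5"
  shows "((\<lambda>t. quad_functional ((!) (frame_dual ! i)) (hyp_frame (\<lambda>k. t * y k) j)) \<longlongrightarrow> (if i = j then 1 else 0)) (at 0)"
proof -
  obtain R where R: "\<And>t. quad_functional ((!) (frame_dual ! i)) (hyp_frame (\<lambda>k. t * y k) j) =
      (if i = j then 1 else 0) + t * (hyp_differential (frame_dual ! i) j y + t * R t)" "continuous_on UNIV R"
    using hyp_frame_line[OF assms(2), of "frame_dual ! i" y] unfolding frame_dual_base[OF assms] by blast
  have "(R \<longlongrightarrow> R 0) (at 0)" using R(2) by (simp add: continuous_on_def)
  then have "((\<lambda>t. (if i = j then 1 else 0) + t * (hyp_differential (frame_dual ! i) j y + t * R t)) \<longlongrightarrow>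
      (if i = j then 1 else 0) + 0 * (hyp_differential (frame_dual ! i) j y + 0 * R 0)) (at 0)"
    by (intro tendsto_intros)
  then show ?thesis unfolding R(1) by simp
qed

text \<open>In the minor built from \<open>frame_dual\<close>, row \<open>i\<close> is exchanged for
  \<open>c\<close>. As \<open>c\<close> annihilates the frame at the origin, this row is divisible
  by \<open>t\<close>. After the division it tends to the differentials and the other rows to those
  of the identity, so the determinant tends to the diagonal entry.\<close>

lemma tangent_form:
  assumes i: "i < 5"
    and c: "\<And>j. j < 5 \<Longrightarrow> frame_value c j = 0"
  shows "\<exists>h\<in>pforms 3 2 5 1. \<forall>y. ((\<lambda>t. h (pluecker 5 (hyp_frame (\<lambda>k. t * y k))) / t) \<longlongrightarrow> hyp_differential c i y) (at 0)"
proof -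
  define C where "C i' = (if i' = i then (!) c else (!) (frame_dual ! i'))" for i'
  obtain h where h: "h \<in> pforms 3 2 5 1"
    "\<And>b. h (pluecker 5 b) = det (mat 5 5 (\<lambda>(i, j). quad_functional (C i) (b j)))"
    using pform_det_quad[of 5 C] by blast
  have "((\<lambda>t. h (pluecker 5 (hyp_frame (\<lambda>k. t * y k))) / t) \<longlongrightarrow> hyp_differential c i y) (at 0)" for y
  proof -
    define f where "f t i' j = (if i' = i then quad_functional ((!) c) (hyp_frame (\<lambda>k. t * y k) j) / t
      else quad_functional (C i') (hyp_frame (\<lambda>k. t * y k) j))" for t i' j
    have "((\<lambda>t. det (mat 5 5 (\<lambda>(i', j). f t i' j))) \<longlongrightarrow>
      det (mat 5 5 (\<lambda>(i', j). if i' = i then hyp_differential c j y else if i' = j then 1 else 0))) (at 0)"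
    proof (rule tendsto_det)
      fix i' j :: nat assume ij: "i' < 5" "j < 5"
      show "((\<lambda>t. f t i' j) \<longlongrightarrow> (if i' = i then hyp_differential c j y else if i' = j then 1 else 0)) (at 0)"
      proof (cases "i' = i")
        case True
        obtain R where R: "\<And>t. quad_functional ((!) c) (hyp_frame (\<lambda>k. t * y k) j) =
            0 + t * (hyp_differential c j y + t * R t)" "continuous_on UNIV R"
          using hyp_frame_line[OF ij(2), of c y] unfolding c[OF ij(2)] by blast
        have "(R \<longlongrightarrow> R 0) (at 0)" using R(2) by (simp add: continuous_on_def)
        then have "((\<lambda>t. hyp_differential c j y + t * R t) \<longlongrightarrow> hyp_differential c j y + 0 * R 0) (at 0)"
          by (intro tendsto_intros)
        moreover have "\<forall>\<^sub>F t in at 0. hyp_differential c j y + t * R t = f t i' j"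
          using True by (simp add: eventually_at_filter f_def R(1))
        ultimately show ?thesis using True by (simp add: tendsto_cong)
      next
        case False
        then show ?thesis using frame_dual_lim[OF ij, of y] by (simp add: f_def C_def)
      qed
    qed
    moreover have "det (mat 5 5 (\<lambda>(i', j). if i' = i then hyp_differential c j y else if i' = j then 1 else 0)) =
      hyp_differential c i y" by (rule det_replace_row[OF i])
    moreover have "\<forall>\<^sub>F t in at 0. det (mat 5 5 (\<lambda>(i', j). f t i' j)) = h (pluecker 5 (hyp_frame (\<lambda>k. t * y k))) / t"
    proof -
      have "h (pluecker 5 (hyp_frame (\<lambda>k. t * y k))) = t * det (mat 5 5 (\<lambda>(i', j). f t i' j))" if "t \<noteq> 0" for t
      proof -
        have "mat 5 5 (\<lambda>(i', j). quad_functional (C i') (hyp_frame (\<lambda>k. t * y k) j)) =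
            multrow i t (mat 5 5 (\<lambda>(i', j). f t i' j))"
          using that by (intro eq_matI) (auto simp: f_def C_def)
        then show ?thesis unfolding h(2) by (simp add: det_multrow[OF i])
      qed
      then show ?thesis by (simp add: eventually_at_filter)
    qed
    ultimately show ?thesis by (simp add: tendsto_cong)
  qed
  with h(1) show ?thesis by blast
qed

text \<open>Forms of degree 1 can be added, so functionals attached to different rows may be
  combined. This helps to separate the motion of the last form, which affects the frame vectors 3
  and 4 together, from that of forms 3 and 4.\<close>

lemma tangent_forms_sum:
  assumes "\<And>i c. (i, c) \<in> set cs \<Longrightarrow> i < 5"
    and "\<And>i c j. (i, c) \<in> set cs \<Longrightarrow> j < 5 \<Longrightarrow>
      frame_value c j = 0"
  shows "\<exists>h\<in>pforms 3 2 5 1. \<forall>y. ((\<lambda>t. h (pluecker 5 (hyp_frame (\<lambda>k. t * y k))) / t) \<longlongrightarrow>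
    (\<Sum>(i, c)\<leftarrow>cs. hyp_differential c i y)) (at 0)"
  using assms
proof (induction cs)
  case Nil
  show ?case by (rule bexI[OF _ pforms_zero]) simp
next
  case (Cons a cs)
  obtain i c where a: "a = (i, c)" by fastforce
  obtain h where h: "h \<in> pforms 3 2 5 1"
    "\<And>y. ((\<lambda>t. h (pluecker 5 (hyp_frame (\<lambda>k. t * y k))) / t) \<longlongrightarrow> hyp_differential c i y) (at 0)"
  proof -
    have "i < 5" "\<And>j. j < 5 \<Longrightarrow>
        frame_value c j = 0"
      using Cons.prems[of i c] a by simp_all
    from tangent_form[OF this] that show thesis by blast
  qed
  obtain h' where h': "h' \<in> pforms 3 2 5 1"
    "\<And>y. ((\<lambda>t. h' (pluecker 5 (hyp_frame (\<lambda>k. t * y k))) / t) \<longlongrightarrow> (\<Sum>(i, c)\<leftarrow>cs. hyp_differential c i y)) (at 0)"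
  proof -
    have "\<exists>h\<in>pforms 3 2 5 1. \<forall>y. ((\<lambda>t. h (pluecker 5 (hyp_frame (\<lambda>k. t * y k))) / t) \<longlongrightarrow>
        (\<Sum>(i, c)\<leftarrow>cs. hyp_differential c i y)) (at 0)"
    proof (rule Cons.IH)
      show "i < 5" if "(i, c) \<in> set cs" for i c
        using that Cons.prems(1)[of i c] by simp
      show "frame_value c j = 0"
        if "(i, c) \<in> set cs" "j < 5" for i c j
        using that Cons.prems(2)[of i c j] by simp
    qed
    with that show thesis by blast
  qed
  show ?case
    by (rule bexI[OF _ pforms_add[OF h(1) h'(1)]])
      (use tendsto_add[OF h(2) h'(2)] in \<open>simp add: a add_divide_distrib\<close>)
qed

theorem krull_dim_Sigma_ge: "enat 22 \<le> krull_dim (subtopology (zariski_Gr 3 2 5) (Sigma_var 3 2 5 6))"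
proof -
  interpret homogeneous_coordinates "subtopology (zariski_Gr 3 2 5) (Sigma_var 3 2 5 6)" "pforms 3 2 5" "prel 5"
    by (rule homogeneous_coordinates_Gr[OF _ Sigma_var_subset]) simp
  have poly: "(\<lambda>x. h (pluecker 5 (hyp_frame x))) \<in> polyfuns 22 (15 * m)" if "h \<in> pforms 3 2 5 m" for m h
    using pform_polyfuns[OF that, where N = 22 and D = 3 and b = hyp_frame] hyp_frame_polyfuns by simp
  \<comment> \<open>\<open>G1 x \<noteq> 0\<close> makes the frame independent and
    \<open>G2 x \<noteq> 0\<close> the six squares; together they place the span of the frame in
    \<open>Sigma_var\<close>.\<close>
  define G1 where "G1 x = det (mat 5 5 (\<lambda>(i, j). quad_functional ((!) (frame_dual ! i)) (hyp_frame x j)))" for x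
  define G2 where "G2 x = det (mat 6 6 (\<lambda>(i, j). quad_functional ((!) (square_dual ! i)) (lin (pt x j) ^ 2)))" for x
  have "G1 \<in> polyfuns 22 (5 * 3)" "G2 \<in> polyfuns 22 (6 * 2)"
    unfolding G1_def[abs_def] G2_def[abs_def]
    by (intro polyfuns_det quad_functional_polyfuns hyp_frame_polyfuns lookup_pt_square_polyfuns; assumption)+
  from polyfuns_mult[OF this] have G: "(\<lambda>x. G1 x * G2 x) \<in> polyfuns 22 (5 * 3 + 6 * 2)" .
  obtain f0 where f0: "f0 \<in> pforms 3 2 5 1" "\<And>x. f0 (pluecker 5 (hyp_frame x)) = G1 x"
    using pform_det_quad[of 5 "\<lambda>i. (!) (frame_dual ! i)"] unfolding G1_def by metis
  have f0_lim: "((\<lambda>t. f0 (pluecker 5 (hyp_frame (\<lambda>i. t * y i)))) \<longlongrightarrow> 1) (at 0)" for y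
  proof -
    have "((\<lambda>t. G1 (\<lambda>i. t * y i)) \<longlongrightarrow> det (mat 5 5 (\<lambda>(i, j). if i = j then 1 else 0))) (at 0)"
      unfolding G1_def by (intro tendsto_det frame_dual_lim)
    moreover have "mat 5 5 (\<lambda>(i, j). if i = j then 1 else 0 :: complex) = 1\<^sub>m 5" by (rule eq_matI) auto
    ultimately show ?thesis by (simp add: f0(2))
  qed
  have "\<exists>h\<in>pforms 3 2 5 1. \<forall>y. ((\<lambda>t. h (pluecker 5 (hyp_frame (\<lambda>k. t * y k))) / t) \<longlongrightarrow> y l) (at 0)" if l: "l < 22" for l
    using tangent_forms_sum[of "tangent_dual ! l"] tangent_dual_base[OF l] tangent_dual_differential[OF l] by simp
  then have "\<forall>l. \<exists>h. l < 22 \<longrightarrow> h \<in> pforms 3 2 5 1 \<and>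
      (\<forall>y. ((\<lambda>t. h (pluecker 5 (hyp_frame (\<lambda>k. t * y k))) / t) \<longlongrightarrow> y l) (at 0))" by blast
  from choice[OF this] obtain f where f: "\<And>l. l < 22 \<Longrightarrow> f l \<in> pforms 3 2 5 1"
    "\<And>l y. l < 22 \<Longrightarrow> ((\<lambda>t. f l (pluecker 5 (hyp_frame (\<lambda>k. t * y k))) / t) \<longlongrightarrow> y l) (at 0)" by blast
  show ?thesis
  proof (rule krull_dim_ge[OF poly G, where f = f and ?f0.0 = f0])
    have "G1 (\<lambda>_. 0) = 1"
    proof -
      have "mat 5 5 (\<lambda>(i, j). quad_functional ((!) (frame_dual ! i)) (hyp_frame (\<lambda>_. 0) j)) = 1\<^sub>m 5"
      proof (rule eq_matI)
        fix i j assume "i < dim_row (1\<^sub>m 5)" "j < dim_col (1\<^sub>m 5)"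
        then have ij: "i < 5" "j < 5" by auto
        have "quad_functional ((!) (frame_dual ! i)) (hyp_frame (\<lambda>_. 0) j) = (if i = j then 1 else 0)"
          using hyp_frame_line[OF ij(2), of "frame_dual ! i" "\<lambda>_. 0"] frame_dual_base[OF ij]
          by (metis add.right_neutral mult_zero_left)
        then show "mat 5 5 (\<lambda>(i, j). quad_functional ((!) (frame_dual ! i)) (hyp_frame (\<lambda>_. 0) j)) $$ (i, j) = 1\<^sub>m 5 $$ (i, j)"
          using ij by simp
      qed auto
      then show ?thesis by (simp add: G1_def)
    qed
    moreover have "G2 (\<lambda>_. 0) = 1"
    proof -
      have "mat 6 6 (\<lambda>(i, j). quad_functional ((!) (square_dual ! i)) (lin (pt (\<lambda>_. 0) j) ^ 2)) = 1\<^sub>m 6"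
      proof (rule eq_matI)
        fix i j assume "i < dim_row (1\<^sub>m 6)" "j < dim_col (1\<^sub>m 6)"
        then have ij: "i < 6" "j < 6" by auto
        have "quad_functional ((!) (square_dual ! i)) (lin (pt (\<lambda>_. 0) j) ^ 2) = (if i = j then 1 else 0)"
          using quad_form_pt[OF ij(2), of "square_dual ! i" 0 "\<lambda>_. 0"] square_dual_base[OF ij]
          by (simp add: power2_eq_square quad_functional_lin_mult)
        then show "mat 6 6 (\<lambda>(i, j). quad_functional ((!) (square_dual ! i)) (lin (pt (\<lambda>_. 0) j) ^ 2)) $$ (i, j) = 1\<^sub>m 6 $$ (i, j)"
          using ij by simp
      qed auto
      then show ?thesis by (simp add: G2_def)
    qed
    ultimately show "G1 (\<lambda>_. 0) * G2 (\<lambda>_. 0) \<noteq> 0" by simp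
    show "\<exists>L\<in>topspace (subtopology (zariski_Gr 3 2 5) (Sigma_var 3 2 5 6)). prel 5 L (pluecker 5 (hyp_frame x))"
      if "G1 x * G2 x \<noteq> 0" for x
    proof -
      have G12: "G1 x \<noteq> 0" "G2 x \<noteq> 0" using that by auto
      note ind = independent_of_quad_det[OF G12(1)[unfolded G1_def]]
      note sq = independent_of_quad_det[OF G12(2)[unfolded G2_def]]
      define Q where "Q = (\<lambda>i. lin (pt x i)) ` {..<6}"
      have inj: "inj_on (\<lambda>i. lin (pt x i)) {..<6}"
        using sq(1) by (auto simp: inj_on_def)
      have img: "(\<lambda>q. q ^ 2) ` Q = (\<lambda>i. lin (pt x i) ^ 2) ` {..<6}" by (auto simp: Q_def)
      have Q: "Q \<in> power_independent_sets 3 2 6"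
        unfolding power_independent_sets_def
      proof (intro CollectI conjI)
        show "finite Q" "card Q = 6" using inj by (simp_all add: Q_def card_image)
        show "Q \<subseteq> forms_space 3 1" unfolding Q_def by (rule image_subsetI) (rule lin_form)
        show "inj_on (\<lambda>q. q ^ 2) Q" using sq(1) by (auto simp: Q_def inj_on_def)
        show "cpoly.independent ((\<lambda>q. q ^ 2) ` Q)" unfolding img by (rule sq(2))
      qed
      have span: "hyp_frame x j \<in> cpoly.span ((\<lambda>q. q ^ 2) ` Q)" if "j < 5" for j
        unfolding hyp_frame_def img using that
        by (intro cpoly.span_diff cpoly.span_scale cpoly.span_base) auto
      have "hyp_frame x j \<in> forms_space 3 2" for j
        unfolding hyp_frame_def power2_eq_square
        by (intro cpoly.subspace_diff cpoly.subspace_scale forms_space_subspace lin_mult_form)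
      note L = Grassmannian_span[OF ind this]
      have "cpoly.span (hyp_frame x ` {..<5}) \<subseteq> cpoly.span ((\<lambda>q. q ^ 2) ` Q)"
        using span by (intro cpoly.span_minimal cpoly.subspace_span) auto
      then have "cpoly.span (hyp_frame x ` {..<5}) \<in> Sigma_var 3 2 5 6"
        using L(1) Q by (auto simp: Sigma_var_def)
      then show ?thesis using L(2) unfolding topspace_Sigma prel_def by blast
    qed
  qed (use f f0(1) f0_lim in auto)
qed

theorem theorem4p6:
  shows "codim_in (zariski_Gr 3 2 5) (Sigma_var 3 2 5 6) = 3 \<and>
    N1 3 5 6 = 23 \<and> N2 3 2 5 = 25 \<and> krull_dim (zariski_Gr 3 2 5) = enat (N2 3 2 5)"
proof -
  have "krull_dim (subtopology (zariski_Gr 3 2 5) (Sigma_var 3 2 5 6)) = enat 22"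
    by (rule antisym[OF krull_dim_Sigma_le krull_dim_Sigma_ge])
  then have "codim_in (zariski_Gr 3 2 5) (Sigma_var 3 2 5 6) = 3"
    by (simp add: codim_in_def krull_dim_Gr numeral_eq_enat)
  moreover have "N2 3 2 5 = 25"
    by (simp add: N2_def numeral_eq_Suc)
  ultimately show ?thesis
    by (simp add: N1_def krull_dim_Gr numeral_eq_enat)
qed

end
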